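(* Let $M$ be a Riemannian manifold, $\mathcal{F}$ a foliation on $M$ with closed leaves, and $p>1$. Assume that an extremal function $f_0$ for the $p$-modulus of $\mathcal{F}$ exists, is $C^2$-smooth, and satisfies $\mathrm{ess\,inf}_M f_0>0$. Then the mean curvature $H_{\mathcal{F}^\perp}$ of the distribution $\mathcal{F}^\perp$ orthogonal to $\mathcal{F}$ is of the form $$H_{\mathcal{F}^\perp}=(p-1)\,(\nabla(\ln f_0))^\top .$$ In particular, $f_0$ is constant on the leaves of $\mathcal{F}$ (hence $f_0=\frac{1}{\hat 1}$) if and only if the distribution $\mathcal{F}^\perp$ is minimal.
   Context: $\mu_M$ and $\mu_L$ denote the Lebesgue (Riemannian volume) measures on $M$ and on a leaf $L\in\mathcal{F}$; $L_x$ is the leaf through $x\in M$, and $\hat 1(x)=\int_{L_x}1\,d\mu_{L_x}=\mu_{L_x}(L_x)$. $(\cdot)^\top$ denotes the component tangent to $\mathcal{F}$. The mean curvature $H_{\mathcal{F}^\perp}$ is the (unnormalized) trace $\sum_\alpha(\nabla_{e_\alpha}e_\alpha)^\top$ over a local orthonormal frame $(e_\alpha)$ of $\mathcal{F}^\perp$; equivalently, it is the vector field tangent to $\mathcal{F}$ satisfying $\mathrm{div}_{\mathcal{F}}X=\mathrm{div}X+\langle H_{\mathcal{F}^\perp},X\rangle$ for every vector field $X$ tangent to $\mathcal{F}$, where $\mathrm{div}_{\mathcal{F}}$ is the divergence along the leaves. $\mathcal{F}^\perp$ is minimal if $H_{\mathcal{F}^\perp}=0$. Modulus: a property holds for almost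 every $L\in\mathcal{F}$ if the union of the leaves for which it fails has $\mu_M$-measure zero. $\mathrm{adm}_p(\mathcal{F})$ is the family of all nonnegative $f\in L^p(M)$ such that $\int_L f\,d\mu_L\geq 1$ for almost every $L\in\mathcal{F}$; $\mathrm{mod}_p(\mathcal{F})=\inf_{f\in\mathrm{adm}_p(\mathcal{F})}\|f\|_p$ if $\mathrm{adm}_p(\mathcal{F})\neq\emptyset$ and $\mathrm{mod}_p(\mathcal{F})=\infty$ otherwise. A function $f_0\in\mathrm{adm}_p(\mathcal{F})$ is extremal for the $p$-modulus of $\mathcal{F}$ if $\mathrm{mod}_p(\mathcal{F})=\|f_0\|_p$.
   Formalization: The equality f_0 = 1/\hat 1 is stated on almost every leaf, not at every point: on the flat Möbius band foliated by circles, f_0 = 1/(2l) is extremal, while \hat 1 = l on the core circle, so pointwise equality fails there. *)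

theory Defs
  imports "HOL-Analysis.Analysis" "HOL-Probability.Essential_Supremum"
begin

section \<open>Smooth maps between open sets\<close>

text \<open>Intended for open \<open>S\<close> and a finite-dimensional domain. There, continuity of all iterated
  directional derivatives is the usual notion of \<open>C\<^sup>k\<close>.\<close>

primrec Ck_on ::
  "nat \<Rightarrow> 'a::real_normed_vector set \<Rightarrow> ('a \<Rightarrow> 'b::real_normed_vector) \<Rightarrow> bool" where
  "Ck_on 0 S f \<longleftrightarrow> continuous_on S f"
| "Ck_on (Suc k) S f \<longleftrightarrow>
     (\<forall>x\<in>S. f differentiable (at x)) \<and> (\<forall>v. Ck_on k S (\<lambda>x. frechet_derivative f (at x) v))"

definition smooth_on ::
  "'a::real_normed_vector set \<Rightarrow> ('a \<Rightarrow> 'b::real_normed_vector) \<Rightarrow> bool" where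
  "smooth_on S f \<longleftrightarrow> (\<forall>k. Ck_on k S f)"


section \<open>Smooth manifolds\<close>

text \<open>The manifold is the whole type \<open>'m\<close> (Hausdorff and second countable, by its sort), of
  dimension \<open>CARD('n)\<close>. A chart is a pair of a domain and a coordinate map; the values
  of the map outside of the domain are irrelevant.\<close>

type_synonym ('m, 'n) chart = "'m set \<times> ('m \<Rightarrow> real ^ 'n)"

abbreviation chart_dom :: "('m, 'n::finite) chart \<Rightarrow> 'm set" where
  "chart_dom c \<equiv> fst c"

abbreviation chart_map :: "('m, 'n::finite) chart \<Rightarrow> 'm \<Rightarrow> real ^ 'n" where
  "chart_map c \<equiv> snd c"

definition chart_img :: "('m, 'n::finite) chart \<Rightarrow> (real ^ 'n) set" where
  "chart_img c = chart_map c ` chart_dom c"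

definition chart_inv :: "('m, 'n::finite) chart \<Rightarrow> real ^ 'n \<Rightarrow> 'm" where
  "chart_inv c = inv_into (chart_dom c) (chart_map c)"

definition is_chart :: "('m::topological_space, 'n::finite) chart \<Rightarrow> bool" where
  "is_chart c \<longleftrightarrow> open (chart_dom c) \<and> open (chart_img c) \<and>
     homeomorphism (chart_dom c) (chart_img c) (chart_map c) (chart_inv c)"

definition smooth_compat :: "('m, 'n::finite) chart \<Rightarrow> ('m, 'n) chart \<Rightarrow> bool" where
  "smooth_compat c d \<longleftrightarrow>
     smooth_on (chart_map c ` (chart_dom c \<inter> chart_dom d)) (chart_map d \<circ> chart_inv c) \<and>
     smooth_on (chart_map d ` (chart_dom c \<inter> chart_dom d)) (chart_map c \<circ> chart_inv d)"

text \<open>A smooth structure is a maximal smooth atlas.\<close>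

definition smooth_structure ::
  "('m::{t2_space, second_countable_topology}, 'n::finite) chart set \<Rightarrow> bool" where
  "smooth_structure A \<longleftrightarrow>
     (\<forall>c\<in>A. is_chart c) \<and> (\<Union>c\<in>A. chart_dom c) = UNIV \<and>
     (\<forall>c\<in>A. \<forall>d\<in>A. smooth_compat c d) \<and>
     (\<forall>c. is_chart c \<and> (\<forall>d\<in>A. smooth_compat c d) \<longrightarrow> c \<in> A)"

definition Ck_fun :: "('m, 'n::finite) chart set \<Rightarrow> nat \<Rightarrow> ('m \<Rightarrow> real) \<Rightarrow> bool" where
  "Ck_fun A k f \<longleftrightarrow> (\<forall>c\<in>A. Ck_on k (chart_img c) (f \<circ> chart_inv c))"


section \<open>Riemannian metrics\<close>

text \<open>Tensor fields are given by their components: \<open>g c z\<close> is the Gram matrix of the coordinate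
  vector fields of the chart \<open>c\<close> at the point with coordinates \<open>z\<close>. Components in two
  charts are related by the covariant transformation law.\<close>

type_synonym ('m, 'n) metric = "('m, 'n) chart \<Rightarrow> real ^ 'n \<Rightarrow> real ^ 'n ^ 'n"

definition riemannian_metric :: "('m, 'n::finite) chart set \<Rightarrow> ('m, 'n) metric \<Rightarrow> bool" where
  "riemannian_metric A g \<longleftrightarrow>
     (\<forall>c\<in>A. smooth_on (chart_img c) (g c) \<and>
        (\<forall>z\<in>chart_img c. transpose (g c z) = g c z \<and> (\<forall>v. v \<noteq> 0 \<longrightarrow> v \<bullet> (g c z *v v) > 0))) \<and>
     (\<forall>c\<in>A. \<forall>d\<in>A. \<forall>x\<in>chart_dom c \<inter> chart_dom d.
        let J = matrix (frechet_derivative (chart_map d \<circ> chart_inv c) (at (chart_map c x)))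
        in g c (chart_map c x) = transpose J ** g d (chart_map d x) ** J)"

definition metric_ip ::
  "('m, 'n::finite) metric \<Rightarrow> ('m, 'n) chart \<Rightarrow> real ^ 'n \<Rightarrow> real ^ 'n \<Rightarrow> real ^ 'n \<Rightarrow> real" where
  "metric_ip g c z u v = u \<bullet> (g c z *v v)"

definition partial :: "'n \<Rightarrow> (real ^ 'n \<Rightarrow> real) \<Rightarrow> real ^ 'n::finite \<Rightarrow> real" where
  "partial i f z = frechet_derivative f (at z) (axis i 1)"

definition christoffel ::
  "('m, 'n::finite) metric \<Rightarrow> ('m, 'n) chart \<Rightarrow> 'n \<Rightarrow> 'n \<Rightarrow> 'n \<Rightarrow> real ^ 'n \<Rightarrow> real" where
  "christoffel g c k i j z =
     (\<Sum>l\<in>UNIV. matrix_inv (g c z) $ k $ l *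
        (partial i (\<lambda>w. g c w $ j $ l) z + partial j (\<lambda>w. g c w $ i $ l) z
         - partial l (\<lambda>w. g c w $ i $ j) z)) / 2"

text \<open>The Levi-Civita derivative \<open>\<nabla>\<^sub>X Y\<close>.\<close>

definition cov_deriv ::
  "('m, 'n::finite) metric \<Rightarrow> ('m, 'n) chart \<Rightarrow> (real ^ 'n \<Rightarrow> real ^ 'n) \<Rightarrow>
    (real ^ 'n \<Rightarrow> real ^ 'n) \<Rightarrow> real ^ 'n \<Rightarrow> real ^ 'n" where
  "cov_deriv g c X Y z = frechet_derivative Y (at z) (X z) +
     (\<chi> k. \<Sum>i\<in>UNIV. \<Sum>j\<in>UNIV. christoffel g c k i j z * X z $ i * Y z $ j)"

definition gradient ::
  "('m, 'n::finite) metric \<Rightarrow> ('m, 'n) chart \<Rightarrow> ('m \<Rightarrow> real) \<Rightarrow> real ^ 'n \<Rightarrow> real ^ 'n" where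
  "gradient g c f z = matrix_inv (g c z) *v (\<chi> i. partial i (f \<circ> chart_inv c) z)"

text \<open>The volume measure is characterized by its values on Borel sets inside a chart
  domain; as countably many chart domains cover the manifold, this determines it.\<close>

definition riemannian_volume ::
  "('m::topological_space, 'n::finite) chart set \<Rightarrow> ('m, 'n) metric \<Rightarrow> 'm measure \<Rightarrow> bool" where
  "riemannian_volume A g \<mu> \<longleftrightarrow> sets \<mu> = sets borel \<and>
     (\<forall>c\<in>A. \<forall>E\<in>sets borel. E \<subseteq> chart_dom c \<longrightarrow>
        emeasure \<mu> E =
          (\<integral>\<^sup>+ z. indicator (chart_map c ` E) z * ennreal (sqrt (det (g c z))) \<partial>lborel))"


section \<open>Foliations\<close>

text \<open>Throughout, \<open>B\<close> is the set of indices of the coordinates along the leaves, so \<open>card B\<close> is the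
  dimension of the foliation and \<open>card (- B)\<close> its codimension.\<close>

definition plaque :: "'n set \<Rightarrow> ('m, 'n::finite) chart \<Rightarrow> 'm \<Rightarrow> 'm set" where
  "plaque B c x = {y \<in> chart_dom c. \<forall>i\<in>-B. chart_map c y $ i = chart_map c x $ i}"

definition foliated_charts ::
  "('m::topological_space, 'n::finite) chart set \<Rightarrow> 'n set \<Rightarrow> 'm set set \<Rightarrow> ('m, 'n) chart set"
where
  "foliated_charts A B \<F> = {c \<in> A. (\<exists>a b. chart_img c = box a b) \<and>
     (\<forall>L\<in>\<F>. components (chart_dom c \<inter> L) \<subseteq> plaque B c ` chart_dom c)}"

text \<open>A foliation is the set of its leaves. Leaves are path connected for the topology of \<open>'m\<close>:
  mere connectedness would admit unions of several dense leaves, whereas a path inside \<open>L\<close>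
  stays, locally, inside one plaque.\<close>

definition foliation ::
  "('m::topological_space, 'n::finite) chart set \<Rightarrow> 'n set \<Rightarrow> 'm set set \<Rightarrow> bool" where
  "foliation A B \<F> \<longleftrightarrow> \<Union>\<F> = UNIV \<and> disjoint \<F> \<and> {} \<notin> \<F> \<and> (\<forall>L\<in>\<F>. path_connected L) \<and>
     (\<forall>x. \<exists>c\<in>foliated_charts A B \<F>. x \<in> chart_dom c)"

definition leaf_of :: "'m set set \<Rightarrow> 'm \<Rightarrow> 'm set" where
  "leaf_of \<F> x = (THE L. L \<in> \<F> \<and> x \<in> L)"

text \<open>The block of \<open>G\<close> with indices in \<open>B\<close>, completed by an identity block; its determinant is
  the Gram determinant of the coordinate vector fields along the leaves.\<close>

definition leaf_block :: "'n set \<Rightarrow> real ^ 'n ^ 'n \<Rightarrow> real ^ 'n ^ 'n::finite" where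
  "leaf_block B G = (\<chi> i j. if i \<in> B \<and> j \<in> B then G $ i $ j else if i = j then 1 else 0)"

definition slice_point :: "'n set \<Rightarrow> real ^ 'n \<Rightarrow> ('n \<Rightarrow> real) \<Rightarrow> real ^ 'n::finite" where
  "slice_point B a y = (\<chi> i. if i \<in> B then y i else a $ i)"

text \<open>The volume measure of a leaf for the induced metric, as a Borel measure on the ambient
  manifold concentrated on the leaf; countably many plaques cover the leaf.\<close>

definition leaf_volume ::
  "('m::topological_space, 'n::finite) chart set \<Rightarrow> ('m, 'n) metric \<Rightarrow> 'n set \<Rightarrow> 'm set set \<Rightarrow>
    'm set \<Rightarrow> 'm measure \<Rightarrow> bool" where
  "leaf_volume A g B \<F> L \<nu> \<longleftrightarrow> sets \<nu> = sets borel \<and> emeasure \<nu> (- L) = 0 \<and>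
     (\<forall>c\<in>foliated_charts A B \<F>. \<forall>x\<in>chart_dom c \<inter> L. \<forall>E\<in>sets borel. E \<subseteq> plaque B c x \<inter> L \<longrightarrow>
        emeasure \<nu> E =
          (\<integral>\<^sup>+ y. indicator (chart_map c ` E) (slice_point B (chart_map c x) y) *
                 ennreal (sqrt (det (leaf_block B (g c (slice_point B (chart_map c x) y)))))
           \<partial>Pi\<^sub>M B (\<lambda>_. lborel)))"


section \<open>Mean curvature of the orthogonal distribution\<close>

text \<open>In a foliated chart the tangent space of the foliation is spanned by the coordinate vectors
  with index in \<open>B\<close>. Vector fields are therefore described by their components in
  foliated charts, which cover the manifold.\<close>

definition leaf_tangent :: "'n set \<Rightarrow> (real ^ 'n::finite) set" where
  "leaf_tangent B = span ((\<lambda>i. axis i 1) ` B)"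

definition tangential ::
  "'n set \<Rightarrow> ('m, 'n::finite) metric \<Rightarrow> ('m, 'n) chart \<Rightarrow> real ^ 'n \<Rightarrow> real ^ 'n \<Rightarrow> real ^ 'n" where
  "tangential B g c z v =
     (THE u. u \<in> leaf_tangent B \<and> (\<forall>w\<in>leaf_tangent B. metric_ip g c z (v - u) w = 0))"

text \<open>Local orthonormal frames of the orthogonal distribution, in coordinates, on an open set \<open>V\<close>
  and indexed by the transverse indices \<open>- B\<close>.\<close>

definition perp_frame ::
  "'n set \<Rightarrow> ('m, 'n::finite) metric \<Rightarrow> ('m, 'n) chart \<Rightarrow> (real ^ 'n) set \<Rightarrow>
    ('n \<Rightarrow> real ^ 'n \<Rightarrow> real ^ 'n) \<Rightarrow> bool" where
  "perp_frame B g c V e \<longleftrightarrow> open V \<and> V \<subseteq> chart_img c \<and> (\<forall>\<alpha>\<in>-B. smooth_on V (e \<alpha>)) \<and>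
     (\<forall>z\<in>V. \<forall>\<alpha>\<in>-B.
        (\<forall>w\<in>leaf_tangent B. metric_ip g c z (e \<alpha> z) w = 0) \<and>
        (\<forall>\<beta>\<in>-B. metric_ip g c z (e \<alpha> z) (e \<beta> z) = (if \<alpha> = \<beta> then 1 else 0)))"

definition mean_curv_perp ::
  "'n set \<Rightarrow> ('m, 'n::finite) metric \<Rightarrow> ('m, 'n) chart \<Rightarrow> real ^ 'n \<Rightarrow> real ^ 'n" where
  "mean_curv_perp B g c z =
     (THE h. \<exists>V e. z \<in> V \<and> perp_frame B g c V e \<and>
        h = (\<Sum>\<alpha>\<in>-B. tangential B g c z (cov_deriv g c (e \<alpha>) (e \<alpha>) z)))"

definition perp_minimal ::
  "('m::topological_space, 'n::finite) chart set \<Rightarrow> ('m, 'n) metric \<Rightarrow> 'n set \<Rightarrow> 'm set set \<Rightarrow> bool"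
where
  "perp_minimal A g B \<F> \<longleftrightarrow>
     (\<forall>c\<in>foliated_charts A B \<F>. \<forall>z\<in>chart_img c. mean_curv_perp B g c z = 0)"


section \<open>Modulus of a foliation\<close>

text \<open>Here \<open>\<mu>\<close> is the volume measure of the manifold and \<open>\<nu> L\<close> the one of the leaf \<open>L\<close>. Lebesgue
  measurability on the manifold is Borel measurability for \<open>completion \<mu>\<close>.\<close>

definition almost_every_leaf ::
  "'m measure \<Rightarrow> 'm set set \<Rightarrow> ('m set \<Rightarrow> bool) \<Rightarrow> bool" where
  "almost_every_leaf \<mu> \<F> P \<longleftrightarrow> \<Union>{L \<in> \<F>. \<not> P L} \<in> null_sets (completion \<mu>)"

definition in_Lp :: "'m measure \<Rightarrow> real \<Rightarrow> ('m \<Rightarrow> real) \<Rightarrow> bool" where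
  "in_Lp \<mu> p f \<longleftrightarrow> f \<in> borel_measurable (completion \<mu>) \<and>
     integrable (completion \<mu>) (\<lambda>x. \<bar>f x\<bar> powr p)"

definition Lp_norm :: "'m measure \<Rightarrow> real \<Rightarrow> ('m \<Rightarrow> real) \<Rightarrow> real" where
  "Lp_norm \<mu> p f = (\<integral>x. \<bar>f x\<bar> powr p \<partial>completion \<mu>) powr (1 / p)"

definition adm ::
  "'m measure \<Rightarrow> ('m set \<Rightarrow> 'm measure) \<Rightarrow> 'm set set \<Rightarrow> real \<Rightarrow> ('m \<Rightarrow> real) set" where
  "adm \<mu> \<nu> \<F> p = {f. in_Lp \<mu> p f \<and> (\<forall>x. 0 \<le> f x) \<and>
     almost_every_leaf \<mu> \<F> (\<lambda>L. 1 \<le> (\<integral>\<^sup>+ x. ennreal (f x) \<partial>\<nu> L))}"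

text \<open>The infimum in \<^typ>\<open>ennreal\<close> of the empty set is \<open>\<infinity>\<close>.\<close>

definition modulus ::
  "'m measure \<Rightarrow> ('m set \<Rightarrow> 'm measure) \<Rightarrow> 'm set set \<Rightarrow> real \<Rightarrow> ennreal" where
  "modulus \<mu> \<nu> \<F> p = (INF f\<in>adm \<mu> \<nu> \<F> p. ennreal (Lp_norm \<mu> p f))"

definition extremal ::
  "'m measure \<Rightarrow> ('m set \<Rightarrow> 'm measure) \<Rightarrow> 'm set set \<Rightarrow> real \<Rightarrow> ('m \<Rightarrow> real) \<Rightarrow> bool" where
  "extremal \<mu> \<nu> \<F> p f \<longleftrightarrow> f \<in> adm \<mu> \<nu> \<F> p \<and> modulus \<mu> \<nu> \<F> p = ennreal (Lp_norm \<mu> p f)"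

definition essinf :: "'m measure \<Rightarrow> ('m \<Rightarrow> real) \<Rightarrow> ereal" where
  "essinf \<mu> f = - esssup \<mu> (\<lambda>x. - ereal (f x))"

definition hat_one :: "('m set \<Rightarrow> 'm measure) \<Rightarrow> 'm set set \<Rightarrow> 'm \<Rightarrow> ennreal" where
  "hat_one \<nu> \<F> x = (\<integral>\<^sup>+ y. 1 \<partial>\<nu> (leaf_of \<F> x))"

end

theory Submission
  imports Defs
begin

text \<open>Let \<open>W\<close> and \<open>w\<close> be the volume densities of the manifold and of the leaves in a foliated chart.
  Moving mass of \<open>f\<^sub>0\<close>, weighted by \<open>1 / w\<close>, from a small cube to another cube with the same transverse
  coordinates preserves the integrals over all leaves. As \<open>f\<^sub>0\<close> is extremal, this cannot decrease the
  norm, so \<open>f\<^sub>0\<^sup>p\<^sup>-\<^sup>1 W / w\<close> is constant along the plaques. On the other hand, the determinant of an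
  orthonormal frame of the orthogonal distribution, completed by the leafwise coordinate fields, is
  \<open>w / W\<close> up to sign, and its logarithmic derivative along the leaves is the mean curvature of that
  distribution. If \<open>f\<^sub>0\<close> is constant on the leaves, the leaf volume is lower semicontinuous, so the set
  where \<open>f\<^sub>0\<close> integrates to more than \<open>1\<close> is open and saturated, and \<open>f\<^sub>0\<close> could be scaled down
  there.\<close>

section \<open>Closure properties of smooth maps\<close>

text \<open>The comparison of norms uses a fixed step \<open>t\<close>, not a derivative at
  \<open>t = 0\<close>: by convexity, \<open>f powr p - f0 powr p\<close> is bounded by the tangent
  at the perturbed value \<open>f\<close>, so nothing is differentiated under an integral. The
  factor \<open>1 / w\<close> turns the moved mass on a plaque into the Lebesgue measure of a slice
  of a cube, which depends on transverse coordinates only; a leaf may meet the chart in infinitely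
  many plaques, hence the need for their countability. Removing mass needs \<open>f0\<close>
  positive at every point, which continuity extracts from the essential bound. The mean curvature is
  a definite description over all local frames. Existence of a frame comes from Gram-Schmidt with a
  parameter; independence holds because every frame yields the same expression in the two densities.
  Semicontinuity of leaf volume is one-sided, as nearby leaves keep finitely many given plaques but
  may acquire more. One side suffices: it rules out leaf integrals above 1, and admissibility rules
  out those below 1 on almost every leaf.\<close>

lemma Ck_on_cong:
  assumes "open S" "\<And>x. x \<in> S \<Longrightarrow> f x = h x"
  shows "Ck_on k S f \<longleftrightarrow> Ck_on k S h"
  using assms(2)
proof (induction k arbitrary: f h)
  case 0
  then show ?case by (auto cong: continuous_on_cong)
next
  case (Suc k)
  have D: "(f has_derivative D) (at x) \<longleftrightarrow> (h has_derivative D) (at x)" if "x \<in> S" for x D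
    using that Suc.prems assms(1) has_derivative_transform_within_open[of f D x UNIV S h]
      has_derivative_transform_within_open[of h D x UNIV S f] by force
  have "f differentiable (at x) \<longleftrightarrow> h differentiable (at x)" if "x \<in> S" for x
    using D[OF that] by (simp add: differentiable_def)
  moreover have "frechet_derivative f (at x) = frechet_derivative h (at x)" if "x \<in> S" for x
    using D[OF that] by (simp add: frechet_derivative_def)
  then have "Ck_on k S (\<lambda>x. frechet_derivative f (at x) v) \<longleftrightarrow>
      Ck_on k S (\<lambda>x. frechet_derivative h (at x) v)" for v
    by (intro Suc.IH) simp
  ultimately show ?case by auto
qed

lemma Ck_on_Suc_imp: "Ck_on (Suc k) S f \<Longrightarrow> Ck_on k S f"
proof (induction k arbitrary: f)
  case 0
  then show ?case
    by (auto intro!: continuous_at_imp_continuous_on differentiable_imp_continuous_within)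
next
  case (Suc k)
  have "Ck_on k S (\<lambda>x. frechet_derivative f (at x) v)" for v
    by (rule Suc.IH) (use Suc.prems in simp)
  then show ?case using Suc.prems by simp
qed

lemma Ck_on_const: "Ck_on k S (\<lambda>_. c)"
  by (induction k arbitrary: c) (simp_all add: frechet_derivative_const)

lemma Ck_on_linear:
  assumes "bounded_linear T" "Ck_on k S f" "open S"
  shows "Ck_on k S (\<lambda>x. T (f x))"
  using assms(2)
proof (induction k arbitrary: f)
  case 0
  then show ?case by (auto intro: bounded_linear.continuous_on[OF assms(1)])
next
  case (Suc k)
  have d: "((\<lambda>x. T (f x)) has_derivative (\<lambda>v. T (frechet_derivative f (at x) v))) (at x)" if "x \<in> S" for x
    using Suc.prems that
    by (intro bounded_linear.has_derivative[OF assms(1)]) (auto simp: frechet_derivative_works)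
  have "Ck_on k S (\<lambda>x. frechet_derivative (\<lambda>x. T (f x)) (at x) v)" for v
    by (subst Ck_on_cong[OF assms(3), of _ "\<lambda>x. T (frechet_derivative f (at x) v)"])
       (use Suc in \<open>auto simp: frechet_derivative_at[OF d, symmetric]\<close>)
  then show ?case using d by (auto simp: differentiable_def)
qed

lemma Ck_on_add:
  assumes "Ck_on k S f" "Ck_on k S h" "open S"
  shows "Ck_on k S (\<lambda>x. f x + h x)"
  using assms(1,2)
proof (induction k arbitrary: f h)
  case 0
  then show ?case by (auto intro: continuous_on_add)
next
  case (Suc k)
  have d: "((\<lambda>x. f x + h x) has_derivative
      (\<lambda>v. frechet_derivative f (at x) v + frechet_derivative h (at x) v)) (at x)" if "x \<in> S" for x
    using Suc.prems that
    by (intro has_derivative_add) (auto simp: frechet_derivative_works)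
  have "Ck_on k S (\<lambda>x. frechet_derivative (\<lambda>x. f x + h x) (at x) v)" for v
    by (subst Ck_on_cong[OF assms(3),
          of _ "\<lambda>x. frechet_derivative f (at x) v + frechet_derivative h (at x) v"])
       (use Suc in \<open>auto simp: frechet_derivative_at[OF d, symmetric]\<close>)
  then show ?case using d by (auto simp: differentiable_def)
qed

lemma Ck_on_sum:
  assumes "\<And>i. i \<in> I \<Longrightarrow> Ck_on k S (f i)" "open S"
  shows "Ck_on k S (\<lambda>x. \<Sum>i\<in>I. f i x)"
  using assms(1)
  by (induction I rule: infinite_finite_induct)
     (auto intro!: Ck_on_add Ck_on_const assms(2))

text \<open>The product rule writes the derivative as a sum of two terms of the same bilinear shape,
  so the induction closes with both factors generalized. Products, scalings, inner products and
  matrix-vector products are all instances.\<close>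

lemma Ck_on_bilinear:
  assumes "bounded_bilinear T" "Ck_on k S f" "Ck_on k S h" "open S"
  shows "Ck_on k S (\<lambda>x. T (f x) (h x))"
  using assms(2,3)
proof (induction k arbitrary: f h)
  case 0
  then show ?case by (auto intro: bounded_bilinear.continuous_on[OF assms(1)])
next
  case (Suc k)
  have d: "((\<lambda>x. T (f x) (h x)) has_derivative
      (\<lambda>v. T (f x) (frechet_derivative h (at x) v) + T (frechet_derivative f (at x) v) (h x))) (at x)"
    if "x \<in> S" for x
    using Suc.prems that
    by (intro bounded_bilinear.FDERIV[OF assms(1)]) (auto simp: frechet_derivative_works)
  have k: "Ck_on k S f" "Ck_on k S h" by (rule Suc.prems[THEN Ck_on_Suc_imp])+
  have "Ck_on k S (\<lambda>x. T (f x) (frechet_derivative h (at x) v) +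
          T (frechet_derivative f (at x) v) (h x))" for v
    by (intro Ck_on_add Suc.IH assms(4) k) (use Suc.prems in auto)
  then have "Ck_on k S (\<lambda>x. frechet_derivative (\<lambda>x. T (f x) (h x)) (at x) v)" for v
    by (subst Ck_on_cong[OF assms(4), of _ "\<lambda>x. T (f x) (frechet_derivative h (at x) v) +
          T (frechet_derivative f (at x) v) (h x)"])
       (auto simp: frechet_derivative_at[OF d, symmetric])
  then show ?case using d by (auto simp: differentiable_def)
qed

lemmas Ck_on_mult = Ck_on_bilinear[OF bounded_bilinear_mult]
lemmas Ck_on_scaleR = Ck_on_bilinear[OF bounded_bilinear_scaleR]

text \<open>The derivative of the reciprocal is a polynomial in the reciprocal itself and the
  derivative of \<open>f\<close>, so the induction hypothesis is needed for the fixed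
  \<open>f\<close> only. \<open>Ck_on_sqrt\<close> follows the same pattern.\<close>

lemma Ck_on_inverse:
  fixes f :: "'a::real_normed_vector \<Rightarrow> real"
  assumes "Ck_on k S f" "\<And>x. x \<in> S \<Longrightarrow> f x \<noteq> 0" "open S"
  shows "Ck_on k S (\<lambda>x. inverse (f x))"
  using assms(1)
proof (induction k)
  case 0
  then show ?case using assms(2) by (auto intro!: continuous_on_inverse)
next
  case (Suc k)
  have d: "((\<lambda>x. inverse (f x)) has_derivative
      (\<lambda>v. - (inverse (f x) * frechet_derivative f (at x) v * inverse (f x)))) (at x)"
    if "x \<in> S" for x
    using Suc.prems that assms(2)
    by (intro Deriv.has_derivative_inverse) (auto simp: frechet_derivative_works)
  have i: "Ck_on k S (\<lambda>x. inverse (f x))"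
    by (rule Suc.IH[OF Suc.prems[THEN Ck_on_Suc_imp]])
  have "Ck_on k S (\<lambda>x. frechet_derivative (\<lambda>x. inverse (f x)) (at x) v)" for v
    using Suc.prems
    by (subst Ck_on_cong[OF assms(3), of _ "\<lambda>x. - (inverse (f x) * frechet_derivative f (at x) v * inverse (f x))"])
       (auto simp: frechet_derivative_at[OF d, symmetric]
         intro!: Ck_on_linear[OF bounded_linear_minus[OF bounded_linear_ident]] Ck_on_mult assms(3) i)
  then show ?case using d by (auto simp: differentiable_def)
qed

lemma Ck_on_sqrt:
  fixes f :: "'a::real_normed_vector \<Rightarrow> real"
  assumes "Ck_on k S f" "\<And>x. x \<in> S \<Longrightarrow> f x > 0" "open S"
  shows "Ck_on k S (\<lambda>x. sqrt (f x))"
  using assms(1)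
proof (induction k)
  case 0
  then show ?case by (auto intro!: continuous_on_real_sqrt)
next
  case (Suc k)
  have d: "((\<lambda>x. sqrt (f x)) has_derivative
      (\<lambda>v. frechet_derivative f (at x) v * (inverse (sqrt (f x)) / 2))) (at x)"
    if "x \<in> S" for x
    using Suc.prems that assms(2)
    by (intro has_derivative_real_sqrt) (auto simp: frechet_derivative_works)
  have i: "Ck_on k S (\<lambda>x. inverse (sqrt (f x)))"
    using assms(2) by (intro Ck_on_inverse Suc.IH[OF Suc.prems[THEN Ck_on_Suc_imp]] assms(3)) force
  have "Ck_on k S (\<lambda>x. frechet_derivative (\<lambda>x. sqrt (f x)) (at x) v)" for v
    using Suc.prems
    by (subst Ck_on_cong[OF assms(3), of _ "\<lambda>x. frechet_derivative f (at x) v * (inverse (sqrt (f x)) / 2)"])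
       (auto simp: frechet_derivative_at[OF d, symmetric]
         intro!: Ck_on_linear[OF bounded_linear_divide] Ck_on_mult assms(3) i)
  then show ?case using d by (auto simp: differentiable_def)
qed

lemma matrix_vector_mult_bounded_bilinear:
  "bounded_bilinear ((*v) :: real ^ 'n ^ 'm \<Rightarrow> real ^ 'n \<Rightarrow> real ^ 'm)"
proof (rule bilinear_conv_bounded_bilinear[THEN iffD1])
  show "bilinear ((*v) :: real ^ 'n ^ 'm \<Rightarrow> real ^ 'n \<Rightarrow> real ^ 'm)"
    unfolding bilinear_def
    by (auto intro!: linearI simp: matrix_vector_mult_add_rdistrib matrix_vector_right_distrib
        scaleR_matrix_vector_assoc matrix_vector_mult_scaleR)
qed

section \<open>Gram--Schmidt with smooth dependence on a parameter\<close>

definition is_metric_on :: "'a set \<Rightarrow> ('a \<Rightarrow> real ^ 'n ^ 'n) \<Rightarrow> bool" where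
  "is_metric_on V G \<longleftrightarrow> (\<forall>z\<in>V. transpose (G z) = G z \<and> (\<forall>v. v \<noteq> 0 \<longrightarrow> v \<bullet> (G z *v v) > 0))"

lemma symmetric_form:
  fixes G :: "real ^ 'n ^ 'n"
  shows "transpose G = G \<Longrightarrow> u \<bullet> (G *v v) = v \<bullet> (G *v u)"
  by (metis dot_lmul_matrix inner_commute transpose_matrix_vector)

text \<open>\<open>leaf_tangent S\<close> is used here for an arbitrary set \<open>S\<close> of
  coordinates. The span condition carries the induction: it keeps the next coordinate vector
  independent of the vectors already built, and it later turns orthogonality to the frame into
  orthogonality to the leaves.\<close>

definition orthoframe ::
  "'a::real_normed_vector set \<Rightarrow> ('a \<Rightarrow> real ^ 'n ^ 'n::finite) \<Rightarrow> 'n set \<Rightarrow> ('n \<Rightarrow> 'a \<Rightarrow> real ^ 'n) \<Rightarrow> bool" where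
  "orthoframe V G S e \<longleftrightarrow> (\<forall>\<alpha>\<in>S. smooth_on V (e \<alpha>)) \<and>
     (\<forall>z\<in>V. \<forall>\<alpha>\<in>S. \<forall>\<beta>\<in>S. e \<alpha> z \<bullet> (G z *v e \<beta> z) = (if \<alpha> = \<beta> then 1 else 0)) \<and>
     (\<forall>z\<in>V. span ((\<lambda>\<alpha>. e \<alpha> z) ` S) = leaf_tangent S)"

lemma leaf_tangent_iff: "v \<in> leaf_tangent S \<longleftrightarrow> (\<forall>i\<in>-S. v $ i = 0)"
proof
  assume "v \<in> leaf_tangent S"
  then show "\<forall>i\<in>-S. v $ i = 0"
    unfolding leaf_tangent_def by (induction rule: span_induct_alt) (auto simp: axis_def)
next
  assume a: "\<forall>i\<in>-S. v $ i = 0"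
  have "v = (\<Sum>i\<in>S. v $ i *\<^sub>R axis i 1)"
  proof (rule vec_eq_iff[THEN iffD2], intro allI)
    fix k show "v $ k = (\<Sum>i\<in>S. v $ i *\<^sub>R axis i 1) $ k"
      using a by (cases "k \<in> S") (simp_all add: axis_def if_distrib sum.delta' cong: if_cong)
  qed
  also have "\<dots> \<in> leaf_tangent S"
    unfolding leaf_tangent_def by (intro span_sum span_scale span_base) auto
  finally show "v \<in> leaf_tangent S" .
qed

text \<open>One Gram-Schmidt step: the coordinate field of \<beta> minus its projection to the span
  of the old frame, normalized. Every operation involved preserves \<open>Ck_on\<close>, so the new
  field depends smoothly on the base point.\<close>

lemma orthoframe_insert:
  assumes V: "open V" and G: "smooth_on V G" and m: "is_metric_on V G"
    and e: "orthoframe V G S e" and \<beta>: "\<beta> \<notin> S"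
  shows "\<exists>e'. orthoframe V G (insert \<beta> S) e' \<and> (\<forall>\<alpha>\<in>S. e' \<alpha> = e \<alpha>)"
proof -
  define v where "v z = axis \<beta> 1 - (\<Sum>\<alpha>\<in>S. (e \<alpha> z \<bullet> (G z *v axis \<beta> 1)) *\<^sub>R e \<alpha> z)" for z
  define q where "q z = v z \<bullet> (G z *v v z)" for z
  define e' where "e' = (\<lambda>\<alpha>. if \<alpha> = \<beta> then (\<lambda>z. inverse (sqrt (q z)) *\<^sub>R v z) else e \<alpha>)"
  have es: "\<alpha> \<in> S \<Longrightarrow> Ck_on k V (e \<alpha>)" for \<alpha> k
    using e by (auto simp: orthoframe_def smooth_on_def)
  have Gk: "Ck_on k V G" for k using G by (auto simp: smooth_on_def)
  have vs: "Ck_on k V v" for k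
    unfolding v_def diff_conv_add_uminus
    by (intro Ck_on_add Ck_on_const Ck_on_linear[OF bounded_linear_minus[OF bounded_linear_ident]]
        Ck_on_sum Ck_on_scaleR es V Ck_on_bilinear[OF bounded_bilinear_inner]
        Ck_on_bilinear[OF matrix_vector_mult_bounded_bilinear] Gk)
  have spn: "(\<Sum>\<alpha>\<in>S. c \<alpha> *\<^sub>R e \<alpha> z) \<in> leaf_tangent S" if "z \<in> V" for c z
  proof -
    have "(\<Sum>\<alpha>\<in>S. c \<alpha> *\<^sub>R e \<alpha> z) \<in> span ((\<lambda>\<alpha>. e \<alpha> z) ` S)"
      by (intro span_sum span_scale span_base) auto
    then show ?thesis using e that by (simp add: orthoframe_def)
  qed
  \<comment> \<open>Otherwise the coordinate vector of \<beta> would lie in the span of the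
    coordinate vectors in \<open>S\<close>, contradicting that \<beta> is outside of
    \<open>S\<close>.\<close>
  have v0: "v z \<noteq> 0" if "z \<in> V" for z
  proof
    assume "v z = 0"
    then have "axis \<beta> 1 \<in> leaf_tangent S"
      using spn[OF that, of "\<lambda>\<alpha>. e \<alpha> z \<bullet> (G z *v axis \<beta> 1)"] by (simp add: v_def)
    then show False using \<beta> by (auto simp: leaf_tangent_iff axis_def dest!: bspec[of _ _ \<beta>])
  qed
  have q0: "q z > 0" if "z \<in> V" for z
    using m v0[OF that] that by (auto simp: q_def is_metric_on_def)
  have qs: "Ck_on k V q" for k
    unfolding q_def
    by (intro Ck_on_bilinear[OF bounded_bilinear_inner] vs V Gk
        Ck_on_bilinear[OF matrix_vector_mult_bounded_bilinear])
  have s': "smooth_on V (e' \<alpha>)" if "\<alpha> \<in> insert \<beta> S" for \<alpha>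
  proof (cases "\<alpha> = \<beta>")
    case True
    have "Ck_on k V (\<lambda>z. inverse (sqrt (q z)))" for k
      by (intro Ck_on_inverse Ck_on_sqrt qs V q0) (simp_all add: q0 less_imp_neq[OF q0, THEN not_sym])
    then show ?thesis using True
      by (simp add: e'_def smooth_on_def Ck_on_scaleR vs V)
  next
    case False
    then show ?thesis using that es by (simp add: e'_def smooth_on_def)
  qed
  have ort: "e \<gamma> z \<bullet> (G z *v v z) = 0" if "z \<in> V" "\<gamma> \<in> S" for z \<gamma>
  proof -
    have "e \<gamma> z \<bullet> (G z *v v z) = e \<gamma> z \<bullet> (G z *v axis \<beta> 1) -
       (\<Sum>\<alpha>\<in>S. (e \<alpha> z \<bullet> (G z *v axis \<beta> 1)) * (e \<gamma> z \<bullet> (G z *v e \<alpha> z)))"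
      by (simp add: v_def matrix_vector_mult_diff_distrib inner_diff_right inner_sum_right
          linear_sum[OF matrix_vector_mul_linear] matrix_vector_mult_scaleR o_def)
    also have "(\<Sum>\<alpha>\<in>S. (e \<alpha> z \<bullet> (G z *v axis \<beta> 1)) * (e \<gamma> z \<bullet> (G z *v e \<alpha> z))) =
       (\<Sum>\<alpha>\<in>S. if \<alpha> = \<gamma> then e \<gamma> z \<bullet> (G z *v axis \<beta> 1) else 0)"
      using e that by (intro sum.cong) (auto simp: orthoframe_def)
    also have "\<dots> = e \<gamma> z \<bullet> (G z *v axis \<beta> 1)" using that by simp
    finally show ?thesis by simp
  qed
  have ort': "v z \<bullet> (G z *v e \<gamma> z) = 0" if "z \<in> V" "\<gamma> \<in> S" for z \<gamma>
    using ort[OF that] symmetric_form[of "G z"] m that by (simp add: is_metric_on_def)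
  have qq: "(inverse (sqrt (q z)) *\<^sub>R v z) \<bullet> (G z *v (inverse (sqrt (q z)) *\<^sub>R v z)) = 1"
    if "z \<in> V" for z
  proof -
    have "sqrt (q z) * sqrt (q z) = q z" "sqrt (q z) \<noteq> 0" using q0[OF that] by auto
    then show ?thesis
      by (simp add: matrix_vector_mult_scaleR q_def[symmetric] field_simps)
  qed
  have sp: "span ((\<lambda>\<alpha>. e' \<alpha> z) ` insert \<beta> S) = leaf_tangent (insert \<beta> S)" if z: "z \<in> V" for z
  proof -
    have E: "(\<lambda>\<alpha>. e' \<alpha> z) ` insert \<beta> S = insert (inverse (sqrt (q z)) *\<^sub>R v z) ((\<lambda>\<alpha>. e \<alpha> z) ` S)"
      using \<beta> by (auto simp: e'_def image_iff)
    have S1: "span ((\<lambda>\<alpha>. e \<alpha> z) ` S) = leaf_tangent S" using e z by (simp add: orthoframe_def)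
    let ?s = "\<Sum>\<alpha>\<in>S. (e \<alpha> z \<bullet> (G z *v axis \<beta> 1)) *\<^sub>R e \<alpha> z"
    have sm: "?s \<in> leaf_tangent S" by (rule spn[OF z])
    have mono: "leaf_tangent S \<subseteq> leaf_tangent (insert \<beta> S)"
      by (auto simp: leaf_tangent_iff)
    have "axis \<beta> 1 \<in> leaf_tangent (insert \<beta> S)" by (auto simp: leaf_tangent_iff axis_def)
    then have "v z \<in> leaf_tangent (insert \<beta> S)"
      using sm mono unfolding v_def leaf_tangent_def by (blast intro: span_diff)
    then have A: "insert (inverse (sqrt (q z)) *\<^sub>R v z) ((\<lambda>\<alpha>. e \<alpha> z) ` S) \<subseteq> leaf_tangent (insert \<beta> S)"
      using S1 mono span_superset[of "(\<lambda>\<alpha>. e \<alpha> z) ` S"] unfolding leaf_tangent_def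
      by (auto intro: span_scale)
    let ?N = "insert (inverse (sqrt (q z)) *\<^sub>R v z) ((\<lambda>\<alpha>. e \<alpha> z) ` S)"
    have B0: "leaf_tangent S \<subseteq> span ?N"
      unfolding S1[symmetric] by (intro span_mono) auto
    have "axis \<beta> 1 = sqrt (q z) *\<^sub>R (inverse (sqrt (q z)) *\<^sub>R v z) + ?s"
      using q0[OF z] by (simp add: v_def)
    also have "\<dots> \<in> span ?N"
      by (intro span_add[OF span_scale[OF span_base]]) (use sm B0 in auto)
    finally have "axis \<beta> 1 \<in> span ?N" .
    moreover have "axis i 1 \<in> span ?N" if "i \<in> S" for i
      using that B0 unfolding leaf_tangent_def by (auto intro: span_base)
    ultimately have B: "(\<lambda>i. axis i 1) ` insert \<beta> S \<subseteq> span ?N" by auto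
    show ?thesis unfolding E
      using A B unfolding leaf_tangent_def by (intro antisym span_minimal subspace_span)
  qed
  have "orthoframe V G (insert \<beta> S) e'"
    unfolding orthoframe_def
  proof (intro conjI ballI s' sp)
    fix z \<alpha> \<gamma> assume "z \<in> V" "\<alpha> \<in> insert \<beta> S" "\<gamma> \<in> insert \<beta> S"
    then show "e' \<alpha> z \<bullet> (G z *v e' \<gamma> z) = (if \<alpha> = \<gamma> then 1 else 0)"
      using \<beta> ort[of z] ort'[of z] qq[of z] e
      unfolding e'_def orthoframe_def
      by (cases "\<alpha> = \<beta>"; cases "\<gamma> = \<beta>") (simp_all add: matrix_vector_mult_scaleR)
  qed
  moreover have "\<forall>\<alpha>\<in>S. e' \<alpha> = e \<alpha>" using \<beta> unfolding e'_def by auto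
  ultimately show ?thesis by blast
qed

lemma orthoframe_extend:
  assumes "open V" "smooth_on V G" "is_metric_on V G" "orthoframe V G S e" "S \<inter> T = {}"
  shows "\<exists>e'. orthoframe V G (S \<union> T) e' \<and> (\<forall>\<alpha>\<in>S. e' \<alpha> = e \<alpha>)"
proof -
  have "finite T" by simp
  then show ?thesis using assms(5)
  proof (induction T)
    case empty
    then show ?case using assms(4) by auto
  next
    case (insert \<beta> T)
    then obtain e1 where e1: "orthoframe V G (S \<union> T) e1" "\<forall>\<alpha>\<in>S. e1 \<alpha> = e \<alpha>" by auto
    have "\<beta> \<notin> S \<union> T" using insert by auto
    from orthoframe_insert[OF assms(1-3) e1(1) this] obtain e2 where
      "orthoframe V G (insert \<beta> (S \<union> T)) e2" "\<forall>\<alpha>\<in>S \<union> T. e2 \<alpha> = e1 \<alpha>" by auto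
    then show ?case using e1 by (intro exI[of _ e2]) simp
  qed
qed

text \<open>Processing the indices of \<open>S\<close> before the others makes one frame adapted to
  the coordinate subspace of \<open>S\<close>; its remaining members are then orthogonal to that
  subspace.\<close>

lemma orthoframe_ex:
  assumes "open V" "smooth_on V G" "is_metric_on V G"
  shows "\<exists>e. orthoframe V G S e \<and> orthoframe V G UNIV e"
proof -
  have "orthoframe V G {} (\<lambda>_ _. 0)" by (auto simp: orthoframe_def leaf_tangent_def)
  from orthoframe_extend[OF assms this, of S] obtain e1 where e1: "orthoframe V G S e1"
    by (metis Int_empty_left Un_empty_left)
  from orthoframe_extend[OF assms e1, of "-S"] obtain e2 where
    e2: "orthoframe V G UNIV e2" "\<forall>\<alpha>\<in>S. e2 \<alpha> = e1 \<alpha>" by (auto simp: Un_commute)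
  have "(\<lambda>\<alpha>. e2 \<alpha> z) ` S = (\<lambda>\<alpha>. e1 \<alpha> z) ` S" for z using e2 by auto
  then have "orthoframe V G S e2"
    using e1 e2(2) unfolding orthoframe_def by simp
  then show ?thesis using e2(1) by blast
qed

text \<open>For a matrix \<open>E\<close> whose rows form an orthonormal basis,
  \<open>E ** G ** transpose E\<close> is the identity, so the square of \<open>det E\<close> times
  \<open>det G\<close> is 1.\<close>

lemma det_pos_if_metric:
  fixes G :: "real ^ 'n ^ 'n"
  assumes "transpose G = G" "\<And>v. v \<noteq> 0 \<Longrightarrow> v \<bullet> (G *v v) > 0"
  shows "det G > 0"
proof -
  \<comment> \<open>Pointwise linear algebra is obtained from the parametric result by taking a
    constant family over the real line.\<close>
  have "is_metric_on (UNIV :: real set) (\<lambda>_. G)" using assms by (auto simp: is_metric_on_def)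
  moreover have "smooth_on (UNIV :: real set) (\<lambda>_. G)" by (auto simp: smooth_on_def Ck_on_const)
  ultimately obtain e :: "'n \<Rightarrow> real \<Rightarrow> real ^ 'n" where e: "orthoframe UNIV (\<lambda>_. G) UNIV e"
    using orthoframe_ex[OF open_UNIV] by blast
  define E :: "real ^ 'n ^ 'n" where "E = (\<chi> k. e k 0)"
  have "(E ** G ** transpose E) $ k $ l = e k 0 \<bullet> (G *v e l 0)" for k l
  proof -
    have "(E ** G ** transpose E) $ k $ l = (\<Sum>j\<in>UNIV. (\<Sum>i\<in>UNIV. e k 0 $ i * G $ i $ j) * e l 0 $ j)"
      by (simp add: matrix_matrix_mult_def transpose_def E_def)
    also have "\<dots> = (\<Sum>i\<in>UNIV. \<Sum>j\<in>UNIV. e k 0 $ i * (G $ i $ j * e l 0 $ j))"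
      by (subst sum.swap) (simp add: sum_distrib_right sum_distrib_left mult.assoc)
    also have "\<dots> = e k 0 \<bullet> (G *v e l 0)"
      by (simp add: inner_vec_def matrix_vector_mult_def sum_distrib_left)
    finally show ?thesis .
  qed
  then have "E ** G ** transpose E = mat 1"
    using e by (auto simp: vec_eq_iff mat_def orthoframe_def)
  then have "det E * det G * det E = 1"
    by (metis det_I det_mul det_transpose)
  then have "(det E)\<^sup>2 * det G > 0" by (simp add: power2_eq_square mult_ac)
  then show ?thesis by (auto simp: zero_less_mult_iff)
qed

section \<open>Mean curvature in a foliated chart\<close>

text \<open>Existence is the expansion in an orthonormal basis of the leafwise subspace; uniqueness
  is definiteness. This makes the description in \<open>tangential\<close> meaningful.\<close>

lemma ex1_orthogonal_projection:
  fixes G :: "real ^ 'n ^ 'n"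
  assumes sym: "transpose G = G" and pos: "\<And>v. v \<noteq> 0 \<Longrightarrow> v \<bullet> (G *v v) > 0"
  shows "\<exists>!u. u \<in> leaf_tangent B \<and> (\<forall>w\<in>leaf_tangent B. (v - u) \<bullet> (G *v w) = 0)"
proof (rule ex_ex1I)
  have "is_metric_on (UNIV :: real set) (\<lambda>_. G)" using assms by (auto simp: is_metric_on_def)
  moreover have "smooth_on (UNIV :: real set) (\<lambda>_. G)" by (auto simp: smooth_on_def Ck_on_const)
  ultimately obtain e :: "'n \<Rightarrow> real \<Rightarrow> real ^ 'n" where e: "orthoframe UNIV (\<lambda>_. G) B e"
    using orthoframe_ex[OF open_UNIV] by blast
  then have sp: "span ((\<lambda>\<alpha>. e \<alpha> 0) ` B) = leaf_tangent B"
    and on: "\<And>\<alpha> \<beta>. \<alpha> \<in> B \<Longrightarrow> \<beta> \<in> B \<Longrightarrow> e \<alpha> 0 \<bullet> (G *v e \<beta> 0) = (if \<alpha> = \<beta> then 1 else 0)"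
    by (auto simp: orthoframe_def)
  define u where "u = (\<Sum>\<alpha>\<in>B. (v \<bullet> (G *v e \<alpha> 0)) *\<^sub>R e \<alpha> 0)"
  have "u \<in> leaf_tangent B" unfolding u_def sp[symmetric]
    by (intro span_sum span_scale span_base) auto
  moreover have "(v - u) \<bullet> (G *v w) = 0" if "w \<in> leaf_tangent B" for w
    using that unfolding sp[symmetric]
  proof (induction rule: span_induct_alt)
    case base
    then show ?case by simp
  next
    case (step a x y)
    then obtain \<beta> where \<beta>: "\<beta> \<in> B" "x = e \<beta> 0" by auto
    have "u \<bullet> (G *v e \<beta> 0) = (\<Sum>\<alpha>\<in>B. if \<alpha> = \<beta> then v \<bullet> (G *v e \<beta> 0) else 0)"
      unfolding u_def inner_sum_left by (intro sum.cong) (use \<beta> on in auto)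
    then have "u \<bullet> (G *v x) = v \<bullet> (G *v x)" using \<beta> by simp
    then show ?case
      using step by (simp add: matrix_vector_right_distrib inner_add_right matrix_vector_mult_scaleR inner_diff_left)
  qed
  ultimately show "\<exists>u. u \<in> leaf_tangent B \<and> (\<forall>w\<in>leaf_tangent B. (v - u) \<bullet> (G *v w) = 0)" by blast
next
  fix u u' assume u: "u \<in> leaf_tangent B \<and> (\<forall>w\<in>leaf_tangent B. (v - u) \<bullet> (G *v w) = 0)"
    and u': "u' \<in> leaf_tangent B \<and> (\<forall>w\<in>leaf_tangent B. (v - u') \<bullet> (G *v w) = 0)"
  have "u - u' \<in> leaf_tangent B" using u u' by (simp add: leaf_tangent_def span_diff)
  then have "(v - u') \<bullet> (G *v (u - u')) - (v - u) \<bullet> (G *v (u - u')) = 0" using u u' by simp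
  then have "(u - u') \<bullet> (G *v (u - u')) = 0" by (simp add: inner_diff_left)
  then show "u = u'" using pos[of "u - u'"] by force
qed

lemma
  assumes "transpose (g c z) = g c z" "\<And>v. v \<noteq> 0 \<Longrightarrow> v \<bullet> (g c z *v v) > 0"
  shows tangential_in: "tangential B g c z v \<in> leaf_tangent B"
    and tangential_inner: "i \<in> B \<Longrightarrow>
      axis i 1 \<bullet> (g c z *v tangential B g c z v) = axis i 1 \<bullet> (g c z *v v)"
proof -
  let ?u = "tangential B g c z v"
  have u: "?u \<in> leaf_tangent B \<and> (\<forall>w\<in>leaf_tangent B. (v - ?u) \<bullet> (g c z *v w) = 0)"
    unfolding tangential_def metric_ip_def by (rule theI'[OF ex1_orthogonal_projection[OF assms]])
  then show "?u \<in> leaf_tangent B" by simp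
  assume "i \<in> B"
  then have "axis i 1 \<in> leaf_tangent B" unfolding leaf_tangent_def by (auto intro: span_base)
  then have "(v - ?u) \<bullet> (g c z *v axis i 1) = 0" using u by simp
  then show "axis i 1 \<bullet> (g c z *v ?u) = axis i 1 \<bullet> (g c z *v v)"
    by (simp add: symmetric_form[OF assms(1), of "axis i 1"] inner_diff_left)
qed

text \<open>The form is definite on the leafwise subspace, so a leafwise vector is determined by its
  products with the leafwise coordinate vectors. Vector identities thus reduce to one scalar
  identity for each index in \<open>B\<close>.\<close>

lemma leaf_tangent_eqI:
  fixes G :: "real ^ 'n ^ 'n"
  assumes sym: "transpose G = G" and pos: "\<And>v. v \<noteq> 0 \<Longrightarrow> v \<bullet> (G *v v) > 0"
    and "u \<in> leaf_tangent B" "v \<in> leaf_tangent B"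
    and eq: "\<And>i. i \<in> B \<Longrightarrow> axis i 1 \<bullet> (G *v u) = axis i 1 \<bullet> (G *v v)"
  shows "u = v"
proof -
  have "w \<bullet> (G *v (u - v)) = 0" if "w \<in> leaf_tangent B" for w
    using that unfolding leaf_tangent_def
    by (induction rule: span_induct_alt)
       (use eq in \<open>auto simp: inner_add_left matrix_vector_mult_diff_distrib inner_diff_right\<close>)
  moreover have "u - v \<in> leaf_tangent B" using assms by (simp add: leaf_tangent_def span_diff)
  ultimately have "(u - v) \<bullet> (G *v (u - v)) = 0" by blast
  then show ?thesis using pos[of "u - v"] by force
qed

lemma
  fixes G :: "real ^ 'n ^ 'n"
  assumes "invertible G"
  shows matrix_inv_right: "G ** matrix_inv G = mat 1"
    and matrix_inv_left: "matrix_inv G ** G = mat 1"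
  using someI_ex[OF assms[unfolded invertible_def]] by (simp_all add: matrix_inv_def)

lemma metric_invertible:
  fixes G :: "real ^ 'n ^ 'n"
  assumes "transpose G = G" "\<And>v. v \<noteq> 0 \<Longrightarrow> v \<bullet> (G *v v) > 0"
  shows "invertible G"
  using det_pos_if_metric[OF assms] by (simp add: invertible_det_nz)

section \<open>The covariant derivative of a unit normal field in coordinates\<close>

lemma partial_matrix_entry:
  assumes "G differentiable (at z)"
  shows "partial i (\<lambda>w. G w $ j $ l) z = frechet_derivative G (at z) (axis i 1) $ j $ l"
proof -
  have "((\<lambda>w. G w $ j $ l) has_derivative (\<lambda>v. frechet_derivative G (at z) v $ j $ l)) (at z)"
    by (intro bounded_linear.has_derivative[OF bounded_linear_vec_nth]) (use assms frechet_derivative_works in blast)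
  from frechet_derivative_at[OF this, symmetric] show ?thesis by (simp add: partial_def)
qed

lemma linear_vec_expand:
  assumes "linear (T :: real ^ 'n \<Rightarrow> 'b::real_vector)"
  shows "T u = (\<Sum>i\<in>UNIV. u $ i *\<^sub>R T (axis i 1))"
proof -
  have "u = (\<Sum>i\<in>UNIV. u $ i *\<^sub>R axis i 1)"
    by (simp add: vec_eq_iff axis_def if_distrib cong: if_cong)
  then have "T u = T (\<Sum>i\<in>UNIV. u $ i *\<^sub>R axis i 1)" by simp
  then show ?thesis by (simp add: linear_sum[OF assms] linear_cmul[OF assms])
qed

lemma smooth_on_differentiable: "smooth_on S f \<Longrightarrow> x \<in> S \<Longrightarrow> f differentiable (at x)"
  unfolding smooth_on_def by (drule spec[of _ "Suc 0"]) simp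

text \<open>Lowering the upper index cancels the inverse matrix and leaves the Christoffel symbols
  of the first kind.\<close>

lemma christoffel_lowered:
  assumes "invertible (g c z)"
  shows "g c z *v (\<chi> k. \<Sum>i\<in>UNIV. \<Sum>j\<in>UNIV. christoffel g c k i j z * X $ i * Y $ j) =
    (\<chi> l. (\<Sum>i\<in>UNIV. \<Sum>j\<in>UNIV. X $ i * Y $ j *
       (partial i (\<lambda>w. g c w $ j $ l) z + partial j (\<lambda>w. g c w $ i $ l) z
         - partial l (\<lambda>w. g c w $ i $ j) z)) / 2)" (is "_ = ?R")
proof -
  let ?d = "\<lambda>i j l. partial i (\<lambda>w. g c w $ j $ l) z + partial j (\<lambda>w. g c w $ i $ l) z
         - partial l (\<lambda>w. g c w $ i $ j) z"
  have "(\<chi> k. \<Sum>i\<in>UNIV. \<Sum>j\<in>UNIV. christoffel g c k i j z * X $ i * Y $ j) = matrix_inv (g c z) *v ?R"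
  proof (rule vec_eq_iff[THEN iffD2], intro allI)
    fix k
    have "(matrix_inv (g c z) *v ?R) $ k =
       (\<Sum>l\<in>UNIV. \<Sum>i\<in>UNIV. \<Sum>j\<in>UNIV. matrix_inv (g c z) $ k $ l * (X $ i * Y $ j * ?d i j l) / 2)"
      by (simp add: matrix_vector_mult_def sum_distrib_left sum_divide_distrib)
    also have "\<dots> = (\<Sum>i\<in>UNIV. \<Sum>l\<in>UNIV. \<Sum>j\<in>UNIV. matrix_inv (g c z) $ k $ l * (X $ i * Y $ j * ?d i j l) / 2)"
      by (rule sum.swap)
    also have "\<dots> = (\<Sum>i\<in>UNIV. \<Sum>j\<in>UNIV. \<Sum>l\<in>UNIV. matrix_inv (g c z) $ k $ l * (X $ i * Y $ j * ?d i j l) / 2)"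
      by (intro sum.cong refl sum.swap)
    also have "\<dots> = (\<Sum>i\<in>UNIV. \<Sum>j\<in>UNIV. christoffel g c k i j z * X $ i * Y $ j)"
      unfolding christoffel_def sum_distrib_right sum_divide_distrib
      by (intro sum.cong refl) (simp add: field_simps)
    finally show "(\<chi> k. \<Sum>i\<in>UNIV. \<Sum>j\<in>UNIV. christoffel g c k i j z * X $ i * Y $ j) $ k =
       (matrix_inv (g c z) *v ?R) $ k" by simp
  qed
  then show ?thesis
    by (simp only: matrix_vector_mul_assoc matrix_inv_right[OF assms] matrix_vector_mul_lid)
qed

lemma inner_axis1: "axis m (1::real) \<bullet> v = v $ m"
  by (simp add: inner_axis' )

text \<open>Invariantly, the product of the covariant derivative of \<open>e\<close> along itself
  with the coordinate field is the product of \<open>e\<close> with the Lie bracket of the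
  coordinate field and \<open>e\<close>. It follows from metric compatibility, absence of torsion,
  and unit length. The proof carries this out in coordinates.\<close>

lemma cov_deriv_unit_normal:
  fixes e :: "real ^ 'n \<Rightarrow> real ^ 'n"
  assumes V: "open V" "z \<in> V" and sym: "\<And>w. w \<in> V \<Longrightarrow> transpose (g c w) = g c w"
    and inv: "invertible (g c z)" and dG: "g c differentiable (at z)" and de: "e differentiable (at z)"
    and normal: "\<And>w. w \<in> V \<Longrightarrow> axis m 1 \<bullet> (g c w *v e w) = 0"
    and unit: "\<And>w. w \<in> V \<Longrightarrow> e w \<bullet> (g c w *v e w) = 1"
  shows "axis m 1 \<bullet> (g c z *v cov_deriv g c e e z) =
    e z \<bullet> (g c z *v frechet_derivative e (at z) (axis m 1))"
proof -
  define G' where "G' = frechet_derivative (g c) (at z)"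
  define e' where "e' = frechet_derivative e (at z)"
  define u where "u = e z"
  have G': "(g c has_derivative G') (at z)" and e': "(e has_derivative e') (at z)"
    using dG de by (auto simp: G'_def e'_def frechet_derivative_works)
  note blG = bounded_bilinear.FDERIV[OF matrix_vector_mult_bounded_bilinear G' e']
  have "((\<lambda>w. axis m 1 \<bullet> (g c w *v e w)) has_derivative
      (\<lambda>v. axis m 1 \<bullet> (g c z *v e' v + G' v *v e z))) (at z)"
    by (intro bounded_linear.has_derivative[OF bounded_linear_inner_right] blG)
  moreover have "((\<lambda>w. axis m 1 \<bullet> (g c w *v e w)) has_derivative (\<lambda>v. 0)) (at z)"
    by (rule has_derivative_transform_within_open[of "\<lambda>_. 0", OF _ V]) (simp_all add: normal)
  ultimately have "(\<lambda>v. axis m 1 \<bullet> (g c z *v e' v + G' v *v e z)) = (\<lambda>v. 0)"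
    by (rule has_derivative_unique)
  \<comment> \<open>The orthogonality relation is differentiated in the direction of
    \<open>e\<close> itself.\<close>
  from fun_cong[OF this, of u] have 1: "axis m 1 \<bullet> (g c z *v e' u + G' u *v u) = 0"
    unfolding u_def .
  have "((\<lambda>w. e w \<bullet> (g c w *v e w)) has_derivative
      (\<lambda>v. e z \<bullet> (g c z *v e' v + G' v *v e z) + e' v \<bullet> (g c z *v e z))) (at z)"
    by (intro has_derivative_inner blG e')
  moreover have "((\<lambda>w. e w \<bullet> (g c w *v e w)) has_derivative (\<lambda>v. 0)) (at z)"
    by (rule has_derivative_transform_within_open[of "\<lambda>_. 1", OF _ V]) (simp_all add: unit)
  ultimately have "(\<lambda>v. e z \<bullet> (g c z *v e' v + G' v *v e z) + e' v \<bullet> (g c z *v e z)) = (\<lambda>v. 0)"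
    by (rule has_derivative_unique)
  \<comment> \<open>The unit length relation is differentiated along the coordinate field. The
    result replaces the one metric derivative in the lowered Christoffel term that relation
    \<open>1\<close> does not cancel.\<close>
  from fun_cong[OF this, of "axis m 1"]
  have "u \<bullet> (g c z *v e' (axis m 1) + G' (axis m 1) *v u) + e' (axis m 1) \<bullet> (g c z *v u) = 0"
    unfolding u_def .
  then have 2: "u \<bullet> (G' (axis m 1) *v u) = - 2 * (u \<bullet> (g c z *v e' (axis m 1)))"
    using symmetric_form[OF sym[OF V(2)], of "e' (axis m 1)" u] by (simp add: inner_add_right)
  have pe: "partial i (\<lambda>w. g c w $ j $ l) z = G' (axis i 1) $ j $ l" for i j l
    unfolding G'_def by (rule partial_matrix_entry[OF dG])
  have symG': "G' v $ j $ l = G' v $ l $ j" for v j l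
  proof -
    have d: "((\<lambda>w. g c w $ j $ l) has_derivative (\<lambda>v. G' v $ j $ l)) (at z)" for j l
      by (intro bounded_linear.has_derivative[OF bounded_linear_vec_nth] G')
    have "g c w $ l $ j = g c w $ j $ l" if "w \<in> V" for w
      using arg_cong[OF sym[OF that], of "\<lambda>M. M $ j $ l"] by (simp add: transpose_def)
    then have "((\<lambda>w. g c w $ j $ l) has_derivative (\<lambda>v. G' v $ l $ j)) (at z)"
      by (intro has_derivative_transform_within_open[OF d V])
    from fun_cong[OF has_derivative_unique[OF d this]] show ?thesis .
  qed
  have lin: "linear G'" using G' has_derivative_linear by blast
  have Gu: "(G' u *v u) $ m = (\<Sum>i\<in>UNIV. \<Sum>j\<in>UNIV. u $ i * u $ j * G' (axis i 1) $ j $ m)"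
  proof -
    have "(G' u *v u) $ m = (\<Sum>j\<in>UNIV. (\<Sum>i\<in>UNIV. u $ i * G' (axis i 1) $ m $ j) * u $ j)"
      by (subst linear_vec_expand[OF lin]) (simp add: matrix_vector_mult_def)
    also have "\<dots> = (\<Sum>i\<in>UNIV. \<Sum>j\<in>UNIV. u $ i * G' (axis i 1) $ m $ j * u $ j)"
      by (subst sum.swap) (simp add: sum_distrib_right)
    finally show ?thesis using symG' by (simp add: mult_ac)
  qed
  have Gm: "u \<bullet> (G' (axis m 1) *v u) = (\<Sum>i\<in>UNIV. \<Sum>j\<in>UNIV. u $ i * u $ j * G' (axis m 1) $ i $ j)"
    by (simp add: inner_vec_def matrix_vector_mult_def sum_distrib_left mult_ac)
  have "(g c z *v (\<chi> k. \<Sum>i\<in>UNIV. \<Sum>j\<in>UNIV. christoffel g c k i j z * u $ i * u $ j)) $ m =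
     (\<Sum>i\<in>UNIV. \<Sum>j\<in>UNIV. u $ i * u $ j * (G' (axis i 1) $ j $ m + G' (axis j 1) $ i $ m
         - G' (axis m 1) $ i $ j)) / 2"
    by (simp add: christoffel_lowered[where g = g and c = c, OF inv] pe)
  also have "\<dots> = ((G' u *v u) $ m + (\<Sum>i\<in>UNIV. \<Sum>j\<in>UNIV. u $ i * u $ j * G' (axis j 1) $ i $ m) -
      u \<bullet> (G' (axis m 1) *v u)) / 2"
    unfolding Gu Gm by (simp add: algebra_simps sum.distrib sum_subtractf)
  also have "(\<Sum>i\<in>UNIV. \<Sum>j\<in>UNIV. u $ i * u $ j * G' (axis j 1) $ i $ m) = (G' u *v u) $ m"
    unfolding Gu by (subst sum.swap) (simp add: mult_ac)
  finally have 3: "(g c z *v (\<chi> k. \<Sum>i\<in>UNIV. \<Sum>j\<in>UNIV. christoffel g c k i j z * u $ i * u $ j)) $ m =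
     (G' u *v u) $ m + u \<bullet> (g c z *v e' (axis m 1))"
    using 2 by (simp add: field_simps)
  have "axis m 1 \<bullet> (g c z *v cov_deriv g c e e z) = axis m 1 \<bullet> (g c z *v e' u) +
     (g c z *v (\<chi> k. \<Sum>i\<in>UNIV. \<Sum>j\<in>UNIV. christoffel g c k i j z * u $ i * u $ j)) $ m"
    by (simp only: cov_deriv_def u_def[symmetric] e'_def[symmetric] matrix_vector_right_distrib
        inner_add_right inner_axis1)
  then show ?thesis
    using 1 unfolding 3 u_def[symmetric] e'_def[symmetric] by (simp add: inner_add_right inner_axis1)
qed

text \<open>Jacobi's formula at the identity, where the derivative of the determinant is the trace:
  in the Leibniz expansion only the identity permutation survives.\<close>

lemma det_has_derivative_at_one:
  fixes R :: "real \<Rightarrow> real ^ 'n ^ 'n"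
  assumes R0: "R t0 = mat 1"
    and D: "\<And>i j. ((\<lambda>t. R t $ i $ j) has_real_derivative D i j) (at t0)"
  shows "((\<lambda>t. det (R t)) has_real_derivative (\<Sum>i\<in>UNIV. D i i)) (at t0)"
proof -
  have pr: "((\<lambda>t. \<Prod>i\<in>UNIV. R t $ i $ p i) has_real_derivative
      (\<Sum>i\<in>UNIV. D i (p i) * (\<Prod>j\<in>UNIV - {i}. R t0 $ j $ p j))) (at t0)" for p
  proof -
    have "((\<lambda>t. R t $ i $ p i) has_derivative (\<lambda>y. D i (p i) * y)) (at t0)" for i
      using D by (simp add: has_field_derivative_def)
    from has_derivative_prod[where f' = "\<lambda>i y. D i (p i) * y", OF this]
    show ?thesis unfolding has_field_derivative_def
      by (rule has_derivative_eq_rhs) (simp add: sum_distrib_left fun_eq_iff mult_ac)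
  qed
  have "((\<lambda>t. det (R t)) has_real_derivative
      (\<Sum>p | p permutes UNIV. of_int (sign p) *
        (\<Sum>i\<in>UNIV. D i (p i) * (\<Prod>j\<in>UNIV - {i}. R t0 $ j $ p j)))) (at t0)"
    unfolding det_def by (intro DERIV_sum DERIV_cmult pr)
  moreover have "(\<Sum>i\<in>UNIV. D i (p i) * (\<Prod>j\<in>UNIV - {i}. R t0 $ j $ p j)) =
      (if p = id then (\<Sum>i\<in>UNIV. D i i) else 0)" if p: "p permutes UNIV" for p
  proof (cases "p = id")
    case True
    then show ?thesis using R0 by (simp add: mat_def)
  next
    case False
    \<comment> \<open>A permutation other than the identity cannot move \<open>i\<close> alone. It
      moves some further index, at which the identity matrix has a zero factor.\<close>
    have pz: "(\<Prod>j\<in>UNIV - {i}. R t0 $ j $ p j) = 0" for i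
    proof -
      have "\<exists>j. j \<noteq> i \<and> p j \<noteq> j"
      proof (rule ccontr)
        assume a: "\<not> (\<exists>j. j \<noteq> i \<and> p j \<noteq> j)"
        then have "p i = i" using permutes_inj[OF p] by (metis injD)
        then have "p j = j" for j using a by (cases "j = i") auto
        then show False using False by (auto simp: id_def)
      qed
      then obtain j where "j \<noteq> i" "p j \<noteq> j" by blast
      then show ?thesis using R0 by (intro prod_zero) (auto simp: mat_def intro!: bexI[of _ j])
    qed
    show ?thesis using False by (simp only: pz mult_zero_right sum.neutral_const if_False)
  qed
  then have "(\<Sum>p | p permutes UNIV. of_int (sign p) *
        (\<Sum>i\<in>UNIV. D i (p i) * (\<Prod>j\<in>UNIV - {i}. R t0 $ j $ p j))) =
     (\<Sum>p | p permutes (UNIV :: 'n set). if p = id then (\<Sum>i\<in>UNIV. D i i) else 0)"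
    by (intro sum.cong) (auto simp: sign_id)
  then have "(\<Sum>p | p permutes UNIV. of_int (sign p) *
        (\<Sum>i\<in>UNIV. D i (p i) * (\<Prod>j\<in>UNIV - {i}. R t0 $ j $ p j))) = (\<Sum>i\<in>UNIV. D i i)"
    by (simp add: permutes_id finite_permutations)
  ultimately show ?thesis by simp
qed

section \<open>The determinant of a normal frame completed by leafwise coordinate fields\<close>

definition frame_matrix :: "'n set \<Rightarrow> ('n \<Rightarrow> 'a \<Rightarrow> real ^ 'n) \<Rightarrow> 'a \<Rightarrow> real ^ 'n ^ 'n::finite" where
  "frame_matrix B e z = (\<chi> r k. if k \<in> B then axis k 1 $ r else e k z $ r)"

text \<open>Mixed products vanish because the frame is normal to the leaves, and the products inside
  the frame form an identity block. This is exactly the completion in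
  \<open>leaf_block\<close>.\<close>

lemma frame_matrix_gram:
  assumes "perp_frame B g c V e" "z \<in> V" "transpose (g c z) = g c z"
  shows "transpose (frame_matrix B e z) ** g c z ** frame_matrix B e z = leaf_block B (g c z)"
proof -
  let ?E = "frame_matrix B e z"
  define col where "col k = (if k \<in> B then axis k 1 else e k z)" for k
  have "(transpose ?E ** g c z ** ?E) $ k $ l = col k \<bullet> (g c z *v col l)" for k l
  proof -
    have "(transpose ?E ** g c z ** ?E) $ k $ l = (\<Sum>j\<in>UNIV. (\<Sum>i\<in>UNIV. col k $ i * g c z $ i $ j) * col l $ j)"
      by (simp add: matrix_matrix_mult_def transpose_def frame_matrix_def col_def if_distrib
          if_distribR cong: if_cong)
    also have "\<dots> = (\<Sum>i\<in>UNIV. \<Sum>j\<in>UNIV. col k $ i * (g c z $ i $ j * col l $ j))"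
      by (subst sum.swap) (simp add: sum_distrib_right sum_distrib_left mult.assoc)
    also have "\<dots> = col k \<bullet> (g c z *v col l)"
      by (simp add: inner_vec_def matrix_vector_mult_def sum_distrib_left)
    finally show ?thesis .
  qed
  moreover have "col k \<bullet> (g c z *v col l) = leaf_block B (g c z) $ k $ l" for k l
  proof -
    have ax: "axis i 1 \<in> leaf_tangent B" if "i \<in> B" for i
      using that unfolding leaf_tangent_def by (auto intro: span_base)
    have n: "e a z \<bullet> (g c z *v axis i 1) = 0" if "a \<notin> B" "i \<in> B" for a i
      using assms(1,2) ax that by (auto simp: perp_frame_def metric_ip_def)
    have n': "axis i 1 \<bullet> (g c z *v e a z) = 0" if "a \<notin> B" "i \<in> B" for a i
      using n[OF that] symmetric_form[OF assms(3)] by metis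
    have o: "e a z \<bullet> (g c z *v e b z) = (if a = b then 1 else 0)" if "a \<notin> B" "b \<notin> B" for a b
      using assms(1,2) that by (auto simp: perp_frame_def metric_ip_def)
    have "axis k 1 \<bullet> (g c z *v axis l 1) = g c z $ k $ l"
      by (simp add: inner_axis1 matrix_vector_mult_basis column_def)
    then show ?thesis
      using n n' o by (auto simp: col_def leaf_block_def)
  qed
  ultimately show ?thesis by (simp add: vec_eq_iff)
qed

text \<open>The quadratic form splits into the form of \<open>G\<close> on the part of the vector
  with indices in \<open>B\<close> and the Euclidean square of the rest, so it is again positive
  definite.\<close>

lemma leaf_block_metric:
  fixes G :: "real ^ 'n ^ 'n"
  assumes "transpose G = G" "\<And>v. v \<noteq> 0 \<Longrightarrow> v \<bullet> (G *v v) > 0"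
  shows "det (leaf_block B G) > 0"
proof (rule det_pos_if_metric)
  show "transpose (leaf_block B G) = leaf_block B G"
    using assms(1) by (auto simp: vec_eq_iff leaf_block_def transpose_def)
  fix v :: "real ^ 'n" assume v: "v \<noteq> 0"
  define p where "p = (\<chi> i. if i \<in> B then v $ i else 0)"
  have "v \<bullet> (leaf_block B G *v v) = (\<Sum>i\<in>UNIV. v $ i * (\<Sum>j\<in>UNIV. leaf_block B G $ i $ j * v $ j))"
    by (simp add: inner_vec_def matrix_vector_mult_def)
  also have "\<dots> = (\<Sum>i\<in>UNIV. p $ i * (\<Sum>j\<in>UNIV. G $ i $ j * p $ j) + (if i \<in> B then 0 else (v $ i)\<^sup>2))"
  proof (intro sum.cong refl)
    fix i
    show "v $ i * (\<Sum>j\<in>UNIV. leaf_block B G $ i $ j * v $ j) =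
      p $ i * (\<Sum>j\<in>UNIV. G $ i $ j * p $ j) + (if i \<in> B then 0 else (v $ i)\<^sup>2)"
    proof (cases "i \<in> B")
      case True
      have "(\<Sum>j\<in>UNIV. leaf_block B G $ i $ j * v $ j) = (\<Sum>j\<in>UNIV. G $ i $ j * p $ j)"
        using True by (intro sum.cong) (auto simp: leaf_block_def p_def)
      then show ?thesis using True by (simp add: p_def)
    next
      case False
      have "(\<Sum>j\<in>UNIV. leaf_block B G $ i $ j * v $ j) = (\<Sum>j\<in>UNIV. if j = i then v $ i else 0)"
        using False by (intro sum.cong) (auto simp: leaf_block_def)
      then show ?thesis using False by (simp add: p_def power2_eq_square)
    qed
  qed
  also have "\<dots> = p \<bullet> (G *v p) + (\<Sum>i\<in>-B. (v $ i)\<^sup>2)"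
    by (simp add: sum.distrib inner_vec_def matrix_vector_mult_def sum.If_cases Compl_eq)
  also have "\<dots> > 0"
  proof (cases "p = 0")
    case True
    then obtain i where "i \<in> -B" "v $ i \<noteq> 0"
      using v by (auto simp: p_def vec_eq_iff split: if_splits)
    then have "0 < (\<Sum>i\<in>-B. (v $ i)\<^sup>2)" by (intro sum_pos2[of _ i]) auto
    then show ?thesis using True by simp
  next
    case False
    then show ?thesis using assms(2)[OF False] by (intro add_pos_nonneg sum_nonneg) auto
  qed
  finally show "v \<bullet> (leaf_block B G *v v) > 0" .
qed

lemma frame_matrix_det:
  assumes "perp_frame B g c V e" "z \<in> V" "transpose (g c z) = g c z"
    and "\<And>v. v \<noteq> 0 \<Longrightarrow> v \<bullet> (g c z *v v) > 0"
  shows "(det (frame_matrix B e z))\<^sup>2 = det (leaf_block B (g c z)) / det (g c z)"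
    and "det (frame_matrix B e z) \<noteq> 0"
proof -
  have "det (frame_matrix B e z) * det (g c z) * det (frame_matrix B e z) = det (leaf_block B (g c z))"
    by (metis frame_matrix_gram[OF assms(1-3)] det_mul det_transpose)
  then show A: "(det (frame_matrix B e z))\<^sup>2 = det (leaf_block B (g c z)) / det (g c z)"
    using det_pos_if_metric[OF assms(3,4)] by (simp add: power2_eq_square field_simps)
  show "det (frame_matrix B e z) \<noteq> 0"
    using A det_pos_if_metric[OF assms(3,4)] leaf_block_metric[OF assms(3,4), of B] by auto
qed

text \<open>Half the logarithm of the square stands for the logarithm of the absolute value, as the
  sign of the determinant is unknown. By Jacobi's formula its derivative is the trace of the inverse
  frame matrix times the derivative of the frame matrix.\<close>

lemma ln_det_frame_derivative:
  assumes fr: "perp_frame B g c V e" and z: "z \<in> V" and sym: "transpose (g c z) = g c z"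
    and pos: "\<And>v. v \<noteq> 0 \<Longrightarrow> v \<bullet> (g c z *v v) > 0"
  shows "((\<lambda>t. ln ((det (frame_matrix B e (z + t *\<^sub>R axis m 1)))\<^sup>2) / 2) has_real_derivative
     (\<Sum>\<alpha>\<in>-B. e \<alpha> z \<bullet> (g c z *v frechet_derivative (e \<alpha>) (at z) (axis m 1)))) (at 0)"
proof -
  let ?E = "frame_matrix B e" and ?l = "\<lambda>t. z + t *\<^sub>R axis m (1::real)"
  note nz = frame_matrix_det(2)[OF assms]
  define I where "I = matrix_inv (?E z)"
  have inv: "invertible (?E z)" using nz by (simp add: invertible_det_nz)
  have IE: "I ** ?E z = mat 1" "?E z ** I = mat 1"
    unfolding I_def using matrix_inv_left[OF inv] matrix_inv_right[OF inv] by auto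
  \<comment> \<open>Normalizing by the inverse at the base point makes the curve start at the
    identity, where Jacobi's formula is available; determinants change by a constant factor
    only.\<close>
  define R where "R t = I ** ?E (?l t)" for t
  define d where "d k = (if k \<in> B then 0 else frechet_derivative (e k) (at z) (axis m 1))" for k
  have e': "(e k has_derivative frechet_derivative (e k) (at z)) (at z)" if "k \<notin> B" for k
    using fr that z unfolding perp_frame_def
    by (intro frechet_derivative_works[THEN iffD1] smooth_on_differentiable[of V]) auto
  have Ed: "((\<lambda>t. ?E (?l t) $ r $ k) has_real_derivative d k $ r) (at 0)" for r k
  proof (cases "k \<in> B")
    case True
    then show ?thesis by (simp add: frame_matrix_def d_def)
  next
    case False
    have "((\<lambda>t. ?l t) has_derivative (\<lambda>t. t *\<^sub>R axis m 1)) (at 0)"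
      by (auto intro!: derivative_eq_intros)
    from has_derivative_compose[OF this, of "e k" "frechet_derivative (e k) (at z)"] e'[OF False]
    have "((\<lambda>t. e k (?l t)) has_derivative (\<lambda>t. frechet_derivative (e k) (at z) (t *\<^sub>R axis m 1))) (at 0)"
      by simp
    from bounded_linear.has_derivative[OF bounded_linear_vec_nth this, of r]
    have "((\<lambda>t. e k (?l t) $ r) has_derivative (\<lambda>t. frechet_derivative (e k) (at z) (t *\<^sub>R axis m 1) $ r)) (at 0)" .
    moreover have "frechet_derivative (e k) (at z) (t *\<^sub>R axis m 1) = t *\<^sub>R frechet_derivative (e k) (at z) (axis m 1)" for t
      using has_derivative_linear[OF e'[OF False]] by (rule linear_cmul)
    ultimately show ?thesis using False
      by (simp add: frame_matrix_def d_def has_field_derivative_def mult.commute[of _ "_ $ r"] fun_eq_iff[symmetric])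
  qed
  have "((\<lambda>t. R t $ i $ k) has_real_derivative (\<Sum>r\<in>UNIV. I $ i $ r * d k $ r)) (at 0)" for i k
    unfolding R_def matrix_matrix_mult_def
    by (simp, intro DERIV_sum DERIV_cmult Ed)
  then have "((\<lambda>t. det (R t)) has_real_derivative (\<Sum>k\<in>UNIV. \<Sum>r\<in>UNIV. I $ k $ r * d k $ r)) (at 0)"
    by (intro det_has_derivative_at_one) (simp add: R_def IE)
  also have "(\<Sum>k\<in>UNIV. \<Sum>r\<in>UNIV. I $ k $ r * d k $ r) =
      (\<Sum>k\<in>-B. e k z \<bullet> (g c z *v frechet_derivative (e k) (at z) (axis m 1)))" (is "_ = ?S")
  proof -
    \<comment> \<open>On rows with index outside of \<open>B\<close> the matrix
      \<open>leaf_block\<close> acts as the identity. These rows of the inverse are therefore the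
      frame vectors lowered by the metric. The columns with index in \<open>B\<close> are constant
      and add nothing to the trace.\<close>
    have "transpose (?E z) ** g c z = leaf_block B (g c z) ** I"
      by (metis frame_matrix_gram[OF fr z sym] IE(2) matrix_mul_assoc matrix_mul_rid)
    then have A: "(transpose (?E z) ** g c z) $ k $ r = (leaf_block B (g c z) ** I) $ k $ r" for k r by simp
    have row: "I $ k $ r = (\<Sum>s\<in>UNIV. e k z $ s * g c z $ s $ r)" if "k \<notin> B" for k r
    proof -
      have "(leaf_block B (g c z) ** I) $ k $ r = (\<Sum>s\<in>UNIV. if s = k then I $ k $ r else 0)"
        unfolding matrix_matrix_mult_def leaf_block_def vec_lambda_beta using that
        by (intro sum.cong) auto
      then show ?thesis using A[of k r] that
        by (simp add: matrix_matrix_mult_def transpose_def frame_matrix_def)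
    qed
    have "(\<Sum>k\<in>UNIV. \<Sum>r\<in>UNIV. I $ k $ r * d k $ r) = (\<Sum>k\<in>-B. \<Sum>r\<in>UNIV. I $ k $ r * d k $ r)"
      by (intro sum.mono_neutral_right) (auto simp: d_def)
    also have "\<dots> = ?S"
    proof (intro sum.cong refl)
      fix k assume k: "k \<in> -B"
      have "(\<Sum>r\<in>UNIV. I $ k $ r * d k $ r) = (\<Sum>r\<in>UNIV. \<Sum>s\<in>UNIV. e k z $ s * g c z $ s $ r * d k $ r)"
        using k row by (simp add: sum_distrib_right)
      also have "\<dots> = e k z \<bullet> (g c z *v d k)"
        by (subst sum.swap) (simp add: inner_vec_def matrix_vector_mult_def sum_distrib_left mult_ac)
      finally show "(\<Sum>r\<in>UNIV. I $ k $ r * d k $ r) =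
          e k z \<bullet> (g c z *v frechet_derivative (e k) (at z) (axis m 1))"
        using k by (simp add: d_def)
    qed
    finally show ?thesis .
  qed
  finally have dR: "((\<lambda>t. det (R t)) has_real_derivative ?S) (at 0)" .
  have R0: "det (R 0) = 1" by (simp add: R_def IE)
  have "?E (?l t) = ?E z ** R t" for t
    unfolding R_def by (simp add: matrix_mul_assoc IE)
  then have dd: "det (?E (?l t)) = det (?E z) * det (R t)" for t by (simp add: det_mul)
  have "((\<lambda>t. ln ((det (?E z) * det (R t))\<^sup>2) / 2) has_real_derivative ?S) (at 0)"
  proof -
    let ?x = "\<lambda>t. det (?E z) * det (R t)"
    have x0: "?x 0 = det (?E z)" by (simp add: R0)
    have h: "(?x has_real_derivative det (?E z) * ?S) (at 0)" by (rule DERIV_cmult[OF dR])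
    have "0 < ?x 0 * ?x 0" using nz unfolding x0 by (simp flip: power2_eq_square)
    from DERIV_cdivide[OF DERIV_chain2[OF DERIV_ln[OF this] DERIV_mult[OF h h]], of 2]
    show ?thesis unfolding power2_eq_square
      by (rule DERIV_cong) (use nz in \<open>simp add: x0 R0 field_simps\<close>)
  qed
  then show ?thesis unfolding dd .
qed

lemma DERIV_partial:
  fixes \<phi> :: "real ^ 'n \<Rightarrow> real"
  assumes "\<phi> differentiable (at z)"
  shows "((\<lambda>t. \<phi> (z + t *\<^sub>R axis i 1)) has_real_derivative partial i \<phi> z) (at 0)"
proof -
  let ?l = "\<lambda>t. z + t *\<^sub>R axis i (1::real)"
  let ?d = "frechet_derivative \<phi> (at z)"
  have f: "(\<phi> has_derivative ?d) (at z)" using assms by (simp add: frechet_derivative_works)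
  have "((\<lambda>t. ?l t) has_derivative (\<lambda>t. t *\<^sub>R axis i 1)) (at 0)"
    by (auto intro!: derivative_eq_intros)
  from has_derivative_compose[OF this, of \<phi> ?d] f
  have "((\<lambda>t. \<phi> (?l t)) has_derivative (\<lambda>t. ?d (t *\<^sub>R axis i 1))) (at 0)" by simp
  moreover have "?d (t *\<^sub>R axis i 1) = partial i \<phi> z * t" for t
    using linear_cmul[OF has_derivative_linear[OF f]] by (simp add: partial_def)
  ultimately show ?thesis
    by (simp add: has_field_derivative_def)
qed

text \<open>The mean curvature form of the orthogonal distribution is the leafwise differential of minus
  the logarithm of the ratio of the two volume densities.\<close>

lemma mean_curv_perp_eq:
  fixes \<phi> :: "real ^ 'n \<Rightarrow> real"
  assumes U: "open U" "U = chart_img c" and z: "z \<in> U"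
    and sm: "smooth_on U (g c)" and m: "is_metric_on U (g c)"
    and d\<phi>: "\<phi> differentiable (at z)"
    and const: "\<And>i. i \<in> B \<Longrightarrow> \<forall>\<^sub>F t in nhds 0. a * \<phi> (z + t *\<^sub>R axis i 1) +
        ln (det (g c (z + t *\<^sub>R axis i 1)) / det (leaf_block B (g c (z + t *\<^sub>R axis i 1)))) / 2 = K i"
  shows "mean_curv_perp B g c z = a *\<^sub>R tangential B g c z (matrix_inv (g c z) *v (\<chi> i. partial i \<phi> z))"
    (is "_ = ?T")
proof -
  have sym: "transpose (g c w) = g c w" and pos: "v \<noteq> 0 \<Longrightarrow> v \<bullet> (g c w *v v) > 0" if "w \<in> U" for w v
    using m that by (auto simp: is_metric_on_def)
  note sp = sym[OF z] pos[OF z]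
  have inv: "invertible (g c z)" by (rule metric_invertible[OF sp])
  have Tin: "?T \<in> leaf_tangent B"
    using tangential_in[where g = g and c = c, OF sp] by (simp add: leaf_tangent_def span_scale)
  have Tip: "axis i 1 \<bullet> (g c z *v ?T) = a * partial i \<phi> z" if "i \<in> B" for i
  proof -
    have "axis i 1 \<bullet> (g c z *v ?T) =
        a * (axis i 1 \<bullet> (g c z *v (matrix_inv (g c z) *v (\<chi> i. partial i \<phi> z))))"
      by (simp add: matrix_vector_mult_scaleR tangential_inner[where g = g and c = c, OF sp that])
    then show ?thesis
      by (simp add: matrix_vector_mul_assoc matrix_inv_right[OF inv] inner_axis1)
  qed
  \<comment> \<open>Proved for every frame near \<open>z\<close>, with a right-hand side not
    mentioning the frame. This gives the uniqueness part of the definite description.\<close>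
  have eqT: "(\<Sum>\<alpha>\<in>-B. tangential B g c z (cov_deriv g c (e \<alpha>) (e \<alpha>) z)) = ?T" (is "?h = _")
    if zV: "z \<in> V" and fr: "perp_frame B g c V e" for V e
  proof (rule leaf_tangent_eqI[OF sp _ Tin])
    show "?h \<in> leaf_tangent B"
      unfolding leaf_tangent_def by (intro span_sum) (use tangential_in[where g = g and c = c, OF sp] in \<open>simp add: leaf_tangent_def\<close>)
    fix i assume i: "i \<in> B"
    have V: "open V" "V \<subseteq> U" using fr U by (auto simp: perp_frame_def)
    have dG: "g c differentiable (at z)"
    using smooth_on_differentiable[OF sm z] .
    have ax: "axis i 1 \<in> leaf_tangent B" using i unfolding leaf_tangent_def by (auto intro: span_base)
    have "axis i 1 \<bullet> (g c z *v ?h) = (\<Sum>\<alpha>\<in>-B. axis i 1 \<bullet> (g c z *v cov_deriv g c (e \<alpha>) (e \<alpha>) z))"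
      by (simp add: linear_sum[OF matrix_vector_mul_linear] o_def inner_sum_right
          tangential_inner[where g = g and c = c, OF sp i])
    also have "\<dots> = (\<Sum>\<alpha>\<in>-B. e \<alpha> z \<bullet> (g c z *v frechet_derivative (e \<alpha>) (at z) (axis i 1)))"
    proof (intro sum.cong refl cov_deriv_unit_normal[where g = g and c = c, OF V(1) zV _ inv dG])
      fix \<alpha> w assume a: "\<alpha> \<in> -B" "w \<in> V"
      then show "e \<alpha> w \<bullet> (g c w *v e \<alpha> w) = 1" using fr by (auto simp: perp_frame_def metric_ip_def)
      have "e \<alpha> w \<bullet> (g c w *v axis i 1) = 0" using fr a ax by (auto simp: perp_frame_def metric_ip_def)
      then show "axis i 1 \<bullet> (g c w *v e \<alpha> w) = 0"
        using symmetric_form[OF sym] a V by (metis subsetD)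
    next
      fix \<alpha> assume "\<alpha> \<in> -B"
      then show "e \<alpha> differentiable (at z)"
        using fr zV smooth_on_differentiable[of V "e \<alpha>"] by (simp add: perp_frame_def)
    qed (use sym V in auto)
    finally have ip: "axis i 1 \<bullet> (g c z *v ?h) =
      (\<Sum>\<alpha>\<in>-B. e \<alpha> z \<bullet> (g c z *v frechet_derivative (e \<alpha>) (at z) (axis i 1)))" (is "_ = ?D") .
    let ?l = "\<lambda>t. z + t *\<^sub>R axis i (1::real)"
    note ld = ln_det_frame_derivative[where m = i, OF fr zV sp]
    have "\<forall>\<^sub>F t in nhds 0. ?l t \<in> V"
    proof (rule topological_tendstoD)
      show "(?l \<longlongrightarrow> z) (nhds 0)"
        using tendsto_at_iff_tendsto_nhds[of ?l 0] by (auto intro!: tendsto_eq_intros)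
    qed (use V zV in auto)
    \<comment> \<open>The squared frame determinant is the inverse of the squared ratio of volume
      densities, so \<open>const\<close> expresses its logarithm by \<phi> up to the constant
      \<open>K i\<close>. Both sides are then differentiated at 0.\<close>
    then have "\<forall>\<^sub>F t in nhds 0. a * \<phi> (?l t) - K i = ln ((det (frame_matrix B e (?l t)))\<^sup>2) / 2"
      using const[OF i]
    proof eventually_elim
      case (elim t)
      have w: "?l t \<in> U" using elim V by auto
      note dp = det_pos_if_metric[OF sym[OF w] pos[OF w]] leaf_block_metric[OF sym[OF w] pos[OF w], of B]
      have "ln ((det (frame_matrix B e (?l t)))\<^sup>2) = - ln (det (g c (?l t)) / det (leaf_block B (g c (?l t))))"
        using dp by (simp add: frame_matrix_det(1)[OF fr elim(1) sym[OF w] pos[OF w]] ln_div)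
      then show ?case using elim(2) by simp
    qed
    then have "((\<lambda>t. a * \<phi> (?l t) - K i) has_real_derivative ?D) (at 0)"
      using ld by (subst DERIV_cong_ev[OF refl _ refl])
    moreover have "((\<lambda>t. a * \<phi> (?l t) - K i) has_real_derivative a * partial i \<phi> z) (at 0)"
    proof -
      note DERIV_partial[OF d\<phi>, of i]
      then show ?thesis by (auto intro!: derivative_eq_intros)
    qed
    ultimately have "?D = a * partial i \<phi> z" by (rule DERIV_unique)
    then show "axis i 1 \<bullet> (g c z *v ?h) = axis i 1 \<bullet> (g c z *v ?T)"
      using ip Tip[OF i] by simp
  qed
  \<comment> \<open>The existence part: the members of the adapted frame with index outside of
    \<open>B\<close> form a normal frame on all of \<open>U\<close>.\<close>
  obtain e where eB: "orthoframe U (g c) B e" and eU: "orthoframe U (g c) UNIV e"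
    using orthoframe_ex[OF U(1) sm m] by blast
  have frU: "perp_frame B g c U e"
    unfolding perp_frame_def
  proof (intro conjI ballI)
    fix w \<alpha> v assume w: "w \<in> U" and a: "\<alpha> \<in> -B" and "v \<in> leaf_tangent B"
    then have "v \<in> span ((\<lambda>\<alpha>. e \<alpha> w) ` B)" using eB by (simp add: orthoframe_def)
    then show "metric_ip g c w (e \<alpha> w) v = 0"
      unfolding metric_ip_def
    proof (induction rule: span_induct_alt)
      case (step k x y)
      then obtain \<beta> where "\<beta> \<in> B" "x = e \<beta> w" by auto
      then have "e \<alpha> w \<bullet> (g c w *v x) = 0" using eU a w by (auto simp: orthoframe_def)
      then show ?case
        using step by (simp add: matrix_vector_right_distrib inner_add_right matrix_vector_mult_scaleR)
    qed simp
  qed (use U eU in \<open>auto simp: orthoframe_def metric_ip_def\<close>)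
  show ?thesis
    unfolding mean_curv_perp_def
  proof (rule the_equality)
    show "\<exists>V e. z \<in> V \<and> perp_frame B g c V e \<and>
        ?T = (\<Sum>\<alpha>\<in>-B. tangential B g c z (cov_deriv g c (e \<alpha>) (e \<alpha>) z))"
      using z frU eqT[OF z frU] by (intro exI[of _ U] exI[of _ e]) simp
  next
    fix h assume "\<exists>V e. z \<in> V \<and> perp_frame B g c V e \<and>
        h = (\<Sum>\<alpha>\<in>-B. tangential B g c z (cov_deriv g c (e \<alpha>) (e \<alpha>) z))"
    then obtain V e where "z \<in> V" "perp_frame B g c V e"
        "h = (\<Sum>\<alpha>\<in>-B. tangential B g c z (cov_deriv g c (e \<alpha>) (e \<alpha>) z))" by (elim exE conjE)
    then show "h = ?T" by (simp only: eqT)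
  qed
qed

section \<open>Leaves and plaques\<close>

locale foliated_manifold =
  fixes A :: "('m::{t2_space, second_countable_topology}, 'n::finite) chart set"
    and B :: "'n set" and \<F> :: "'m set set"
  assumes smooth_structure: "smooth_structure A" and foliation: "foliation A B \<F>"
begin

abbreviation fol_charts :: "('m, 'n) chart set" where
  "fol_charts \<equiv> foliated_charts A B \<F>"

lemma chart_facts:
  assumes "c \<in> A"
  shows open_chart_dom: "open (chart_dom c)" and open_chart_img: "open (chart_img c)"
    and continuous_chart_map: "continuous_on (chart_dom c) (chart_map c)"
    and continuous_chart_inv: "continuous_on (chart_img c) (chart_inv c)"
    and chart_inv_map: "x \<in> chart_dom c \<Longrightarrow> chart_inv c (chart_map c x) = x"
    and chart_map_inv: "z \<in> chart_img c \<Longrightarrow> chart_map c (chart_inv c z) = z"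
    and chart_inv_dom: "z \<in> chart_img c \<Longrightarrow> chart_inv c z \<in> chart_dom c"
    and chart_map_img: "x \<in> chart_dom c \<Longrightarrow> chart_map c x \<in> chart_img c"
proof -
  have "is_chart c" using assms smooth_structure by (auto simp: smooth_structure_def)
  then show "open (chart_dom c)" "open (chart_img c)"
    "continuous_on (chart_dom c) (chart_map c)" "continuous_on (chart_img c) (chart_inv c)"
    "x \<in> chart_dom c \<Longrightarrow> chart_inv c (chart_map c x) = x"
    "z \<in> chart_img c \<Longrightarrow> chart_map c (chart_inv c z) = z"
    by (auto simp: is_chart_def homeomorphism_def)
  show "z \<in> chart_img c \<Longrightarrow> chart_inv c z \<in> chart_dom c"
    using \<open>is_chart c\<close> by (auto simp: is_chart_def homeomorphism_def)
  show "x \<in> chart_dom c \<Longrightarrow> chart_map c x \<in> chart_img c" by (simp add: chart_img_def)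
qed

lemma fol_charts_subset: "c \<in> fol_charts \<Longrightarrow> c \<in> A"
  by (simp add: foliated_charts_def)

lemmas fol_chart_facts = chart_facts[OF fol_charts_subset]

lemma open_chart_preimage:
  assumes "c \<in> A" "open U" shows "open {x \<in> chart_dom c. chart_map c x \<in> U}"
  using continuous_open_preimage[OF continuous_chart_map open_chart_dom assms(2)] assms(1)
  by (simp add: vimage_def Int_def)

lemma open_chart_inv_preimage:
  assumes "c \<in> A" "open U" shows "open {z \<in> chart_img c. chart_inv c z \<in> U}"
  using continuous_open_preimage[OF continuous_chart_inv open_chart_img assms(2)] assms(1)
  by (simp add: vimage_def Int_def)

lemma fol_chart_at: obtains c where "c \<in> fol_charts" "x \<in> chart_dom c"
  using foliation unfolding foliation_def by blast

lemma leaf_at: obtains L where "L \<in> \<F>" "x \<in> L"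
  using foliation unfolding foliation_def by blast

lemma leaf_unique: "L \<in> \<F> \<Longrightarrow> L' \<in> \<F> \<Longrightarrow> x \<in> L \<Longrightarrow> x \<in> L' \<Longrightarrow> L = L'"
  using foliation by (auto simp: foliation_def disjoint_def)

lemma leaf_of_eq: "L \<in> \<F> \<Longrightarrow> x \<in> L \<Longrightarrow> leaf_of \<F> x = L"
  unfolding leaf_of_def by (rule the_equality) (use leaf_unique in blast)+

lemma plaque_self: "x \<in> chart_dom c \<Longrightarrow> x \<in> plaque B c x"
  by (simp add: plaque_def)

lemma plaque_eq: "y \<in> plaque B c x \<Longrightarrow> plaque B c y = plaque B c x"
  by (auto simp: plaque_def)

text \<open>A foliated chart only guarantees that each component of a leaf in its domain is some
  plaque; the point \<open>x\<close> identifies which one.\<close>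

lemma plaque_component:
  assumes "c \<in> fol_charts" "L \<in> \<F>" "x \<in> chart_dom c" "x \<in> L"
  shows "connected_component_set (chart_dom c \<inter> L) x = plaque B c x"
proof -
  have "connected_component_set (chart_dom c \<inter> L) x \<in> components (chart_dom c \<inter> L)"
    using assms by (auto simp: components_def)
  then obtain y where y: "connected_component_set (chart_dom c \<inter> L) x = plaque B c y"
    using assms(1,2) unfolding foliated_charts_def by blast
  moreover have "x \<in> connected_component_set (chart_dom c \<inter> L) x" using assms by simp
  ultimately show ?thesis using plaque_eq by metis
qed

lemma plaque_subset_leaf:
  assumes "c \<in> fol_charts" "L \<in> \<F>" "x \<in> chart_dom c" "x \<in> L"
  shows "plaque B c x \<subseteq> L"
  using plaque_component[OF assms] connected_component_subset[of "chart_dom c \<inter> L" x] by auto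

lemma connected_subset_plaque:
  assumes "c \<in> fol_charts" "L \<in> \<F>" "connected T" "T \<subseteq> chart_dom c \<inter> L" "x \<in> T"
  shows "T \<subseteq> plaque B c x"
  using connected_component_maximal[of x T "chart_dom c \<inter> L"] plaque_component[OF assms(1,2), of x] assms
  by auto

text \<open>The principle that carries local statements over to whole leaves: a path in
  \<open>L\<close> is, for short times, inside one plaque, so \<open>Q\<close> is locally constant
  along it. It is applied both to real values and to truth values, that is, to membership in a
  set.\<close>

lemma leaf_locally_constant:
  assumes L: "L \<in> \<F>"
    and loc: "\<And>x. x \<in> L \<Longrightarrow>
      \<exists>c\<in>fol_charts. x \<in> chart_dom c \<and> (\<forall>y\<in>plaque B c x. Q y = Q x)"
    and xy: "x \<in> L" "y \<in> L"
  shows "Q x = Q y"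
proof -
  have "path_connected L" using L foliation by (simp add: foliation_def)
  then obtain \<gamma> where \<gamma>: "path \<gamma>" "path_image \<gamma> \<subseteq> L" "pathstart \<gamma> = x" "pathfinish \<gamma> = y"
    using xy unfolding path_connected_def by blast
  have cont: "continuous_on {0..1} \<gamma>" using \<gamma> by (simp add: path_def)
  have inL: "\<gamma> t \<in> L" if "t \<in> {0..1}" for t using \<gamma> that by (auto simp: path_image_def)
  have "(\<lambda>t. Q (\<gamma> t)) constant_on {0..1}"
  proof (rule locally_constant_imp_constant)
    fix t :: real assume t: "t \<in> {0..1}"
    obtain c where c: "c \<in> fol_charts" "\<gamma> t \<in> chart_dom c" "\<forall>y\<in>plaque B c (\<gamma> t). Q y = Q (\<gamma> t)"
      using loc[OF inL[OF t]] by blast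
    obtain U where U: "open U" "U \<inter> {0..1} = \<gamma> -` chart_dom c \<inter> {0..1}"
      using cont[unfolded continuous_on_open_invariant, rule_format, OF fol_chart_facts(1)[OF c(1)]]
      by auto
    then have "t \<in> U" using t c by auto
    then obtain d where d: "d > 0" "ball t d \<subseteq> U" using U(1) openE by blast
    let ?T = "ball t d \<inter> {0..1}"
    have "connected ?T" by (intro convex_connected convex_Int convex_ball) auto
    then have "connected (\<gamma> ` ?T)"
      by (intro connected_continuous_image) (auto intro: continuous_on_subset[OF cont])
    moreover have "\<gamma> ` ?T \<subseteq> chart_dom c \<inter> L" using U d inL by blast
    moreover have "\<gamma> t \<in> \<gamma> ` ?T" using t d by auto
    ultimately have "\<gamma> ` ?T \<subseteq> plaque B c (\<gamma> t)" by (rule connected_subset_plaque[OF c(1) L])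
    then show "\<exists>T. openin (top_of_set {0..1}) T \<and> t \<in> T \<and> (\<forall>s\<in>T. Q (\<gamma> s) = Q (\<gamma> t))"
      using c(3) t d by (intro exI[of _ ?T]) (auto simp: openin_open)
  qed simp
  then have "Q (\<gamma> 0) = Q (\<gamma> 1)" by (auto simp: constant_on_def)
  then show ?thesis using \<gamma> by (simp add: pathstart_def pathfinish_def)
qed

text \<open>A plaque of \<open>d\<close> meets the plaque of \<open>c\<close> in a relatively open
  set, and distinct plaques of \<open>d\<close> are disjoint. Second countability therefore leaves
  only countably many.\<close>

lemma countable_plaques_meeting:
  assumes L: "L \<in> \<F>" and c: "c \<in> fol_charts" and d: "d \<in> fol_charts"
    and x: "x \<in> chart_dom c" "x \<in> L"
  shows "countable {P' \<in> plaque B d ` (chart_dom d \<inter> L). P' \<inter> plaque B c x \<noteq> {}}"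
proof -
  let ?P = "plaque B c x"
  obtain \<B> :: "'m set set" where \<B>: "countable \<B>" "topological_basis \<B>"
    using ex_countable_basis by blast
  \<comment> \<open>The surjection from the countable base sends a basic set to the plaque of
    \<open>d\<close> through an arbitrary point that it shares with the plaque of
    \<open>c\<close>.\<close>
  have "{P' \<in> plaque B d ` (chart_dom d \<inter> L). P' \<inter> ?P \<noteq> {}} \<subseteq>
      (\<lambda>U. plaque B d (SOME y. y \<in> U \<inter> ?P)) ` \<B>"
  proof
    fix P' assume "P' \<in> {P' \<in> plaque B d ` (chart_dom d \<inter> L). P' \<inter> ?P \<noteq> {}}"
    then obtain y' y where y': "y' \<in> chart_dom d" "y' \<in> L" "P' = plaque B d y'"
      and y: "y \<in> plaque B d y'" "y \<in> ?P" by auto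
    have yL: "y \<in> L" using plaque_subset_leaf[OF c L x] y by auto
    have yd: "y \<in> chart_dom c" "y \<in> chart_dom d" using y by (auto simp: plaque_def)
    let ?W = "{z \<in> chart_img c. chart_inv c z \<in> chart_dom d}" and ?y = "chart_map c y"
    have "open ?W" by (intro open_chart_inv_preimage fol_charts_subset c fol_chart_facts(1) d)
    moreover have "?y \<in> ?W" using yd fol_chart_facts[OF c] by auto
    ultimately obtain r where r: "r > 0" "ball ?y r \<subseteq> ?W" using openE by blast
    \<comment> \<open>A slice of a ball by a plaque is convex. Its image in the manifold is a
      connected part of the leaf, hence inside a single plaque of \<open>d\<close>; this gives the
      relative openness.\<close>
    define S where "S = ball ?y r \<inter> {z. \<forall>i\<in>-B. z $ i = ?y $ i}"
    have "convex {z :: real ^ 'n. \<forall>i\<in>-B. z $ i = ?y $ i}"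
      by (rule convexI) (auto simp: distrib_right[symmetric])
    then have "connected S" unfolding S_def by (intro convex_connected convex_Int convex_ball)
    then have con: "connected (chart_inv c ` S)"
      by (intro connected_continuous_image continuous_on_subset[OF fol_chart_facts(4)[OF c]])
         (use r in \<open>auto simp: S_def\<close>)
    have SP: "chart_inv c ` S \<subseteq> ?P"
    proof
      fix v assume "v \<in> chart_inv c ` S"
      then obtain z where z: "v = chart_inv c z" "z \<in> S" by blast
      then have "z \<in> chart_img c" using r by (auto simp: S_def)
      then have "v \<in> plaque B c y"
        using z fol_chart_facts[OF c] by (auto simp: plaque_def S_def)
      then show "v \<in> ?P" using plaque_eq[OF y(2)] by simp
    qed
    have "chart_inv c ` S \<subseteq> chart_dom d \<inter> L"
      using SP plaque_subset_leaf[OF c L x] r by (auto simp: S_def)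
    moreover have "y \<in> chart_inv c ` S"
      using r yd fol_chart_facts[OF c] by (auto simp: S_def image_iff intro!: bexI[of _ ?y])
    ultimately have Sd: "chart_inv c ` S \<subseteq> plaque B d y" by (rule connected_subset_plaque[OF d L con])
    let ?N = "{x \<in> chart_dom c. chart_map c x \<in> ball ?y r}"
    have "open ?N" by (intro open_chart_preimage fol_charts_subset c) simp
    moreover have "y \<in> ?N" using yd r by auto
    ultimately obtain U where U: "U \<in> \<B>" "y \<in> U" "U \<subseteq> ?N"
      using topological_basisE[OF \<B>(2)] by blast
    have "U \<inter> ?P \<subseteq> plaque B d y"
    proof
      fix v assume v: "v \<in> U \<inter> ?P"
      then have "v \<in> ?N" using U by auto
      moreover have "chart_map c v \<in> S" using calculation v y by (auto simp: S_def plaque_def)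
      ultimately have "v \<in> chart_inv c ` S" using fol_chart_facts(5)[OF c] by (force simp: image_iff)
      then show "v \<in> plaque B d y" using Sd by auto
    qed
    moreover have "(SOME y. y \<in> U \<inter> ?P) \<in> U \<inter> ?P" using U y by (intro someI[of "\<lambda>y. y \<in> U \<inter> ?P" y] IntI)
    ultimately have "(SOME y. y \<in> U \<inter> ?P) \<in> plaque B d y" by (rule subsetD)
    from plaque_eq[OF this] have "P' = plaque B d (SOME y. y \<in> U \<inter> ?P)"
      using plaque_eq[OF y(1)] y'(3) by simp
    then show "P' \<in> (\<lambda>U. plaque B d (SOME y. y \<in> U \<inter> ?P)) ` \<B>"
      using U(1) by (rule image_eqI)
  qed
  then show ?thesis by (rule countable_subset) (intro countable_image \<B>(1))
qed

lemma countable_fol_atlas: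
  obtains C where "countable C" "C \<subseteq> fol_charts" "(\<Union>c\<in>C. chart_dom c) = UNIV"
proof -
  obtain \<D> where \<D>: "\<D> \<subseteq> chart_dom ` fol_charts" "countable \<D>" "\<Union>\<D> = \<Union>(chart_dom ` fol_charts)"
    by (rule Lindelof[of "chart_dom ` fol_charts"]) (auto intro: fol_chart_facts(1))
  moreover have "\<Union>(chart_dom ` fol_charts) = UNIV" using foliation by (auto simp: foliation_def)
  ultimately show ?thesis
    using that by (metis countable_subset_image)
qed

text \<open>A path in a leaf only visits plaques that can be reached from the first one by a chain of
  intersecting plaques, and each plaque meets only countably many others.\<close>

lemma countable_plaques:
  assumes L: "L \<in> \<F>" and c: "c \<in> fol_charts"
  shows "countable (plaque B c ` (chart_dom c \<inter> L))"
proof -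
  obtain C where C: "countable C" "C \<subseteq> fol_charts" "(\<Union>c\<in>C. chart_dom c) = UNIV"
    by (rule countable_fol_atlas)
  define \<P> where "\<P> = (\<Union>d\<in>C. plaque B d ` (chart_dom d \<inter> L))"
  define R where "R = {(P, P'). P \<in> \<P> \<and> P' \<in> \<P> \<and> P' \<inter> P \<noteq> {}}"
  have met: "countable {P' \<in> plaque B d ` (chart_dom d \<inter> L). P' \<inter> P \<noteq> {}}"
    if P: "P \<in> \<P>" and d: "d \<in> fol_charts" for P d
  proof -
    obtain e x where e: "e \<in> C" "x \<in> chart_dom e" "x \<in> L" "P = plaque B e x"
      using P unfolding \<P>_def by blast
    then have "e \<in> fol_charts" using C by blast
    from countable_plaques_meeting[OF L this d] e show ?thesis by simp
  qed
  have "countable (R `` Y)" if "countable Y" for Y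
  proof -
    have "R `` Y \<subseteq> (\<Union>P\<in>Y \<inter> \<P>. \<Union>d\<in>C. {P' \<in> plaque B d ` (chart_dom d \<inter> L). P' \<inter> P \<noteq> {}})"
      by (auto simp: R_def \<P>_def)
    moreover have "countable \<dots>"
      by (intro countable_UN countable_Int1 that C met) (use C in auto)
    ultimately show ?thesis by (rule countable_subset)
  qed
  then have co: "countable (R\<^sup>* `` {P0})" for P0 by (rule countable_rtrancl) simp_all
  have "L \<noteq> {}" using L foliation unfolding foliation_def by metis
  then obtain x0 where x0: "x0 \<in> L" by blast
  obtain c0 where c0: "c0 \<in> C" "x0 \<in> chart_dom c0" using C by blast
  define P0 where "P0 = plaque B c0 x0"
  have P0: "P0 \<in> \<P>" using x0 c0 unfolding P0_def \<P>_def by blast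
  have reach: "P \<in> \<P>" if "P \<in> R\<^sup>* `` {P0}" for P
    using that P0 by (auto simp: R_def elim: rtranclE)
  have cover: "y \<in> \<Union>(R\<^sup>* `` {P0})" if y: "y \<in> L" for y
  proof -
    \<comment> \<open>A plaque that meets a reachable plaque is reachable itself, so being covered
      by reachable plaques is constant on each plaque of the countable atlas.\<close>
    have "(x0 \<in> \<Union>(R\<^sup>* `` {P0})) = (y \<in> \<Union>(R\<^sup>* `` {P0}))"
    proof (rule leaf_locally_constant[OF L _ x0 y])
      fix x assume x: "x \<in> L"
      obtain d where d: "d \<in> C" "x \<in> chart_dom d" using C by blast
      let ?P = "plaque B d x"
      have P: "?P \<in> \<P>" using d x unfolding \<P>_def by blast
      have "?P \<in> R\<^sup>* `` {P0}" if v: "v \<in> ?P" "v \<in> P'" "P' \<in> R\<^sup>* `` {P0}" for v P'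
      proof -
        have "(P', ?P) \<in> R" using reach[OF v(3)] P v by (auto simp: R_def)
        then show ?thesis using v(3) by (auto intro: rtrancl_into_rtrancl)
      qed
      then have "v \<in> \<Union>(R\<^sup>* `` {P0}) \<longleftrightarrow> ?P \<in> R\<^sup>* `` {P0}" if "v \<in> ?P" for v
        using that by blast
      then show "\<exists>c\<in>fol_charts. x \<in> chart_dom c \<and>
          (\<forall>y\<in>plaque B c x. (y \<in> \<Union>(R\<^sup>* `` {P0})) = (x \<in> \<Union>(R\<^sup>* `` {P0})))"
        using d C plaque_self[OF d(2)] by blast
    qed
    moreover have "x0 \<in> \<Union>(R\<^sup>* `` {P0})" using plaque_self[OF c0(2)] by (auto simp: P0_def)
    ultimately show ?thesis by simp
  qed
  \<comment> \<open>The chart \<open>c\<close> need not belong to the countable atlas; each of its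
    plaques in \<open>L\<close> still meets a reachable one.\<close>
  have "plaque B c ` (chart_dom c \<inter> L) \<subseteq>
      (\<Union>P\<in>R\<^sup>* `` {P0}. {P' \<in> plaque B c ` (chart_dom c \<inter> L). P' \<inter> P \<noteq> {}})"
  proof
    fix P' assume P': "P' \<in> plaque B c ` (chart_dom c \<inter> L)"
    then obtain x where x: "x \<in> chart_dom c" "x \<in> L" "P' = plaque B c x" by auto
    obtain P where "P \<in> R\<^sup>* `` {P0}" "x \<in> P" using cover[OF x(2)] by auto
    then show "P' \<in> (\<Union>P\<in>R\<^sup>* `` {P0}. {P' \<in> plaque B c ` (chart_dom c \<inter> L). P' \<inter> P \<noteq> {}})"
      using P' x plaque_self[OF x(1)] by auto
  qed
  moreover have "countable \<dots>"
    by (intro countable_UN co met reach c)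
  ultimately show ?thesis by (rule countable_subset)
qed

definition saturation :: "'m set \<Rightarrow> 'm set" where
  "saturation U = \<Union>{L \<in> \<F>. L \<inter> U \<noteq> {}}"

lemma saturation_iff: "L \<in> \<F> \<Longrightarrow> x \<in> L \<Longrightarrow> x \<in> saturation U \<longleftrightarrow> L \<inter> U \<noteq> {}"
  using leaf_unique by (auto simp: saturation_def)

text \<open>Inside a foliated chart, a leafwise translation of coordinates carries a neighbourhood
  of one point of a plaque to a neighbourhood of another without leaving the respective leaves.
  Membership in the interior of the saturation is thus constant on plaques, and so on
  leaves.\<close>

lemma open_saturation:
  assumes "open U"
  shows "open (saturation U)"
proof -
  let ?I = "interior (saturation U)"
  have sub: "U \<subseteq> saturation U"
  proof
    fix x assume "x \<in> U"
    moreover obtain L where "L \<in> \<F>" "x \<in> L" by (rule leaf_at)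
    ultimately show "x \<in> saturation U" by (auto simp: saturation_iff)
  qed
  have move: "w \<in> ?I" if c: "c \<in> fol_charts" and w: "w \<in> chart_dom c" and v: "v \<in> plaque B c w" "v \<in> ?I"
    for c v w
  proof -
    \<comment> \<open>As \<open>v\<close> and \<open>w\<close> lie in one plaque, the transverse
      components of this vector vanish.\<close>
    let ?d = "chart_map c v - chart_map c w"
    let ?Z = "{z \<in> chart_img c. chart_inv c z \<in> ?I}"
    let ?N = "{x \<in> chart_dom c. chart_map c x \<in> (\<lambda>z. z + ?d) -` ?Z}"
    note ff = fol_chart_facts[OF c]
    have "open ?N"
      by (intro open_chart_preimage fol_charts_subset c continuous_open_vimage
          open_chart_inv_preimage continuous_intros) auto
    moreover have "w \<in> ?N" using w v ff by (auto simp: plaque_def)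
    moreover have "?N \<subseteq> saturation U"
    proof safe
      fix x assume x: "x \<in> chart_dom c" "chart_map c x + ?d \<in> chart_img c"
        "chart_inv c (chart_map c x + ?d) \<in> ?I"
      let ?y = "chart_inv c (chart_map c x + ?d)"
      obtain L where L: "L \<in> \<F>" "?y \<in> L" by (rule leaf_at)
      have "?y \<in> saturation U" using x(3) interior_subset by blast
      then have "L \<inter> U \<noteq> {}" using L saturation_iff by simp
      moreover have "x \<in> plaque B c ?y" using x v ff by (auto simp: plaque_def)
      then have "x \<in> L" using plaque_subset_leaf[OF c L(1) _ L(2)] x ff by auto
      ultimately show "x \<in> saturation U" using L saturation_iff by simp
    qed
    ultimately show ?thesis by (meson interiorI)
  qed
  have "x \<in> ?I" if x: "x \<in> saturation U" for x
  proof -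
    obtain L y where L: "L \<in> \<F>" "x \<in> L" "y \<in> L" "y \<in> U" using x by (auto simp: saturation_def)
    have "(x \<in> ?I) = (y \<in> ?I)"
    proof (rule leaf_locally_constant[OF L(1) _ L(2,3)])
      fix w assume "w \<in> L"
      obtain c where c: "c \<in> fol_charts" "w \<in> chart_dom c" by (rule fol_chart_at)
      have "v \<in> ?I \<longleftrightarrow> w \<in> ?I" if v: "v \<in> plaque B c w" for v
        using move[OF c v] move[OF c(1), of v w] v c(2) plaque_eq[OF v] plaque_self[OF c(2)]
        by (auto simp: plaque_def)
      then show "\<exists>c\<in>fol_charts. w \<in> chart_dom c \<and> (\<forall>v\<in>plaque B c w. (v \<in> ?I) = (w \<in> ?I))"
        using c by blast
    qed
    then show ?thesis using L sub assms by (meson interior_maximal subsetD)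
  qed
  then have "saturation U = ?I" using interior_subset by auto
  then show ?thesis by (metis open_interior)
qed

end

section \<open>Integration in charts and over plaques\<close>

text \<open>A closed ball for the maximum norm: a slice by a plaque is empty or a product of
  intervals of length \<open>2 * \<epsilon>\<close>, whatever the leafwise coordinates of the
  centre.\<close>

definition cube :: "real ^ 'n \<Rightarrow> real \<Rightarrow> (real ^ 'n::finite) set" where
  "cube z \<epsilon> = {w. \<forall>i. \<bar>w $ i - z $ i\<bar> \<le> \<epsilon>}"

lemma cube_eq_cbox: "cube z \<epsilon> = cbox (\<chi> i. z $ i - \<epsilon>) (\<chi> i. z $ i + \<epsilon>)"
proof -
  have "\<bar>a - b\<bar> \<le> \<epsilon> \<longleftrightarrow> b - \<epsilon> \<le> a \<and> a \<le> b + \<epsilon>" for a b :: real by auto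
  then show ?thesis by (simp add: cube_def set_eq_iff mem_box_cart)
qed

lemma closed_cube: "closed (cube z \<epsilon>)"
  unfolding cube_eq_cbox by (rule closed_cbox)

lemma cube_small:
  fixes z :: "real ^ 'n"
  assumes "open U" "z \<in> U"
  obtains \<delta> where "\<delta> > 0" "\<And>\<epsilon>. \<epsilon> \<le> \<delta> \<Longrightarrow> cube z \<epsilon> \<subseteq> U"
proof -
  obtain r where r: "r > 0" "ball z r \<subseteq> U" using assms openE by blast
  \<comment> \<open>The additional 1 makes the bound of the norm by the sum of the coordinates
    strict.\<close>
  let ?n = "real CARD('n) + 1"
  have "cube z \<epsilon> \<subseteq> U" if "\<epsilon> \<le> r / ?n" for \<epsilon>
  proof
    fix w assume "w \<in> cube z \<epsilon>"
    then have "(\<Sum>i\<in>UNIV. \<bar>(w - z) $ i\<bar>) \<le> (\<Sum>i\<in>(UNIV :: 'n set). r / ?n)"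
      using that by (intro sum_mono) (auto simp: cube_def intro: order_trans)
    also have "\<dots> < r" using r by (simp add: field_simps)
    finally have "norm (w - z) < r" using norm_le_l1_cart[of "w - z"] by linarith
    then show "w \<in> U" using r by (auto simp: dist_norm norm_minus_commute)
  qed
  then show ?thesis using r that[of "r / ?n"] by simp
qed

lemma emeasure_cube:
  fixes z :: "real ^ 'n"
  assumes "\<epsilon> \<ge> 0"
  shows "emeasure lborel (cube z \<epsilon>) = ennreal ((2 * \<epsilon>) ^ CARD('n))"
proof -
  have d: "((\<chi> i. z $ i + \<epsilon>) - (\<chi> i. z $ i - \<epsilon>)) \<bullet> b = 2 * \<epsilon>" if b: "b \<in> Basis" for b :: "real ^ 'n"
  proof -
    obtain i where "b = axis i 1" using b by (auto simp: Basis_vec_def)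
    then show ?thesis by (simp add: inner_axis)
  qed
  have "(\<chi> i. z $ i - \<epsilon>) \<bullet> b \<le> (\<chi> i. z $ i + \<epsilon>) \<bullet> b" if "b \<in> Basis" for b
    using d[OF that] assms by (simp add: inner_diff_left)
  from emeasure_lborel_cbox[OF this] show ?thesis
    unfolding cube_eq_cbox by (simp add: d)
qed

lemma slice_point_measurable:
  "slice_point B a \<in> borel_measurable (Pi\<^sub>M B (\<lambda>_. lborel))"
proof -
  define f where "f i y = slice_point B a y $ i" for i y
  have "f i \<in> borel_measurable (Pi\<^sub>M B (\<lambda>_. lborel))" for i
    unfolding f_def
    by (cases "i \<in> B")
       (auto simp: slice_point_def measurable_component_singleton[where M = "\<lambda>_. lborel", simplified])
  then have "(\<lambda>y. \<Sum>i\<in>UNIV. f i y *\<^sub>R axis i (1::real)) \<in> borel_measurable (Pi\<^sub>M B (\<lambda>_. lborel))"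
    by (intro borel_measurable_sum borel_measurable_scaleR borel_measurable_const)
  moreover have "slice_point B a = (\<lambda>y. \<Sum>i\<in>UNIV. f i y *\<^sub>R axis i 1)"
    unfolding f_def by (rule ext) (rule linear_vec_expand[OF linear_ident])
  ultimately show ?thesis by simp
qed

lemma continuous_on_det:
  fixes M :: "'a::topological_space \<Rightarrow> real ^ 'n ^ 'n"
  assumes "\<And>i j. continuous_on S (\<lambda>z. M z $ i $ j)"
  shows "continuous_on S (\<lambda>z. det (M z))"
  unfolding det_def
  by (intro continuous_on_sum continuous_on_mult continuous_on_const continuous_on_prod assms)

lemma nn_integral_slice_cube:
  assumes "\<epsilon> \<ge> 0"
  shows "(\<integral>\<^sup>+ y. indicator (cube z \<epsilon>) (slice_point B a y) \<partial>Pi\<^sub>M B (\<lambda>_. lborel)) =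
    (if \<forall>i\<in>-B. \<bar>a $ i - z $ i\<bar> \<le> \<epsilon> then ennreal (2 * \<epsilon>) ^ card B else 0)"
proof (cases "\<forall>i\<in>-B. \<bar>a $ i - z $ i\<bar> \<le> \<epsilon>")
  case True
  interpret product_sigma_finite "\<lambda>_. lborel" by standard
  let ?I = "\<lambda>i. {z $ i - \<epsilon>..z $ i + \<epsilon>}"
  have "(\<integral>\<^sup>+ y. indicator (cube z \<epsilon>) (slice_point B a y) \<partial>Pi\<^sub>M B (\<lambda>_. lborel)) =
      (\<integral>\<^sup>+ y. indicator (Pi\<^sub>E B ?I) y \<partial>Pi\<^sub>M B (\<lambda>_. lborel))"
  proof (intro nn_integral_cong)
    fix y assume "y \<in> space (Pi\<^sub>M B (\<lambda>_. lborel :: real measure))"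
    then have "y \<in> extensional B" by (simp add: space_PiM PiE_def)
    moreover have "\<bar>y i - z $ i\<bar> \<le> \<epsilon> \<longleftrightarrow> y i \<in> ?I i" for i by auto
    ultimately have "slice_point B a y \<in> cube z \<epsilon> \<longleftrightarrow> y \<in> Pi\<^sub>E B ?I"
      using True by (auto simp: cube_def slice_point_def PiE_iff)
    then show "(indicator (cube z \<epsilon>) (slice_point B a y) :: ennreal) = indicator (Pi\<^sub>E B ?I) y"
      by (simp add: indicator_def)
  qed
  also have "\<dots> = emeasure (Pi\<^sub>M B (\<lambda>_. lborel)) (Pi\<^sub>E B ?I)"
    by (intro nn_integral_indicator sets_PiM_I_finite) auto
  also have "\<dots> = (\<Prod>i\<in>B. emeasure lborel (?I i))" by (intro emeasure_PiM) auto
  also have "\<dots> = ennreal (2 * \<epsilon>) ^ card B" using assms by simp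
  finally show ?thesis using True by simp
next
  case False
  then have "slice_point B a y \<notin> cube z \<epsilon>" for y
    by (auto simp: cube_def slice_point_def)
  then show ?thesis using False by auto
qed

context foliated_manifold
begin

text \<open>The restriction of \<open>N\<close> to \<open>P\<close> is the push-forward of a measure
  with density on the parameter space. One statement serves the manifold, with \<open>P\<close> a
  chart domain and \<open>s\<close> the identity, and the leaves, with \<open>P\<close> a plaque and
  \<open>s\<close> a slice.\<close>

lemma nn_integral_chart:
  fixes N :: "'m measure" and \<Lambda> :: "'y measure" and \<psi> :: "'m \<Rightarrow> ennreal"
  assumes c: "c \<in> A" and N: "sets N = sets borel" and s: "s \<in> borel_measurable \<Lambda>"
    and P: "P \<in> sets borel" "P \<subseteq> chart_dom c"
    and d: "(\<lambda>y. indicator (chart_img c) (s y) * d y) \<in> borel_measurable \<Lambda>"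
    and inP: "\<And>y. y \<in> space \<Lambda> \<Longrightarrow> s y \<in> chart_img c \<Longrightarrow> chart_inv c (s y) \<in> P"
    and eq: "\<And>E. E \<in> sets borel \<Longrightarrow> E \<subseteq> P \<Longrightarrow>
      emeasure N E = (\<integral>\<^sup>+ y. indicator (chart_map c ` E) (s y) * d y \<partial>\<Lambda>)"
    and \<psi>: "\<psi> \<in> borel_measurable borel"
  shows "(\<integral>\<^sup>+ x. \<psi> x * indicator P x \<partial>N) =
    (\<integral>\<^sup>+ y. indicator (chart_img c) (s y) * \<psi> (chart_inv c (s y)) * d y \<partial>\<Lambda>)"
proof -
  note cf = chart_facts[OF c]
  \<comment> \<open>Nothing is known of \<open>chart_inv\<close> outside of the chart image;
    replacing it there by a constant makes the map Borel, and the density vanishes there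
    anyway.\<close>
  define T where "T y = (if s y \<in> chart_img c then chart_inv c (s y) else undefined)" for y
  have im: "{y \<in> space \<Lambda>. s y \<in> chart_img c} \<in> sets \<Lambda>"
    using measurable_sets[OF s borel_open[OF cf(2)]] by (simp add: vimage_def Int_def conj_commute)
  have "(\<lambda>y. chart_inv c (s y)) \<in> borel_measurable (restrict_space \<Lambda> {y. s y \<in> chart_img c})"
    by (rule measurable_compose[OF measurable_restrict_space3[OF s]
          borel_measurable_continuous_on_restrict[OF cf(4)]]) simp
  then have T: "T \<in> borel_measurable \<Lambda>"
    unfolding T_def by (subst measurable_If_restrict_space_iff[OF im]) simp
  have N1: "(indicator P :: 'm \<Rightarrow> ennreal) \<in> borel_measurable N" using P N by measurable
  have meq: "density N (indicator P) =
      distr (density \<Lambda> (\<lambda>y. indicator (chart_img c) (s y) * d y)) borel T"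
  proof (rule measure_eqI)
    fix E assume "E \<in> sets (density N (indicator P))"
    then have E: "E \<in> sets borel" using N by simp
    have "emeasure (density N (indicator P)) E = emeasure N (P \<inter> E)"
      using E P N by (subst emeasure_density[OF N1])
        (auto simp: indicator_inter_arith[symmetric] intro!: nn_integral_indicator)
    also have "\<dots> = (\<integral>\<^sup>+ y. indicator (chart_map c ` (P \<inter> E)) (s y) * d y \<partial>\<Lambda>)"
      using E P by (intro eq) auto
    also have "\<dots> = (\<integral>\<^sup>+ y. indicator (chart_img c) (s y) * d y * indicator (T -` E \<inter> space \<Lambda>) y \<partial>\<Lambda>)"
    proof (intro nn_integral_cong)
      fix y assume y: "y \<in> space \<Lambda>"
      have "s y \<in> chart_map c ` (P \<inter> E) \<longleftrightarrow> s y \<in> chart_img c \<and> T y \<in> E"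
      proof
        assume "s y \<in> chart_map c ` (P \<inter> E)"
        then obtain x where "x \<in> P" "x \<in> E" "s y = chart_map c x" by auto
        then show "s y \<in> chart_img c \<and> T y \<in> E" using P(2) cf(5,8)[of x] by (auto simp: T_def)
      next
        assume a: "s y \<in> chart_img c \<and> T y \<in> E"
        then have "chart_inv c (s y) \<in> P \<inter> E" using inP[OF y] by (auto simp: T_def)
        then show "s y \<in> chart_map c ` (P \<inter> E)"
          using cf(6)[of "s y"] a by (intro image_eqI[of _ _ "chart_inv c (s y)"]) auto
      qed
      then show "indicator (chart_map c ` (P \<inter> E)) (s y) * d y =
          indicator (chart_img c) (s y) * d y * indicator (T -` E \<inter> space \<Lambda>) y"
        using y by (auto simp: indicator_def)
    qed
    also have "\<dots> = emeasure (density \<Lambda> (\<lambda>y. indicator (chart_img c) (s y) * d y)) (T -` E \<inter> space \<Lambda>)"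
      by (rule emeasure_density[symmetric, OF d measurable_sets[OF T E]])
    also have "\<dots> = emeasure (distr (density \<Lambda> (\<lambda>y. indicator (chart_img c) (s y) * d y)) borel T) E"
      using T E by (subst emeasure_distr) auto
    finally show "emeasure (density N (indicator P)) E =
      emeasure (distr (density \<Lambda> (\<lambda>y. indicator (chart_img c) (s y) * d y)) borel T) E" .
  qed (use N in simp)
  have "(\<integral>\<^sup>+ x. \<psi> x * indicator P x \<partial>N) = (\<integral>\<^sup>+ x. \<psi> x \<partial>density N (indicator P))"
  proof -
    have "\<psi> \<in> borel_measurable N" using \<psi> N by (simp cong: measurable_cong_sets)
    then show ?thesis by (subst nn_integral_density[OF N1]) (simp_all add: mult.commute)
  qed
  also have "\<dots> = (\<integral>\<^sup>+ y. \<psi> (T y) \<partial>density \<Lambda> (\<lambda>y. indicator (chart_img c) (s y) * d y))"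
    unfolding meq using T \<psi> by (subst nn_integral_distr) auto
  also have "\<dots> = (\<integral>\<^sup>+ y. (indicator (chart_img c) (s y) * d y) * \<psi> (T y) \<partial>\<Lambda>)"
    using measurable_compose[OF T \<psi>] by (intro nn_integral_density d) simp
  also have "\<dots> = (\<integral>\<^sup>+ y. indicator (chart_img c) (s y) * \<psi> (chart_inv c (s y)) * d y \<partial>\<Lambda>)"
    by (intro nn_integral_cong) (auto simp: T_def indicator_def mult.commute)
  finally show ?thesis .
qed

lemma plaque_sets:
  assumes "c \<in> A"
  shows "plaque B c x \<in> sets borel"
proof -
  let ?K = "{z :: real ^ 'n. \<forall>i\<in>-B. z $ i = chart_map c x $ i}"
  have K: "?K = (\<Inter>i\<in>-B. {z. z $ i = chart_map c x $ i})" by auto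
  have "open (- ?K)" unfolding K
    by (intro open_Compl closed_INT ballI closed_Collect_eq continuous_intros)
  have "plaque B c x = chart_dom c - {y \<in> chart_dom c. chart_map c y \<in> - ?K}"
    by (auto simp: plaque_def)
  also have "\<dots> \<in> sets borel"
    by (intro sets.Diff borel_open open_chart_preimage open_chart_dom assms \<open>open (- ?K)\<close>)
  finally show ?thesis .
qed

end

section \<open>The two volume densities, and integration over the manifold and its leaves\<close>

locale riemannian_foliation = foliated_manifold A B \<F>
  for A :: "('m::{t2_space, second_countable_topology}, 'n::finite) chart set"
    and B :: "'n set" and \<F> :: "'m set set" +
  fixes g :: "('m, 'n) metric" and \<mu> :: "'m measure" and \<nu> :: "'m set \<Rightarrow> 'm measure"
  assumes metric: "riemannian_metric A g" and volume: "riemannian_volume A g \<mu>"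
    and closed_leaves: "\<forall>L\<in>\<F>. closed L"
    and leaf_volumes: "\<forall>L\<in>\<F>. leaf_volume A g B \<F> L (\<nu> L)"
begin

text \<open>This is the density \<open>W\<close> of the overview; \<open>leaf_vol\<close> below is
  \<open>w\<close>.\<close>

definition vol :: "('m, 'n) chart \<Rightarrow> real ^ 'n \<Rightarrow> real" where
  "vol c z = sqrt (det (g c z))"

definition leaf_vol :: "('m, 'n) chart \<Rightarrow> real ^ 'n \<Rightarrow> real" where
  "leaf_vol c z = sqrt (det (leaf_block B (g c z)))"

lemma
  assumes "c \<in> A"
  shows metric_smooth: "smooth_on (chart_img c) (g c)"
    and metric_is_metric: "is_metric_on (chart_img c) (g c)"
  using metric assms by (auto simp: riemannian_metric_def is_metric_on_def)

lemma
  assumes "c \<in> A" "z \<in> chart_img c"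
  shows det_metric_pos: "det (g c z) > 0" and det_leaf_block_pos: "det (leaf_block B (g c z)) > 0"
  using metric_is_metric[OF assms(1)] assms(2)
  by (auto simp: is_metric_on_def intro!: det_pos_if_metric leaf_block_metric)

lemma vol_pos: "c \<in> A \<Longrightarrow> z \<in> chart_img c \<Longrightarrow> vol c z > 0"
  using det_metric_pos by (simp add: vol_def)

lemma leaf_vol_pos: "c \<in> A \<Longrightarrow> z \<in> chart_img c \<Longrightarrow> leaf_vol c z > 0"
  using det_leaf_block_pos by (simp add: leaf_vol_def)

lemma
  assumes "c \<in> A"
  shows continuous_vol: "continuous_on (chart_img c) (vol c)"
    and continuous_leaf_vol: "continuous_on (chart_img c) (leaf_vol c)"
proof -
  have "Ck_on 0 (chart_img c) (g c)" using metric_smooth[OF assms] unfolding smooth_on_def by blast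
  then have "continuous_on (chart_img c) (g c)" by simp
  then have e: "continuous_on (chart_img c) (\<lambda>z. g c z $ i $ j)" for i j
    by (intro continuous_on_component)
  then have "continuous_on (chart_img c) (\<lambda>z. leaf_block B (g c z) $ i $ j)" for i j
    by (cases "i \<in> B"; cases "j \<in> B"; cases "i = j") (simp_all add: leaf_block_def)
  with e show "continuous_on (chart_img c) (vol c)" "continuous_on (chart_img c) (leaf_vol c)"
    unfolding vol_def leaf_vol_def by (intro continuous_on_real_sqrt continuous_on_det; simp)+
qed

lemma borel_chart_img_indicator:
  assumes "c \<in> A" "continuous_on (chart_img c) f"
  shows "(\<lambda>z. indicator (chart_img c) z * ennreal (f z)) \<in> borel_measurable borel"
proof -
  have "(\<lambda>z. ennreal (indicator (chart_img c) z *\<^sub>R f z)) \<in> borel_measurable borel"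
    by (intro measurable_compose[OF _ measurable_ennreal]
        borel_measurable_continuous_on_indicator assms(2) borel_open open_chart_img assms(1))
  moreover have "ennreal (indicator (chart_img c) z *\<^sub>R f z) = indicator (chart_img c) z * ennreal (f z)" for z
    by (simp add: indicator_def)
  ultimately show ?thesis by simp
qed

lemma sets_mu: "sets \<mu> = sets borel" using volume by (simp add: riemannian_volume_def)

lemma sets_nu: "L \<in> \<F> \<Longrightarrow> sets (\<nu> L) = sets borel"
  using leaf_volumes by (auto simp: leaf_volume_def)

text \<open>Closedness makes \<open>- L\<close> a Borel set. For a set that is not measurable,
  \<open>emeasure\<close> is 0 by default, and the clause in \<open>leaf_volume\<close> would say
  nothing.\<close>

lemma AE_in_leaf:
  assumes L: "L \<in> \<F>"
  shows "AE x in \<nu> L. x \<in> L"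
proof (rule AE_I')
  show "- L \<in> null_sets (\<nu> L)"
    using leaf_volumes closed_leaves L sets_nu[OF L]
    by (intro null_setsI) (auto simp: leaf_volume_def intro: borel_open)
qed auto

lemma nn_integral_volume:
  fixes \<psi> :: "'m \<Rightarrow> ennreal"
  assumes c: "c \<in> A" and \<psi>: "\<psi> \<in> borel_measurable borel"
  shows "(\<integral>\<^sup>+ x. \<psi> x * indicator (chart_dom c) x \<partial>\<mu>) =
    (\<integral>\<^sup>+ z. indicator (chart_img c) z * \<psi> (chart_inv c z) * ennreal (vol c z) \<partial>lborel)"
proof (rule nn_integral_chart[OF c sets_mu _ _ _ _ _ _ \<psi>])
  show "(\<lambda>z. indicator (chart_img c) z * ennreal (vol c z)) \<in> borel_measurable lborel"
    using borel_chart_img_indicator[OF c continuous_vol[OF c]] by simp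
  show "emeasure \<mu> E = (\<integral>\<^sup>+ z. indicator (chart_map c ` E) z * ennreal (vol c z) \<partial>lborel)"
    if "E \<in> sets borel" "E \<subseteq> chart_dom c" for E
    using volume c that by (simp add: riemannian_volume_def vol_def)
qed (use chart_facts[OF c] in auto)

lemma nn_integral_plaque:
  fixes \<psi> :: "'m \<Rightarrow> ennreal"
  assumes c: "c \<in> fol_charts" and L: "L \<in> \<F>" and x: "x \<in> chart_dom c" "x \<in> L"
    and \<psi>: "\<psi> \<in> borel_measurable borel"
  shows "(\<integral>\<^sup>+ y. \<psi> y * indicator (plaque B c x) y \<partial>\<nu> L) =
    (\<integral>\<^sup>+ y. indicator (chart_img c) (slice_point B (chart_map c x) y) *
       \<psi> (chart_inv c (slice_point B (chart_map c x) y)) *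
       ennreal (leaf_vol c (slice_point B (chart_map c x) y)) \<partial>Pi\<^sub>M B (\<lambda>_. lborel))"
proof (rule nn_integral_chart[OF fol_charts_subset[OF c] sets_nu[OF L] slice_point_measurable
      plaque_sets[OF fol_charts_subset[OF c]] _ _ _ _ \<psi>])
  show "plaque B c x \<subseteq> chart_dom c" by (auto simp: plaque_def)
  show "(\<lambda>y. indicator (chart_img c) (slice_point B (chart_map c x) y) *
      ennreal (leaf_vol c (slice_point B (chart_map c x) y))) \<in> borel_measurable (Pi\<^sub>M B (\<lambda>_. lborel))"
    using measurable_compose[OF slice_point_measurable
        borel_chart_img_indicator[OF _ continuous_leaf_vol[OF fol_charts_subset[OF c]]]]
      fol_charts_subset[OF c] by simp
  show "chart_inv c (slice_point B (chart_map c x) y) \<in> plaque B c x"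
    if "slice_point B (chart_map c x) y \<in> chart_img c" for y
    using fol_chart_facts[OF c] that by (auto simp: plaque_def slice_point_def)
  fix E :: "'m set" assume E: "E \<in> sets borel" "E \<subseteq> plaque B c x"
  then have "E \<subseteq> plaque B c x \<inter> L" using plaque_subset_leaf[OF c L x] by auto
  then show "emeasure (\<nu> L) E = (\<integral>\<^sup>+ y. indicator (chart_map c ` E) (slice_point B (chart_map c x) y) *
      ennreal (leaf_vol c (slice_point B (chart_map c x) y)) \<partial>Pi\<^sub>M B (\<lambda>_. lborel))"
    using leaf_volumes L c x E(1) unfolding leaf_volume_def leaf_vol_def by blast
qed

lemma plaque_family:
  "disjoint_family_on (\<lambda>P. P) (plaque B c ` S)" "\<Union>(plaque B c ` (chart_dom c \<inter> S)) \<supseteq> chart_dom c \<inter> S"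
  using plaque_eq plaque_self by (fastforce simp: disjoint_family_on_def plaque_def)+

text \<open>The plaques of \<open>L\<close> in the chart are disjoint, Borel and countably many, so
  the measure with density \<psi> is additive over them.\<close>

lemma nn_integral_leaf_plaques:
  fixes \<psi> :: "'m \<Rightarrow> ennreal"
  assumes c: "c \<in> fol_charts" and L: "L \<in> \<F>" and \<psi>: "\<psi> \<in> borel_measurable borel"
    and supp: "\<And>x. x \<notin> chart_dom c \<Longrightarrow> \<psi> x = 0"
  shows "(\<integral>\<^sup>+ x. \<psi> x \<partial>\<nu> L) =
    (\<integral>\<^sup>+ P. (\<integral>\<^sup>+ x. \<psi> x * indicator P x \<partial>\<nu> L) \<partial>count_space (plaque B c ` (chart_dom c \<inter> L)))"
proof -
  let ?\<P> = "plaque B c ` (chart_dom c \<inter> L)"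
  have \<psi>': "\<psi> \<in> borel_measurable (\<nu> L)" using \<psi> sets_nu[OF L] by (simp cong: measurable_cong_sets)
  have U: "\<Union>?\<P> = chart_dom c \<inter> L"
    using plaque_family(2)[of c L] plaque_subset_leaf[OF c L] by (auto simp: plaque_def)
  have ps: "P \<in> sets borel" if "P \<in> ?\<P>" for P
    using that plaque_sets[OF fol_charts_subset[OF c]] by auto
  then have Us: "\<Union>?\<P> \<in> sets borel" by (intro sets.countable_Union countable_plaques L c) auto
  have "AE x in \<nu> L. \<psi> x = \<psi> x * indicator (\<Union>?\<P>) x"
    using AE_in_leaf[OF L] by eventually_elim (use supp in \<open>auto simp: U indicator_def\<close>)
  then have "(\<integral>\<^sup>+ x. \<psi> x \<partial>\<nu> L) = (\<integral>\<^sup>+ x. \<psi> x * indicator (\<Union>?\<P>) x \<partial>\<nu> L)"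
    by (rule nn_integral_cong_AE)
  also have "\<dots> = emeasure (density (\<nu> L) \<psi>) (\<Union>?\<P>)"
    using Us sets_nu[OF L] by (simp add: emeasure_density[OF \<psi>'])
  also have "\<dots> = (\<integral>\<^sup>+ P. emeasure (density (\<nu> L) \<psi>) P \<partial>count_space ?\<P>)"
    using emeasure_UN_countable[of ?\<P> "\<lambda>P. P" "density (\<nu> L) \<psi>"] ps sets_nu[OF L]
      countable_plaques[OF L c] plaque_family(1)[of c] by simp
  also have "\<dots> = (\<integral>\<^sup>+ P. (\<integral>\<^sup>+ x. \<psi> x * indicator P x \<partial>\<nu> L) \<partial>count_space ?\<P>)"
    using ps sets_nu[OF L] by (intro nn_integral_cong) (simp add: emeasure_density[OF \<psi>'])
  finally show ?thesis .
qed

section \<open>Small cubes in charts as test masses\<close>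

definition chart_cube :: "('m, 'n) chart \<Rightarrow> real ^ 'n \<Rightarrow> real \<Rightarrow> 'm set" where
  "chart_cube c z \<epsilon> = {x \<in> chart_dom c. chart_map c x \<in> cube z \<epsilon>}"

lemma chart_cube_sets: "c \<in> A \<Longrightarrow> chart_cube c z \<epsilon> \<in> sets borel"
proof -
  assume c: "c \<in> A"
  have "chart_cube c z \<epsilon> = chart_dom c - {x \<in> chart_dom c. chart_map c x \<in> - cube z \<epsilon>}"
    by (auto simp: chart_cube_def)
  also have "\<dots> \<in> sets borel"
    by (intro sets.Diff borel_open open_chart_preimage open_chart_dom c open_Compl closed_cube)
  finally show ?thesis .
qed

text \<open>The indicator of a chart cube divided by a density, so that integrals over the manifold or over
  a plaque become Euclidean volumes.\<close>

definition cube_weight ::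
  "(('m, 'n) chart \<Rightarrow> real ^ 'n \<Rightarrow> real) \<Rightarrow> ('m, 'n) chart \<Rightarrow> real ^ 'n \<Rightarrow> real \<Rightarrow> 'm \<Rightarrow> real" where
  "cube_weight \<rho> c z \<epsilon> x = (if x \<in> chart_cube c z \<epsilon> then 1 / \<rho> c (chart_map c x) else 0)"

lemma cube_weight_nonneg:
  assumes "\<And>w. w \<in> chart_img c \<Longrightarrow> \<rho> c w > 0" "c \<in> A"
  shows "0 \<le> cube_weight \<rho> c z \<epsilon> x"
  using assms(1)[OF chart_map_img[OF assms(2)], of x]
  by (auto simp: cube_weight_def chart_cube_def)

lemma cube_weight_measurable:
  assumes c: "c \<in> A" and cont: "continuous_on (chart_img c) (\<rho> c)"
    and pos: "\<And>w. w \<in> chart_img c \<Longrightarrow> \<rho> c w > 0"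
  shows "cube_weight \<rho> c z \<epsilon> \<in> borel_measurable borel"
proof -
  note cf = chart_facts[OF c]
  have "continuous_on (chart_dom c) (\<lambda>x. 1 / \<rho> c (chart_map c x))"
    using pos cf(8)
    by (intro continuous_on_divide continuous_on_const continuous_on_compose2[OF cont cf(3)]) force+
  then have "(\<lambda>x. indicator (chart_dom c) x *\<^sub>R (1 / \<rho> c (chart_map c x))) \<in> borel_measurable borel"
    by (intro borel_measurable_continuous_on_indicator borel_open cf(1))
  note borel_measurable_scaleR[OF borel_measurable_indicator[OF chart_cube_sets[OF c, of z \<epsilon>]] this]
  then have "(\<lambda>x. indicator (chart_cube c z \<epsilon>) x *\<^sub>R (indicator (chart_dom c) x *\<^sub>R (1 / \<rho> c (chart_map c x))))
      \<in> borel_measurable borel"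
    by simp
  moreover have "cube_weight \<rho> c z \<epsilon> =
      (\<lambda>x. indicator (chart_cube c z \<epsilon>) x *\<^sub>R (indicator (chart_dom c) x *\<^sub>R (1 / \<rho> c (chart_map c x))))"
    by (auto simp: fun_eq_iff cube_weight_def chart_cube_def)
  ultimately show ?thesis by simp
qed

lemma cube_weight_cancel:
  assumes c: "c \<in> A" and pos: "\<And>w. w \<in> chart_img c \<Longrightarrow> \<rho> c w > 0"
    and sub: "cube z \<epsilon> \<subseteq> chart_img c"
  shows "indicator (chart_img c) w * ennreal (cube_weight \<rho> c z \<epsilon> (chart_inv c w)) * ennreal (\<rho> c w) =
    indicator (cube z \<epsilon>) w"
proof (cases "w \<in> cube z \<epsilon>")
  case True
  then have w: "w \<in> chart_img c" using sub by auto
  then have "ennreal (cube_weight \<rho> c z \<epsilon> (chart_inv c w)) * ennreal (\<rho> c w) = ennreal 1"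
    using True pos[OF w] chart_facts[OF c]
    by (subst ennreal_mult[symmetric]) (auto simp: cube_weight_def chart_cube_def)
  then show ?thesis using True w by simp
next
  case False
  then show ?thesis using chart_facts[OF c]
    by (auto simp: cube_weight_def chart_cube_def indicator_def)
qed

lemma nn_integral_volume_cube:
  assumes c: "c \<in> A" and sub: "cube z \<epsilon> \<subseteq> chart_img c" and e: "\<epsilon> \<ge> 0"
  shows "(\<integral>\<^sup>+ x. ennreal (cube_weight vol c z \<epsilon> x) \<partial>\<mu>) = ennreal ((2 * \<epsilon>) ^ CARD('n))"
proof -
  have "(\<integral>\<^sup>+ x. ennreal (cube_weight vol c z \<epsilon> x) \<partial>\<mu>) =
      (\<integral>\<^sup>+ x. ennreal (cube_weight vol c z \<epsilon> x) * indicator (chart_dom c) x \<partial>\<mu>)"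
    by (intro nn_integral_cong) (auto simp: cube_weight_def chart_cube_def indicator_def)
  also have "\<dots> = (\<integral>\<^sup>+ w. indicator (chart_img c) w * ennreal (cube_weight vol c z \<epsilon> (chart_inv c w)) *
      ennreal (vol c w) \<partial>lborel)"
    by (intro nn_integral_volume c measurable_compose[OF _ measurable_ennreal]
        cube_weight_measurable continuous_vol vol_pos)
  also have "\<dots> = (\<integral>\<^sup>+ w. indicator (cube z \<epsilon>) w \<partial>lborel)"
    by (intro nn_integral_cong cube_weight_cancel c vol_pos sub)
  also have "\<dots> = ennreal ((2 * \<epsilon>) ^ CARD('n))"
    using closed_cube by (subst nn_integral_indicator) (auto simp: emeasure_cube e intro: borel_closed)
  finally show ?thesis .
qed

text \<open>Equality holds plaque by plaque: each plaque contributes either nothing or a fixed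
  Euclidean volume, and which of the two occurs depends on transverse coordinates only. The sum over
  plaques may be infinite.\<close>

lemma nn_integral_leaf_cube:
  assumes c: "c \<in> fol_charts" and L: "L \<in> \<F>" and e: "\<epsilon> \<ge> 0"
    and z: "cube z \<epsilon> \<subseteq> chart_img c" and z': "cube z' \<epsilon> \<subseteq> chart_img c"
    and zz: "\<forall>i\<in>-B. z $ i = z' $ i"
  shows "(\<integral>\<^sup>+ x. ennreal (cube_weight leaf_vol c z \<epsilon> x) \<partial>\<nu> L) =
    (\<integral>\<^sup>+ x. ennreal (cube_weight leaf_vol c z' \<epsilon> x) \<partial>\<nu> L)"
proof -
  note cA = fol_charts_subset[OF c]
  have m: "(\<lambda>x. ennreal (cube_weight leaf_vol c z \<epsilon> x)) \<in> borel_measurable borel" for z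
    by (intro cA measurable_compose[OF _ measurable_ennreal]
        cube_weight_measurable continuous_leaf_vol leaf_vol_pos)
  have s: "ennreal (cube_weight leaf_vol c z \<epsilon> x) = 0" if "x \<notin> chart_dom c" for x z
    using that by (simp add: cube_weight_def chart_cube_def)
  have p: "(\<integral>\<^sup>+ y. ennreal (cube_weight leaf_vol c z \<epsilon> y) * indicator (plaque B c x) y \<partial>\<nu> L) =
      (if \<forall>i\<in>-B. \<bar>chart_map c x $ i - z $ i\<bar> \<le> \<epsilon> then ennreal (2 * \<epsilon>) ^ card B else 0)"
    if "x \<in> chart_dom c" "x \<in> L" "cube z \<epsilon> \<subseteq> chart_img c" for x z
    using that
    by (simp add: nn_integral_plaque[OF c L that(1,2) m] cube_weight_cancel[where \<rho> = leaf_vol, OF cA leaf_vol_pos[OF cA]]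
        nn_integral_slice_cube e)
  have "(\<integral>\<^sup>+ x. ennreal (cube_weight leaf_vol c z \<epsilon> x) * indicator P x \<partial>\<nu> L) =
      (\<integral>\<^sup>+ x. ennreal (cube_weight leaf_vol c z' \<epsilon> x) * indicator P x \<partial>\<nu> L)"
    if "P \<in> plaque B c ` (chart_dom c \<inter> L)" for P
    using that zz by (auto simp: p z z')
  then have "(\<integral>\<^sup>+ P. (\<integral>\<^sup>+ x. ennreal (cube_weight leaf_vol c z \<epsilon> x) * indicator P x \<partial>\<nu> L)
        \<partial>count_space (plaque B c ` (chart_dom c \<inter> L))) =
      (\<integral>\<^sup>+ P. (\<integral>\<^sup>+ x. ennreal (cube_weight leaf_vol c z' \<epsilon> x) * indicator P x \<partial>\<nu> L)
        \<partial>count_space (plaque B c ` (chart_dom c \<inter> L)))"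
    by (rule nn_integral_cong) simp
  moreover have "(\<integral>\<^sup>+ x. ennreal (cube_weight leaf_vol c z \<epsilon> x) \<partial>\<nu> L) =
      (\<integral>\<^sup>+ P. (\<integral>\<^sup>+ x. ennreal (cube_weight leaf_vol c z \<epsilon> x) * indicator P x \<partial>\<nu> L)
        \<partial>count_space (plaque B c ` (chart_dom c \<inter> L)))" for z
    by (rule nn_integral_leaf_plaques[OF c L m s])
  ultimately show ?thesis by simp
qed

text \<open>An open set contains a chart cube; if it were null, the weight of that cube would
  integrate to 0 instead of the Euclidean volume.\<close>

lemma emeasure_mu_open_pos:
  assumes "open U" "U \<noteq> {}"
  shows "emeasure \<mu> U > 0"
proof -
  obtain x c where x: "x \<in> U" "c \<in> fol_charts" "x \<in> chart_dom c"
    using assms(2) fol_chart_at by (metis ex_in_conv)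
  note cA = fol_charts_subset[OF x(2)] and cf = fol_chart_facts[OF x(2)]
  let ?V = "{z \<in> chart_img c. chart_inv c z \<in> U}"
  have "open ?V" by (rule open_chart_inv_preimage[OF cA assms(1)])
  moreover have "chart_map c x \<in> ?V" using cf x by auto
  ultimately obtain \<delta> where d: "\<delta> > 0" "\<And>\<epsilon>. \<epsilon> \<le> \<delta> \<Longrightarrow> cube (chart_map c x) \<epsilon> \<subseteq> ?V"
    by (rule cube_small) blast
  let ?z = "chart_map c x"
  have sub: "chart_cube c ?z \<delta> \<subseteq> U" using d(2)[of \<delta>] cf by (force simp: chart_cube_def)
  have U: "U \<in> sets \<mu>" using assms(1) by (simp add: sets_mu)
  show ?thesis
  proof (rule ccontr)
    assume "\<not> emeasure \<mu> U > 0"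
    then have "U \<in> null_sets \<mu>" using U by auto
    then have "AE y in \<mu>. y \<notin> U" by (rule AE_not_in)
    then have "(\<integral>\<^sup>+ y. ennreal (cube_weight vol c ?z \<delta> y) \<partial>\<mu>) = (\<integral>\<^sup>+ y. 0 \<partial>\<mu>)"
      by (intro nn_integral_cong_AE) (use sub in \<open>auto simp: cube_weight_def elim!: eventually_mono\<close>)
    moreover have "cube ?z \<delta> \<subseteq> chart_img c" using d(2)[of \<delta>] by auto
    ultimately have "(2 * \<delta>) ^ CARD('n) \<le> 0"
      using nn_integral_volume_cube[OF cA, of ?z \<delta>] d(1) by simp
    moreover have "0 < (2 * \<delta>) ^ CARD('n)" using d(1) by (intro zero_less_power) simp
    ultimately show False by linarith
  qed
qed

end

section \<open>First variation of the modulus\<close>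

text \<open>The smaller union of leaves need not be Borel; it is null because the completed measure
  is used.\<close>

lemma almost_every_leaf_mono:
  assumes "almost_every_leaf \<mu> \<F> P" "\<And>L. L \<in> \<F> \<Longrightarrow> P L \<Longrightarrow> Q L"
  shows "almost_every_leaf \<mu> \<F> Q"
proof -
  have "\<Union>{L \<in> \<F>. \<not> Q L} \<subseteq> \<Union>{L \<in> \<F>. \<not> P L}" using assms(2) by blast
  then show ?thesis
    using assms(1) unfolding almost_every_leaf_def by (rule null_sets_completion_subset)
qed

text \<open>Convexity, with the tangent taken at \<open>a\<close>. In the application
  \<open>a\<close> is the perturbed value and \<open>b\<close> the value of \<open>f0\<close>, which
  bounds the new power from above for a step of finite size.\<close>

lemma powr_le_tangent:
  fixes a b p :: real
  assumes "a > 0" "b > 0" "p \<ge> 1"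
  shows "a powr p \<le> b powr p + p * a powr (p - 1) * (a - b)"
proof -
  have "b powr p - a powr p \<ge> p * a powr (p - 1) * (b - a)"
    by (rule convex_on_imp_above_tangent[OF powr_convex[OF assms(3)]])
       (use assms in \<open>auto intro!: derivative_eq_intros simp: interior_open\<close>)
  then show ?thesis by (simp add: algebra_simps)
qed

text \<open>Turns limits in step and position jointly into one step bound and one cube size that
  work uniformly.\<close>

lemma nbhd_box:
  fixes z :: "real ^ 'n"
  assumes "\<forall>\<^sub>F x in nhds (0::real, z). Q (fst x) (snd x)"
  obtains t0 \<delta> where "t0 > 0" "\<delta> > 0"
    "\<And>t \<epsilon> w. \<bar>t\<bar> \<le> t0 \<Longrightarrow> \<epsilon> \<le> \<delta> \<Longrightarrow> w \<in> cube z \<epsilon> \<Longrightarrow> Q t w"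
proof -
  obtain S where S: "open S" "(0, z) \<in> S" "\<forall>x\<in>S. Q (fst x) (snd x)"
    using assms by (auto simp: eventually_nhds)
  obtain T U where TU: "open T" "open U" "(0, z) \<in> T \<times> U" "T \<times> U \<subseteq> S"
    using open_prod_elim[OF S(1,2)] by blast
  obtain r where r: "r > 0" "ball 0 r \<subseteq> T" using TU openE[of T 0] by blast
  obtain \<delta> where d: "\<delta> > 0" "\<And>\<epsilon>. \<epsilon> \<le> \<delta> \<Longrightarrow> cube z \<epsilon> \<subseteq> U" using cube_small[of U z] TU by blast
  have "Q t w" if "\<bar>t\<bar> \<le> r / 2" "\<epsilon> \<le> \<delta>" "w \<in> cube z \<epsilon>" for t \<epsilon> w
  proof -
    have "t \<in> T" using that(1) r by (auto simp: dist_norm)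
    moreover have "w \<in> U" using d(2)[OF that(2)] that(3) by auto
    ultimately have "(t, w) \<in> S" using TU(4) by blast
    then show ?thesis using S(3) by force
  qed
  then show ?thesis using that[of "r / 2" \<delta>] r(1) d(1) by simp
qed

locale extremal_foliation = riemannian_foliation A B \<F> g \<mu> \<nu>
  for A :: "('m::{t2_space, second_countable_topology}, 'n::finite) chart set"
    and B :: "'n set" and \<F> :: "'m set set"
    and g :: "('m, 'n) metric" and \<mu> :: "'m measure" and \<nu> :: "'m set \<Rightarrow> 'm measure" +
  fixes p :: real and f0 :: "'m \<Rightarrow> real"
  assumes p: "p > 1" and extremal: "extremal \<mu> \<nu> \<F> p f0"
    and f0_C2: "Ck_fun A 2 f0" and f0_essinf: "essinf \<mu> f0 > 0"
begin

lemma f0_differentiable: "c \<in> A \<Longrightarrow> z \<in> chart_img c \<Longrightarrow> (f0 \<circ> chart_inv c) differentiable (at z)"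
  using f0_C2 by (simp add: Ck_fun_def numeral_2_eq_2)

lemma f0_chart_continuous: "c \<in> A \<Longrightarrow> continuous_on (chart_img c) (f0 \<circ> chart_inv c)"
  by (intro differentiable_imp_continuous_on differentiable_at_imp_differentiable_on f0_differentiable)

lemma f0_continuous: "continuous_on UNIV f0"
proof (rule continuous_at_imp_continuous_on, rule ballI)
  fix x
  obtain c where c: "c \<in> fol_charts" "x \<in> chart_dom c" by (rule fol_chart_at)
  note cf = fol_chart_facts[OF c(1)]
  have "continuous_on (chart_dom c) (\<lambda>y. (f0 \<circ> chart_inv c) (chart_map c y))"
    by (rule continuous_on_compose2[OF f0_chart_continuous[OF fol_charts_subset[OF c(1)]] cf(3)])
       (use cf(8) in auto)
  then have "continuous_on (chart_dom c) f0"
    by (rule continuous_on_eq) (simp add: cf(5))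
  then show "isCont f0 x" using cf(1) c(2) by (simp add: continuous_on_eq_continuous_at)
qed

lemma f0_borel: "f0 \<in> borel_measurable borel"
  by (rule borel_measurable_continuous_onI[OF f0_continuous])

lemma f0_adm: "f0 \<in> adm \<mu> \<nu> \<F> p"
  using extremal by (simp add: extremal_def)

text \<open>The essential bound holds almost everywhere only. By continuity a violation would occur
  on a nonempty open set, and such a set is not null.\<close>

lemma f0_pos: "f0 x > 0"
proof (rule ccontr)
  assume "\<not> f0 x > 0"
  let ?e = "esssup \<mu> (\<lambda>x. - ereal (f0 x))"
  have "?e < 0" using f0_essinf by (simp add: essinf_def ereal_uminus_less_reorder)
  \<comment> \<open>The number \<open>r\<close> is negative, and \<open>- r\<close> lies strictly
    between 0 and the essential infimum.\<close>
  then obtain r where r: "?e < ereal r" "ereal r < 0" using ereal_dense2 by blast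
  have U: "open {y. f0 y < - r}" by (intro open_Collect_less f0_continuous continuous_intros)
  moreover have "x \<in> {y. f0 y < - r}" using \<open>\<not> f0 x > 0\<close> r(2) by simp
  ultimately have "emeasure \<mu> {y. f0 y < - r} > 0" by (intro emeasure_mu_open_pos) auto
  moreover have "AE y in \<mu>. y \<notin> {y. f0 y < - r}"
    using esssup_AE[of "\<lambda>x. - ereal (f0 x)" \<mu>]
  proof eventually_elim
    case (elim y)
    from le_less_trans[OF this r(1)] show ?case by simp
  qed
  then have "{y. f0 y < - r} \<in> null_sets \<mu>"
    using U by (subst AE_iff_null_sets) (auto simp: sets_mu)
  ultimately show False by auto
qed

lemma completion_borel: "f \<in> borel_measurable borel \<Longrightarrow> f \<in> borel_measurable (completion \<mu>)"
  by (rule measurable_completion) (simp add: sets_mu cong: measurable_cong_sets)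

lemma f0_powr_integrable: "integrable (completion \<mu>) (\<lambda>x. f0 x powr p)"
proof -
  have "integrable (completion \<mu>) (\<lambda>x. \<bar>f0 x\<bar> powr p)"
    using f0_adm unfolding adm_def in_Lp_def by blast
  then show ?thesis using f0_pos by (simp add: abs_of_pos)
qed

lemma extremal_integral_le:
  assumes adm: "f \<in> adm \<mu> \<nu> \<F> p"
  shows "(\<integral>x. f0 x powr p \<partial>completion \<mu>) \<le> (\<integral>x. f x powr p \<partial>completion \<mu>)"
proof -
  have "modulus \<mu> \<nu> \<F> p \<le> ennreal (Lp_norm \<mu> p f)"
    unfolding modulus_def by (rule INF_lower[OF adm])
  then have "Lp_norm \<mu> p f0 \<le> Lp_norm \<mu> p f"
    using extremal by (simp add: extremal_def Lp_norm_def)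
  moreover have "Lp_norm \<mu> p f = (\<integral>x. f x powr p \<partial>completion \<mu>) powr (1 / p)"
    using adm by (simp add: Lp_norm_def adm_def)
  moreover have "Lp_norm \<mu> p f0 = (\<integral>x. f0 x powr p \<partial>completion \<mu>) powr (1 / p)"
    using f0_adm by (simp add: Lp_norm_def adm_def)
  ultimately have le: "(\<integral>x. f0 x powr p \<partial>completion \<mu>) powr (1 / p) \<le> (\<integral>x. f x powr p \<partial>completion \<mu>) powr (1 / p)"
    by simp
  show ?thesis
  proof (rule ccontr)
    assume "\<not> ?thesis"
    then have "(\<integral>x. f x powr p \<partial>completion \<mu>) powr (1 / p) < (\<integral>x. f0 x powr p \<partial>completion \<mu>) powr (1 / p)"
      using p by (intro powr_less_mono2 integral_nonneg_AE) auto
    then show False using le by simp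
  qed
qed

text \<open>Up to the factor \<open>p\<close>, the first-order change of the integral of
  \<open>f0 powr p\<close> when mass weighted by \<open>1 / leaf_vol\<close> is added near the point
  with coordinates \<open>z\<close>, per unit of Euclidean volume.\<close>

definition density_ratio :: "('m, 'n) chart \<Rightarrow> real ^ 'n \<Rightarrow> real" where
  "density_ratio c z = f0 (chart_inv c z) powr (p - 1) * (vol c z / leaf_vol c z)"

text \<open>If the ratio at \<open>z'\<close> exceeded the one at \<open>z\<close>, moving leafwise mass from a small cube around
  \<open>z'\<close> to one around \<open>z\<close> would keep the leaf integrals and decrease the norm.\<close>

lemma density_ratio_not_less:
  assumes c: "c \<in> fol_charts" and z: "z \<in> chart_img c" and z': "z' \<in> chart_img c"
    and zz: "\<forall>i\<in>-B. z $ i = z' $ i"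
  shows "\<not> density_ratio c z < density_ratio c z'"
proof
  assume less: "density_ratio c z < density_ratio c z'"
  note cA = fol_charts_subset[OF c] and cf = fol_chart_facts[OF c]
  let ?F = "\<lambda>x. f0 (chart_inv c x)"
  \<comment> \<open>The density ratio after a shift by \<open>t / leaf_vol\<close>. The tangent is
    taken at the shifted function, so the ratio has to be controlled there and not only at
    \<open>t = 0\<close>.\<close>
  define \<Phi> where "\<Phi> t w = (?F w + t / leaf_vol c w) powr (p - 1) * (vol c w / leaf_vol c w)" for t w
  \<comment> \<open>Two intermediate values keep the ratios on the two cubes apart by a fixed gap
    \<open>m2 - m1\<close>.\<close>
  obtain m1 where m1: "density_ratio c z < m1" "m1 < density_ratio c z'" using dense[OF less] by blast
  obtain m2 where m2: "m1 < m2" "m2 < density_ratio c z'" using dense[OF m1(2)] by blast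
  have "z \<noteq> z'" using less by auto
  then obtain U U' where U: "open U" "open U'" "z \<in> U" "z' \<in> U'" "U \<inter> U' = {}"
    by (metis hausdorff)
  have tend: "((\<lambda>x. ?F (snd x)) \<longlongrightarrow> ?F w) (nhds (0::real, w))"
    "((\<lambda>x. leaf_vol c (snd x)) \<longlongrightarrow> leaf_vol c w) (nhds (0::real, w))"
    "((\<lambda>x. vol c (snd x)) \<longlongrightarrow> vol c w) (nhds (0::real, w))" if w: "w \<in> chart_img c" for w
  proof -
    have snd: "((\<lambda>x. snd x) \<longlongrightarrow> w) (nhds (0::real, w))"
      using tendsto_at_iff_tendsto_nhds[of snd "(0::real, w)"] isCont_snd[of "(0::real, w)" "\<lambda>x. x"]
      by (simp add: isCont_def)
    have *: "((\<lambda>x. h (snd x)) \<longlongrightarrow> h w) (nhds (0::real, w))" if "continuous_on (chart_img c) h" for h :: "real ^ 'n \<Rightarrow> real"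
    proof -
      have "isCont h w" using that w cf(2) by (simp add: continuous_on_eq_continuous_at)
      then have "(h \<longlongrightarrow> h w) (nhds w)" by (simp add: isCont_def tendsto_at_iff_tendsto_nhds)
      from filterlim_compose[OF this snd] show ?thesis .
    qed
    show "((\<lambda>x. ?F (snd x)) \<longlongrightarrow> ?F w) (nhds (0::real, w))"
      using *[OF f0_chart_continuous[OF cA]] by simp
    show "((\<lambda>x. leaf_vol c (snd x)) \<longlongrightarrow> leaf_vol c w) (nhds (0::real, w))"
      "((\<lambda>x. vol c (snd x)) \<longlongrightarrow> vol c w) (nhds (0::real, w))"
      by (intro * continuous_vol continuous_leaf_vol cA)+
  qed
  have fst: "((\<lambda>x. fst x) \<longlongrightarrow> 0) (nhds (0::real, w))" for w :: "real ^ 'n"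
    using tendsto_at_iff_tendsto_nhds[of fst "(0::real, w)"] isCont_fst[of "(0::real, w)" "\<lambda>x. x"]
    by (simp add: isCont_def)
  have lv: "leaf_vol c w \<noteq> 0" if "w \<in> chart_img c" for w
    using leaf_vol_pos[OF cA that] by simp
  \<comment> \<open>The sign \<open>s\<close> is 1 near \<open>z\<close>, where mass is added, and
    -1 near \<open>z'\<close>, where it is removed.\<close>
  have base: "((\<lambda>x. ?F (snd x) + s * fst x / leaf_vol c (snd x)) \<longlongrightarrow> ?F w) (nhds (0, w))"
    if "w \<in> chart_img c" for w s
    using tendsto_add[OF tend(1)[OF that] tendsto_divide[OF tendsto_mult[OF tendsto_const fst] tend(2)[OF that] lv[OF that]]]
    by simp
  have \<Phi>lim: "((\<lambda>x. \<Phi> (s * fst x) (snd x)) \<longlongrightarrow> density_ratio c w) (nhds (0, w))"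
    if "w \<in> chart_img c" for w s
  proof -
    have "?F w \<noteq> 0" using f0_pos[of "chart_inv c w"] by simp
    then show ?thesis unfolding \<Phi>_def density_ratio_def
      by (intro tendsto_mult tendsto_powr base tendsto_const tendsto_divide tend lv that)
  qed
  have img: "\<forall>\<^sub>F x in nhds (0::real, w). snd x \<in> V" if "w \<in> V" "open V" for w :: "real ^ 'n" and V
    using that by (auto simp: eventually_nhds intro!: exI[of _ "UNIV \<times> V"] open_Times)
  have "\<forall>\<^sub>F x in nhds (0, z). snd x \<in> chart_img c \<and> snd x \<in> U \<and> \<Phi> (fst x) (snd x) < m1"
    using img[OF z cf(2)] img[OF U(3,1)] order_tendstoD(2)[OF \<Phi>lim[OF z, of 1] m1(1)]
    by (simp add: eventually_conj_iff)
  then obtain t1 d1 where t1: "t1 > 0" "d1 > 0"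
    "\<And>t \<epsilon> w. \<bar>t\<bar> \<le> t1 \<Longrightarrow> \<epsilon> \<le> d1 \<Longrightarrow> w \<in> cube z \<epsilon> \<Longrightarrow> w \<in> chart_img c \<and> w \<in> U \<and> \<Phi> t w < m1"
    by (rule nbhd_box) blast
  have "\<forall>\<^sub>F x in nhds (0, z'). snd x \<in> chart_img c \<and> snd x \<in> U' \<and> m2 < \<Phi> (- fst x) (snd x) \<and>
      0 < ?F (snd x) - fst x / leaf_vol c (snd x)"
    using img[OF z' cf(2)] img[OF U(4,2)] order_tendstoD(1)[OF \<Phi>lim[OF z', of "-1"] m2(2)]
      order_tendstoD(1)[OF base[OF z', of "-1"] f0_pos]
    by (simp add: eventually_conj_iff)
  then obtain t2 d2 where t2: "t2 > 0" "d2 > 0"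
    "\<And>t \<epsilon> w. \<bar>t\<bar> \<le> t2 \<Longrightarrow> \<epsilon> \<le> d2 \<Longrightarrow> w \<in> cube z' \<epsilon> \<Longrightarrow> w \<in> chart_img c \<and> w \<in> U' \<and>
       m2 < \<Phi> (- t) w \<and> 0 < ?F w - t / leaf_vol c w"
    by (rule nbhd_box) blast
  define t where "t = min t1 t2"
  \<comment> \<open>Both cubes have the same size, as required for the leaf integrals to balance and
    for the two Euclidean volumes to agree.\<close>
  define \<epsilon> where "\<epsilon> = min d1 d2"
  have pos: "t > 0" "\<epsilon> > 0" using t1 t2 by (auto simp: t_def \<epsilon>_def)
  have q1: "w \<in> chart_img c \<and> w \<in> U \<and> \<Phi> t w < m1" if "w \<in> cube z \<epsilon>" for w
    by (rule t1(3)[OF _ _ that]) (use pos in \<open>auto simp: t_def \<epsilon>_def\<close>)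
  have q2: "w \<in> chart_img c \<and> w \<in> U' \<and> m2 < \<Phi> (- t) w \<and> 0 < ?F w - t / leaf_vol c w" if "w \<in> cube z' \<epsilon>" for w
    by (rule t2(3)[OF _ _ that]) (use pos in \<open>auto simp: t_def \<epsilon>_def\<close>)
  have sub: "cube z \<epsilon> \<subseteq> chart_img c" "cube z' \<epsilon> \<subseteq> chart_img c" using q1 q2 by auto
  have disj: "x \<notin> chart_cube c z' \<epsilon>" if "x \<in> chart_cube c z \<epsilon>" for x
    using that q1 q2 U(5) by (auto simp: chart_cube_def)
  define r1 where "r1 = cube_weight leaf_vol c z \<epsilon>"
  define r2 where "r2 = cube_weight leaf_vol c z' \<epsilon>"
  \<comment> \<open>These cubes are weighted by \<open>1 / vol\<close>, so their integrals over the
    manifold are the Euclidean volume. They are what remains after bounding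
    \<open>vol / leaf_vol\<close> times the power of \<open>f\<close> by \<open>m1\<close> or
    \<open>m2\<close>.\<close>
  define k1 where "k1 = cube_weight vol c z \<epsilon>"
  define k2 where "k2 = cube_weight vol c z' \<epsilon>"
  define f where "f x = f0 x + t * r1 x - t * r2 x" for x
  have rm: "r1 \<in> borel_measurable borel" "r2 \<in> borel_measurable borel"
    and km: "k1 \<in> borel_measurable borel" "k2 \<in> borel_measurable borel"
    unfolding r1_def r2_def k1_def k2_def
    by (intro cube_weight_measurable cA continuous_vol continuous_leaf_vol vol_pos leaf_vol_pos; assumption)+
  have nn: "0 \<le> r1 x" "0 \<le> r2 x" "0 \<le> k1 x" "0 \<le> k2 x" for x
    unfolding r1_def r2_def k1_def k2_def
    by (intro cube_weight_nonneg vol_pos leaf_vol_pos cA; assumption)+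
  have fm: "f \<in> borel_measurable borel"
    unfolding f_def using rm f0_borel by (intro borel_measurable_diff borel_measurable_add borel_measurable_times) auto
  \<comment> \<open>On the first cube the tangent term is
    \<open>p * t * f x powr (p - 1) / leaf_vol\<close>, at most \<open>p * t * m1 / vol\<close>; on
    the second it has the opposite sign and the bound uses \<open>m2\<close>; elsewhere
    \<open>f\<close> equals \<open>f0\<close>.\<close>
  have pw: "f x > 0 \<and> f x powr p \<le> f0 x powr p + p * t * (m1 * k1 x - m2 * k2 x)" for x
  proof -
    consider "x \<in> chart_cube c z \<epsilon>" | "x \<in> chart_cube c z' \<epsilon>" "x \<notin> chart_cube c z \<epsilon>"
      | "x \<notin> chart_cube c z \<epsilon>" "x \<notin> chart_cube c z' \<epsilon>" by blast
    then show ?thesis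
    proof cases
      case 1
      let ?w = "chart_map c x"
      have w: "?w \<in> cube z \<epsilon>" "chart_inv c ?w = x" using 1 cf(5) by (auto simp: chart_cube_def)
      note v = vol_pos[OF cA, of ?w] leaf_vol_pos[OF cA, of ?w] q1[OF w(1)]
      have fx: "f x = f0 x + t / leaf_vol c ?w"
        using 1 disj[OF 1] by (simp add: f_def r1_def r2_def cube_weight_def)
      then have fp: "f x > 0" using f0_pos[of x] v pos by (simp add: add_pos_pos)
      have "f x powr (p - 1) * (vol c ?w / leaf_vol c ?w) \<le> m1" using v(3) by (simp add: \<Phi>_def w fx)
      then have "f x powr (p - 1) / leaf_vol c ?w \<le> m1 / vol c ?w" using v by (simp add: field_simps)
      then have "p * t * (f x powr (p - 1) / leaf_vol c ?w) \<le> p * t * (m1 / vol c ?w)"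
        using p pos by (intro mult_left_mono) auto
      moreover have "f x powr p \<le> f0 x powr p + p * f x powr (p - 1) * (f x - f0 x)"
        using powr_le_tangent[OF fp f0_pos] p by simp
      moreover have "p * f x powr (p - 1) * (f x - f0 x) = p * t * (f x powr (p - 1) / leaf_vol c ?w)"
        by (simp add: fx mult_ac)
      moreover have "m1 * k1 x - m2 * k2 x = m1 / vol c ?w"
        using 1 disj[OF 1] by (simp add: k1_def k2_def cube_weight_def)
      ultimately show ?thesis using fp by simp
    next
      case 2
      let ?w = "chart_map c x"
      have w: "?w \<in> cube z' \<epsilon>" "chart_inv c ?w = x" using 2 cf(5) by (auto simp: chart_cube_def)
      note v = vol_pos[OF cA, of ?w] leaf_vol_pos[OF cA, of ?w] q2[OF w(1)]
      have fx: "f x = f0 x - t / leaf_vol c ?w"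
        using 2 by (simp add: f_def r1_def r2_def cube_weight_def)
      then have fp: "f x > 0" using v w by simp
      have "m2 \<le> f x powr (p - 1) * (vol c ?w / leaf_vol c ?w)" using v(3) by (simp add: \<Phi>_def w fx)
      then have "m2 / vol c ?w \<le> f x powr (p - 1) / leaf_vol c ?w" using v by (simp add: field_simps)
      then have "p * t * (m2 / vol c ?w) \<le> p * t * (f x powr (p - 1) / leaf_vol c ?w)"
        using p pos by (intro mult_left_mono) auto
      moreover have "f x powr p \<le> f0 x powr p + p * f x powr (p - 1) * (f x - f0 x)"
        using powr_le_tangent[OF fp f0_pos] p by simp
      moreover have "p * f x powr (p - 1) * (f x - f0 x) = - (p * t * (f x powr (p - 1) / leaf_vol c ?w))"
        by (simp add: fx mult_ac)
      moreover have "p * t * (m1 * k1 x - m2 * k2 x) = - (p * t * (m2 / vol c ?w))"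
        using 2 by (simp add: k1_def k2_def cube_weight_def)
      ultimately show ?thesis using fp by simp
    next
      case 3
      then show ?thesis using f0_pos by (simp add: f_def r1_def r2_def k1_def k2_def cube_weight_def)
    qed
  qed
  let ?V = "(2 * \<epsilon>) ^ CARD('n)"
  have k: "integrable (completion \<mu>) k" "(\<integral>x. k x \<partial>completion \<mu>) = ?V"
    if "k \<in> borel_measurable borel" "\<And>x. 0 \<le> k x" "(\<integral>\<^sup>+ x. ennreal (k x) \<partial>\<mu>) = ennreal ?V" for k
  proof -
    have km: "k \<in> borel_measurable (completion \<mu>)" by (rule completion_borel[OF that(1)])
    have e: "(\<integral>\<^sup>+ x. ennreal (k x) \<partial>completion \<mu>) = ennreal ?V"
      using that(3) by (simp add: nn_integral_completion)
    show "integrable (completion \<mu>) k"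
      by (rule integrableI_nn_integral_finite[OF km _ e]) (use that(2) in auto)
    show "(\<integral>x. k x \<partial>completion \<mu>) = ?V"
      using that(2) pos by (subst integral_eq_nn_integral[OF km]) (auto simp: e)
  qed
  have k1: "integrable (completion \<mu>) k1" "(\<integral>x. k1 x \<partial>completion \<mu>) = ?V"
    by (intro k km nn, simp add: k1_def nn_integral_volume_cube[OF cA sub(1)] pos less_imp_le)+
  have k2: "integrable (completion \<mu>) k2" "(\<integral>x. k2 x \<partial>completion \<mu>) = ?V"
    by (intro k km nn, simp add: k2_def nn_integral_volume_cube[OF cA sub(2)] pos less_imp_le)+
  let ?b = "\<lambda>x. f0 x powr p + p * t * (m1 * k1 x - m2 * k2 x)"
  have bi: "integrable (completion \<mu>) ?b"
    by (intro Bochner_Integration.integrable_add integrable_mult_right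
        Bochner_Integration.integrable_diff f0_powr_integrable k1 k2)
  have bv: "(\<integral>x. ?b x \<partial>completion \<mu>) = (\<integral>x. f0 x powr p \<partial>completion \<mu>) + p * t * (m1 * ?V - m2 * ?V)"
    using k1 k2 f0_powr_integrable by simp
  have fi: "integrable (completion \<mu>) (\<lambda>x. f x powr p)"
  proof (rule Bochner_Integration.integrable_bound[OF bi])
    show "(\<lambda>x. f x powr p) \<in> borel_measurable (completion \<mu>)"
      using completion_borel[OF fm] by measurable
    have "norm (f x powr p) \<le> norm (?b x)" for x
      using pw[of x] by (simp add: order_trans[OF _ abs_ge_self])
    then show "AE x in completion \<mu>. norm (f x powr p) \<le> norm (?b x)" by simp
  qed
  have leaf: "1 \<le> (\<integral>\<^sup>+ x. ennreal (f x) \<partial>\<nu> L)" if L: "L \<in> \<F>" and 1: "1 \<le> (\<integral>\<^sup>+ x. ennreal (f0 x) \<partial>\<nu> L)" for L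
  proof -
    have meas: "(\<lambda>x. ennreal (h x)) \<in> borel_measurable (\<nu> L)" if "h \<in> borel_measurable borel" for h
      using that sets_nu[OF L] by (simp cong: measurable_cong_sets)
    have tr: "(\<lambda>x. t * r1 x) \<in> borel_measurable borel" "(\<lambda>x. t * r2 x) \<in> borel_measurable borel"
      using rm by simp_all
    have "(\<integral>\<^sup>+ x. ennreal (r1 x) \<partial>\<nu> L) = (\<integral>\<^sup>+ x. ennreal (r2 x) \<partial>\<nu> L)"
      unfolding r1_def r2_def using nn_integral_leaf_cube[OF c L _ sub zz] pos by simp
    then have I: "(\<integral>\<^sup>+ x. ennreal (t * r1 x) \<partial>\<nu> L) = (\<integral>\<^sup>+ x. ennreal (t * r2 x) \<partial>\<nu> L)"
      using pos nn meas[OF rm(1)] meas[OF rm(2)] by (simp add: ennreal_mult nn_integral_cmult)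
    have "(\<integral>\<^sup>+ x. ennreal (f x) \<partial>\<nu> L) + (\<integral>\<^sup>+ x. ennreal (t * r2 x) \<partial>\<nu> L) =
        (\<integral>\<^sup>+ x. ennreal (f x) + ennreal (t * r2 x) \<partial>\<nu> L)"
      by (rule nn_integral_add[symmetric]) (intro meas fm tr)+
    also have "\<dots> = (\<integral>\<^sup>+ x. ennreal (f0 x) + ennreal (t * r1 x) \<partial>\<nu> L)"
    proof (rule nn_integral_cong)
      fix x
      have "ennreal (f x) + ennreal (t * r2 x) = ennreal (f x + t * r2 x)"
        using pw[of x] nn pos by (intro ennreal_plus[symmetric]) (auto simp: less_imp_le)
      also have "f x + t * r2 x = f0 x + t * r1 x" by (simp add: f_def)
      also have "ennreal (f0 x + t * r1 x) = ennreal (f0 x) + ennreal (t * r1 x)"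
        using f0_pos[of x] nn pos by (intro ennreal_plus) (auto simp: less_imp_le)
      finally show "ennreal (f x) + ennreal (t * r2 x) = ennreal (f0 x) + ennreal (t * r1 x)" .
    qed
    also have "\<dots> = (\<integral>\<^sup>+ x. ennreal (f0 x) \<partial>\<nu> L) + (\<integral>\<^sup>+ x. ennreal (t * r1 x) \<partial>\<nu> L)"
      by (rule nn_integral_add) (intro meas f0_borel tr)+
    finally have eq: "(\<integral>\<^sup>+ x. ennreal (f x) \<partial>\<nu> L) + (\<integral>\<^sup>+ x. ennreal (t * r1 x) \<partial>\<nu> L) =
        (\<integral>\<^sup>+ x. ennreal (f0 x) \<partial>\<nu> L) + (\<integral>\<^sup>+ x. ennreal (t * r1 x) \<partial>\<nu> L)"
      unfolding I .
    show ?thesis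
    proof (cases "(\<integral>\<^sup>+ x. ennreal (t * r1 x) \<partial>\<nu> L) = \<infinity>")
      case True
      \<comment> \<open>An infinite moved mass cannot be cancelled from the balance
        \<open>eq\<close>. In this case the added mass alone, which lies below \<open>f\<close>,
        makes the leaf integral infinite.\<close>
      have "t * r1 x \<le> f x" for x
      proof (cases "x \<in> chart_cube c z \<epsilon>")
        case True
        then show ?thesis using disj[OF True] f0_pos[of x] by (simp add: f_def r2_def cube_weight_def)
      next
        case False
        then show ?thesis using pw[of x] by (simp add: r1_def cube_weight_def)
      qed
      then have "(\<integral>\<^sup>+ x. ennreal (t * r1 x) \<partial>\<nu> L) \<le> (\<integral>\<^sup>+ x. ennreal (f x) \<partial>\<nu> L)"
        by (intro nn_integral_mono ennreal_leI)
      then show ?thesis using True by (simp add: top_unique)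
    next
      case False
      then have "(\<integral>\<^sup>+ x. ennreal (f x) \<partial>\<nu> L) = (\<integral>\<^sup>+ x. ennreal (f0 x) \<partial>\<nu> L)"
        using eq by (simp add: ennreal_add_left_cancel add.commute[of _ "\<integral>\<^sup>+ x. ennreal (t * r1 x) \<partial>\<nu> L"])
      then show ?thesis using 1 by simp
    qed
  qed
  have "f \<in> adm \<mu> \<nu> \<F> p"
    unfolding adm_def in_Lp_def
  proof (intro CollectI conjI allI)
    show "f \<in> borel_measurable (completion \<mu>)" by (rule completion_borel[OF fm])
    show "integrable (completion \<mu>) (\<lambda>x. \<bar>f x\<bar> powr p)"
      using fi pw by (simp add: abs_of_pos)
    show "0 \<le> f x" for x using pw[of x] by simp
    show "almost_every_leaf \<mu> \<F> (\<lambda>L. 1 \<le> (\<integral>\<^sup>+ x. ennreal (f x) \<partial>\<nu> L))"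
      by (rule almost_every_leaf_mono[of \<mu> \<F> "\<lambda>L. 1 \<le> (\<integral>\<^sup>+ x. ennreal (f0 x) \<partial>\<nu> L)"])
         (use f0_adm leaf in \<open>auto simp: adm_def\<close>)
  qed
  then have "(\<integral>x. f0 x powr p \<partial>completion \<mu>) \<le> (\<integral>x. f x powr p \<partial>completion \<mu>)"
    by (rule extremal_integral_le)
  also have "\<dots> \<le> (\<integral>x. ?b x \<partial>completion \<mu>)"
    by (rule integral_mono[OF fi bi]) (use pw in auto)
  \<comment> \<open>The two Euclidean volumes agree, so the sign of the right-hand side is that of
    \<open>m1 - m2\<close>, which is negative.\<close>
  finally have "0 \<le> p * t * (m1 * ?V - m2 * ?V)" unfolding bv by simp
  moreover have "p * t * (m1 * ?V - m2 * ?V) < 0"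
    using p pos m2(1) by (intro mult_pos_neg) (auto intro!: mult_strict_right_mono)
  ultimately show False by simp
qed

lemma density_ratio_eq:
  assumes "c \<in> fol_charts" "z \<in> chart_img c" "z' \<in> chart_img c" "\<forall>i\<in>-B. z $ i = z' $ i"
  shows "density_ratio c z = density_ratio c z'"
  using density_ratio_not_less[OF assms] density_ratio_not_less[OF assms(1,3,2)] assms(4)
  by (simp add: not_less)

end

section \<open>The curvature formula, and minimality as constancy along leaves\<close>

context extremal_foliation
begin

abbreviation log_f0 :: "('m, 'n) chart \<Rightarrow> real ^ 'n \<Rightarrow> real" where
  "log_f0 c \<equiv> (\<lambda>x. ln (f0 x)) \<circ> chart_inv c"

lemma log_f0_differentiable:
  assumes "c \<in> A" "z \<in> chart_img c"
  shows "log_f0 c differentiable (at z)"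
proof -
  have "(f0 \<circ> chart_inv c) z > 0" using f0_pos by simp
  moreover obtain D where "((f0 \<circ> chart_inv c) has_derivative D) (at z)"
    using f0_differentiable[OF assms] by (auto simp: differentiable_def)
  ultimately have "((\<lambda>w. ln ((f0 \<circ> chart_inv c) w)) has_derivative
      (\<lambda>h. D h * inverse ((f0 \<circ> chart_inv c) z))) (at z)"
    by (intro has_derivative_ln)
  then show ?thesis by (auto simp: differentiable_def o_def)
qed

lemma eventually_line_in_img:
  assumes "c \<in> A" "z \<in> chart_img c"
  shows "\<forall>\<^sub>F t in nhds 0. z + t *\<^sub>R v \<in> chart_img c"
proof (rule topological_tendstoD)
  show "((\<lambda>t. z + t *\<^sub>R v) \<longlongrightarrow> z) (nhds 0)"
    using tendsto_at_iff_tendsto_nhds[of "\<lambda>t. z + t *\<^sub>R v" 0] by (auto intro!: tendsto_eq_intros)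
qed (use assms open_chart_img in auto)

text \<open>Along a leafwise coordinate line the transverse coordinates are fixed, so
  \<open>density_ratio_eq\<close> makes the logarithm of the ratio constant. This is the hypothesis
  of \<open>mean_curv_perp_eq\<close> with coefficient \<open>p - 1\<close> and \<phi> the logarithm
  of \<open>f0\<close>.\<close>

lemma mean_curv_perp_formula:
  assumes c: "c \<in> fol_charts" and z: "z \<in> chart_img c"
  shows "mean_curv_perp B g c z = (p - 1) *\<^sub>R tangential B g c z (gradient g c (\<lambda>x. ln (f0 x)) z)"
  unfolding gradient_def
proof (rule mean_curv_perp_eq[where U = "chart_img c"])
  note cA = fol_charts_subset[OF c]
  show "open (chart_img c)" "smooth_on (chart_img c) (g c)" "is_metric_on (chart_img c) (g c)"
    by (intro open_chart_img metric_smooth metric_is_metric cA)+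
  show "chart_img c = chart_img c" "z \<in> chart_img c" by (rule refl, rule z)
  show "log_f0 c differentiable (at z)" by (rule log_f0_differentiable[OF cA z])
  have ln_ratio: "ln (density_ratio c w) = (p - 1) * log_f0 c w +
      ln (det (g c w) / det (leaf_block B (g c w))) / 2" if "w \<in> chart_img c" for w
  proof -
    note dp = det_metric_pos[OF cA that] det_leaf_block_pos[OF cA that]
    have "vol c w / leaf_vol c w = sqrt (det (g c w) / det (leaf_block B (g c w)))"
      by (simp add: vol_def leaf_vol_def real_sqrt_divide)
    moreover have "ln (sqrt (det (g c w) / det (leaf_block B (g c w)))) =
        ln (det (g c w) / det (leaf_block B (g c w))) / 2"
      using dp by (simp add: ln_sqrt)
    moreover have "f0 (chart_inv c w) powr (p - 1) > 0" using f0_pos[of "chart_inv c w"] by simp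
    moreover have "vol c w / leaf_vol c w > 0" using vol_pos[OF cA that] leaf_vol_pos[OF cA that] by simp
    ultimately show ?thesis
      unfolding density_ratio_def using f0_pos[of "chart_inv c w"]
      by (subst ln_mult_pos) (auto simp: ln_powr)
  qed
  fix i assume i: "i \<in> B"
  show "\<forall>\<^sub>F t in nhds 0. (p - 1) * log_f0 c (z + t *\<^sub>R axis i 1) +
      ln (det (g c (z + t *\<^sub>R axis i 1)) / det (leaf_block B (g c (z + t *\<^sub>R axis i 1)))) / 2 =
      ln (density_ratio c z)"
    using eventually_line_in_img[OF cA z, of "axis i 1"]
  proof eventually_elim
    case (elim t)
    have "\<forall>j\<in>-B. (z + t *\<^sub>R axis i 1) $ j = z $ j" using i by (auto simp: axis_def)
    from density_ratio_eq[OF c elim z this] show ?case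
      using ln_ratio[OF elim] by simp
  qed
qed

lemma tangential_gradient_eq_0_iff:
  assumes c: "c \<in> A" and z: "z \<in> chart_img c"
  shows "tangential B g c z (gradient g c (\<lambda>x. ln (f0 x)) z) = 0 \<longleftrightarrow>
    (\<forall>i\<in>B. partial i (log_f0 c) z = 0)"
proof -
  let ?T = "tangential B g c z (gradient g c (\<lambda>x. ln (f0 x)) z)"
  have sym: "transpose (g c z) = g c z" and pos: "\<And>v. v \<noteq> 0 \<Longrightarrow> v \<bullet> (g c z *v v) > 0"
    using metric_is_metric[OF c] z by (auto simp: is_metric_on_def)
  have ip: "axis i 1 \<bullet> (g c z *v ?T) = partial i (log_f0 c) z" if "i \<in> B" for i
  proof -
    have "axis i 1 \<bullet> (g c z *v ?T) = axis i 1 \<bullet> (g c z *v gradient g c (\<lambda>x. ln (f0 x)) z)"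
      by (rule tangential_inner[where g = g and c = c, OF sym _ that]) (rule pos)
    then show ?thesis
      using matrix_inv_right[OF metric_invertible[OF sym pos]]
      by (simp add: gradient_def matrix_vector_mul_assoc inner_axis1)
  qed
  show ?thesis
  proof
    assume "?T = 0"
    then show "\<forall>i\<in>B. partial i (log_f0 c) z = 0" using ip by auto
  next
    assume a: "\<forall>i\<in>B. partial i (log_f0 c) z = 0"
    show "?T = 0"
      by (rule leaf_tangent_eqI[OF sym pos tangential_in[where g = g and c = c, OF sym pos]])
         (use ip a in \<open>auto simp: leaf_tangent_def span_zero\<close>)
  qed
qed

lemma perp_minimal_iff:
  "perp_minimal A g B \<F> \<longleftrightarrow>
    (\<forall>c\<in>fol_charts. \<forall>z\<in>chart_img c. \<forall>i\<in>B. partial i (log_f0 c) z = 0)"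
proof -
  have "mean_curv_perp B g c z = 0 \<longleftrightarrow> (\<forall>i\<in>B. partial i (log_f0 c) z = 0)"
    if "c \<in> fol_charts" "z \<in> chart_img c" for c z
    using mean_curv_perp_formula[OF that] tangential_gradient_eq_0_iff[OF fol_charts_subset[OF that(1)] that(2)] p
    by simp
  then show ?thesis by (simp add: perp_minimal_def)
qed

lemma partial_eq_0_if_constant_on_leaves:
  assumes const: "\<forall>L\<in>\<F>. f0 constant_on L"
    and c: "c \<in> fol_charts" and z: "z \<in> chart_img c" and i: "i \<in> B"
  shows "partial i (log_f0 c) z = 0"
proof -
  note cA = fol_charts_subset[OF c] and cf = fol_chart_facts[OF c]
  obtain L where L: "L \<in> \<F>" "chart_inv c z \<in> L" by (rule leaf_at)
  have "\<forall>\<^sub>F t in nhds 0. log_f0 c (z + t *\<^sub>R axis i 1) = log_f0 c z"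
    using eventually_line_in_img[OF cA z, of "axis i 1"]
  proof eventually_elim
    case (elim t)
    have "chart_inv c (z + t *\<^sub>R axis i 1) \<in> plaque B c (chart_inv c z)"
      using i cf elim z by (auto simp: plaque_def axis_def)
    then have "chart_inv c (z + t *\<^sub>R axis i 1) \<in> L"
      using plaque_subset_leaf[OF c L(1) cf(7)[OF z] L(2)] by auto
    then have "f0 (chart_inv c (z + t *\<^sub>R axis i 1)) = f0 (chart_inv c z)"
      using const L by (auto simp: constant_on_def)
    then show ?case by simp
  qed
  then have "((\<lambda>t. log_f0 c (z + t *\<^sub>R axis i 1)) has_real_derivative 0) (at 0)"
    by (subst DERIV_cong_ev[OF refl _ refl]) auto
  then show ?thesis
    using DERIV_unique DERIV_partial[OF log_f0_differentiable[OF cA z]] by blast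
qed

text \<open>Two points of a plaque are joined by a straight segment in coordinates, whose direction
  has leafwise components only. This gives constancy on plaques, and
  \<open>leaf_locally_constant\<close> extends it to the leaf.\<close>

lemma constant_on_leaves_if_partial_eq_0:
  assumes part: "\<And>c z i. c \<in> fol_charts \<Longrightarrow> z \<in> chart_img c \<Longrightarrow> i \<in> B \<Longrightarrow> partial i (log_f0 c) z = 0"
    and L: "L \<in> \<F>"
  shows "f0 constant_on L"
proof -
  have plq: "f0 y = f0 x" if c: "c \<in> fol_charts" and x: "x \<in> chart_dom c" and y: "y \<in> plaque B c x" for c x y
  proof -
    note cA = fol_charts_subset[OF c] and cf = fol_chart_facts[OF c]
    have yd: "y \<in> chart_dom c" using y by (simp add: plaque_def)
    let ?d = "chart_map c y - chart_map c x"
    define l where "l t = chart_map c x + t *\<^sub>R ?d" for t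
    \<comment> \<open>Images of foliated charts are boxes by definition, so the segment stays
      inside.\<close>
    have conv: "convex (chart_img c)" using c by (auto simp: foliated_charts_def convex_box)
    have img: "l t \<in> chart_img c" if "t \<in> {0..1}" for t
      using convexD_alt[OF conv cf(8)[OF x] cf(8)[OF yd], of t] that
      by (simp add: l_def algebra_simps)
    have D: "((\<lambda>t. log_f0 c (l t)) has_real_derivative 0) (at t)" if "t \<in> {0..1}" for t
    proof -
      let ?D = "frechet_derivative (log_f0 c) (at (l t))"
      have f: "(log_f0 c has_derivative ?D) (at (l t))"
        using log_f0_differentiable[OF cA img[OF that]] by (simp add: frechet_derivative_works)
      note lin = has_derivative_linear[OF f]
      have "?D ?d = (\<Sum>i\<in>UNIV. ?d $ i * partial i (log_f0 c) (l t))"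
        unfolding partial_def by (subst linear_vec_expand[OF lin]) simp
      also have "\<dots> = 0"
      proof (rule sum.neutral, rule ballI)
        fix i
        show "?d $ i * partial i (log_f0 c) (l t) = 0"
          using part[OF c img[OF that], of i] y by (cases "i \<in> B") (auto simp: plaque_def)
      qed
      finally have "?D (s *\<^sub>R ?d) = 0" for s using linear_cmul[OF lin] by simp
      moreover have "(l has_derivative (\<lambda>s. s *\<^sub>R ?d)) (at t)"
        unfolding l_def by (auto intro!: derivative_eq_intros)
      from has_derivative_compose[OF this f]
      have "((\<lambda>t. log_f0 c (l t)) has_derivative (\<lambda>s. ?D (s *\<^sub>R ?d))) (at t)" .
      ultimately have "((\<lambda>t. log_f0 c (l t)) has_derivative (\<lambda>s. 0)) (at t)" by simp
      then show ?thesis unfolding has_field_derivative_def lambda_zero .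
    qed
    have "log_f0 c (l 1) = log_f0 c (l 0)"
    proof (rule DERIV_isconst_end[where f = "\<lambda>t. log_f0 c (l t)"])
      show "continuous_on {0..1} (\<lambda>t. log_f0 c (l t))"
        by (intro continuous_at_imp_continuous_on ballI) (rule DERIV_isCont[OF D])
      show "((\<lambda>t. log_f0 c (l t)) has_real_derivative 0) (at t)" if "0 < t" "t < 1" for t
        by (rule D) (use that in simp)
    qed simp
    then have "ln (f0 y) = ln (f0 x)" using cf x yd by (simp add: l_def)
    then show ?thesis using f0_pos by simp
  qed
  have "f0 x = f0 y" if "x \<in> L" "y \<in> L" for x y
    by (rule leaf_locally_constant[OF L _ that]) (metis fol_chart_at plq)
  then show ?thesis unfolding constant_on_def by metis
qed

lemma constant_on_leaves_iff: "(\<forall>L\<in>\<F>. f0 constant_on L) \<longleftrightarrow> perp_minimal A g B \<F>"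
  unfolding perp_minimal_iff
  using partial_eq_0_if_constant_on_leaves constant_on_leaves_if_partial_eq_0 by blast

end

section \<open>Lower semicontinuity of the leaf volume\<close>

lemma finite_part_of_countable_sum:
  fixes f :: "'a \<Rightarrow> ennreal"
  assumes "countable S" and less: "a < (\<integral>\<^sup>+ x. f x \<partial>count_space S)"
  obtains F where "finite F" "F \<subseteq> S" "a < sum f F"
proof (cases "finite S")
  case True
  then show ?thesis using that[of S] less by (simp add: nn_integral_count_space_finite)
next
  case False
  let ?e = "from_nat_into S"
  have bij: "bij_betw ?e UNIV S" by (rule bij_betw_from_nat_into[OF assms(1) False])
  have "(\<integral>\<^sup>+ x. f x \<partial>count_space S) = (\<Sum>n. f (?e n))"
    using nn_integral_bij_count_space[OF bij, of f] by (simp add: nn_integral_count_space_nat)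
  also have "\<dots> = (SUP n. \<Sum>i<n. f (?e i))" by (rule suminf_eq_SUP)
  finally obtain n where "a < (\<Sum>i<n. f (?e i))" using less by (auto simp: less_SUP_iff)
  moreover have "(\<Sum>i<n. f (?e i)) = sum f (?e ` {..<n})"
    using bij by (subst sum.reindex) (auto simp: bij_betw_def intro: inj_on_subset)
  moreover have "?e ` {..<n} \<subseteq> S" using bij by (auto simp: bij_betw_def)
  ultimately show ?thesis using that[of "?e ` {..<n}"] by simp
qed

text \<open>First countability reduces semicontinuity to sequences, for which Fatou's lemma is
  available.\<close>

lemma eventually_less_if_liminf:
  fixes J :: "'a::first_countable_topology \<Rightarrow> 'b::complete_linorder"
  assumes lim: "\<And>X. X \<longlonglongrightarrow> x \<Longrightarrow> J x \<le> liminf (\<lambda>n. J (X n))" and a: "a < J x"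
  shows "\<forall>\<^sub>F y in nhds x. a < J y"
proof -
  have "\<forall>\<^sub>F y in inf (nhds x) (principal UNIV). a < J y"
  proof (rule sequentially_imp_eventually_nhds_within, intro allI impI)
    fix X :: "nat \<Rightarrow> 'a" assume "(\<forall>n. X n \<in> UNIV) \<and> X \<longlonglongrightarrow> x"
    then have "a < liminf (\<lambda>n. J (X n))" using less_le_trans[OF a lim] by blast
    then show "\<forall>\<^sub>F n in sequentially. a < J (X n)" by (rule less_LiminfD)
  qed
  then show ?thesis by simp
qed

definition transverse :: "'n set \<Rightarrow> real ^ 'n \<Rightarrow> real ^ 'n::finite" where
  "transverse B z = (\<chi> i. if i \<in> B then 0 else z $ i)"

lemma transverse_eq_iff: "transverse B z = transverse B w \<longleftrightarrow> (\<forall>i\<in>-B. z $ i = w $ i)"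
  by (auto simp: transverse_def vec_eq_iff)

lemma dist_transverse_le: "dist (transverse B z) (transverse B w) \<le> dist z w"
proof -
  have "norm (transverse B z - transverse B w) \<le> norm (z - w)"
    by (rule norm_le_componentwise_cart) (auto simp: transverse_def)
  then show ?thesis by (simp add: dist_norm)
qed

context riemannian_foliation
begin

text \<open>The value 0 outside of the open chart image keeps this lower semicontinuous across the
  boundary of the image.\<close>

definition plaque_density :: "('m, 'n) chart \<Rightarrow> ('m \<Rightarrow> real) \<Rightarrow> real ^ 'n \<Rightarrow> ennreal" where
  "plaque_density c \<psi> w = indicator (chart_img c) w * ennreal (\<psi> (chart_inv c w)) * ennreal (leaf_vol c w)"

text \<open>Only the transverse coordinates of \<open>z\<close> enter, since
  \<open>slice_point\<close> overwrites the others. Hence the integral can be studied as a function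
  on coordinate space.\<close>

definition plaque_integral :: "('m, 'n) chart \<Rightarrow> ('m \<Rightarrow> real) \<Rightarrow> real ^ 'n \<Rightarrow> ennreal" where
  "plaque_integral c \<psi> z = (\<integral>\<^sup>+ y. plaque_density c \<psi> (slice_point B z y) \<partial>Pi\<^sub>M B (\<lambda>_. lborel))"

lemma plaque_integral_eq:
  assumes "c \<in> fol_charts" "L \<in> \<F>" "x \<in> chart_dom c" "x \<in> L" "\<psi> \<in> borel_measurable borel"
  shows "(\<integral>\<^sup>+ y. ennreal (\<psi> y) * indicator (plaque B c x) y \<partial>\<nu> L) = plaque_integral c \<psi> (chart_map c x)"
  unfolding plaque_integral_def plaque_density_def
  by (rule nn_integral_plaque[OF assms(1-4)]) (intro measurable_compose[OF assms(5)] measurable_ennreal)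

lemma plaque_density_liminf:
  assumes c: "c \<in> A" and \<psi>: "continuous_on UNIV \<psi>" "\<And>x. 0 \<le> \<psi> x" and W: "W \<longlonglongrightarrow> w"
  shows "plaque_density c \<psi> w \<le> liminf (\<lambda>n. plaque_density c \<psi> (W n))"
proof (cases "w \<in> chart_img c")
  case True
  note cf = chart_facts[OF c]
  have eq: "plaque_density c \<psi> v = ennreal (\<psi> (chart_inv c v) * leaf_vol c v)" if "v \<in> chart_img c" for v
    using that \<psi>(2) leaf_vol_pos[OF c that] by (simp add: plaque_density_def ennreal_mult less_imp_le)
  have "continuous_on (chart_img c) (\<lambda>v. \<psi> (chart_inv c v) * leaf_vol c v)"
    by (intro continuous_on_mult continuous_leaf_vol c continuous_on_compose2[OF \<psi>(1) cf(4)]) auto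
  then have "isCont (\<lambda>v. \<psi> (chart_inv c v) * leaf_vol c v) w"
    using True cf(2) by (simp add: continuous_on_eq_continuous_at)
  from isCont_tendsto_compose[OF this W]
  have "(\<lambda>n. ennreal (\<psi> (chart_inv c (W n)) * leaf_vol c (W n))) \<longlonglongrightarrow> plaque_density c \<psi> w"
    unfolding eq[OF True] by (rule tendsto_ennrealI)
  moreover have "\<forall>\<^sub>F n in sequentially. W n \<in> chart_img c"
    by (rule topological_tendstoD[OF W cf(2) True])
  then have "\<forall>\<^sub>F n in sequentially. ennreal (\<psi> (chart_inv c (W n)) * leaf_vol c (W n)) = plaque_density c \<psi> (W n)"
    by eventually_elim (simp add: eq)
  ultimately have "(\<lambda>n. plaque_density c \<psi> (W n)) \<longlonglongrightarrow> plaque_density c \<psi> w"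
    by (rule Lim_transform_eventually)
  then show ?thesis by (simp add: lim_imp_Liminf)
next
  case False
  then show ?thesis by (simp add: plaque_density_def)
qed

lemma plaque_density_measurable:
  assumes c: "c \<in> A" and \<psi>: "continuous_on UNIV \<psi>" "\<And>x. 0 \<le> \<psi> x"
  shows "plaque_density c \<psi> \<in> borel_measurable borel"
proof -
  note cf = chart_facts[OF c]
  have "continuous_on (chart_img c) (\<lambda>v. \<psi> (chart_inv c v) * leaf_vol c v)"
    by (intro continuous_on_mult continuous_leaf_vol c continuous_on_compose2[OF \<psi>(1) cf(4)]) auto
  from borel_chart_img_indicator[OF c this]
  have "(\<lambda>w. indicator (chart_img c) w * ennreal (\<psi> (chart_inv c w) * leaf_vol c w)) \<in> borel_measurable borel" .
  moreover have "plaque_density c \<psi> w = indicator (chart_img c) w * ennreal (\<psi> (chart_inv c w) * leaf_vol c w)" for w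
    using \<psi>(2) leaf_vol_pos[OF c, of w]
    by (cases "w \<in> chart_img c") (simp_all add: plaque_density_def ennreal_mult less_imp_le)
  ultimately show ?thesis by (simp add: fun_eq_iff cong: measurable_cong)
qed

text \<open>Fatou's lemma. The densities are not assumed to be dominated near the boundary of the
  chart, so only the lower bound is claimed.\<close>

lemma plaque_integral_lsc:
  assumes c: "c \<in> A" and \<psi>: "continuous_on UNIV \<psi>" "\<And>x. 0 \<le> \<psi> x" and a: "a < plaque_integral c \<psi> z"
  shows "\<forall>\<^sub>F w in nhds z. a < plaque_integral c \<psi> w"
  using _ a
proof (rule eventually_less_if_liminf)
  fix X :: "nat \<Rightarrow> real ^ 'n" assume X: "X \<longlonglongrightarrow> z"
  have "(\<lambda>n. slice_point B (X n) y) \<longlonglongrightarrow> slice_point B z y" for y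
    unfolding slice_point_def
    by (intro tendsto_vec_lambda) (auto intro: tendsto_vec_nth[OF X])
  then have "plaque_integral c \<psi> z \<le>
      (\<integral>\<^sup>+ y. liminf (\<lambda>n. plaque_density c \<psi> (slice_point B (X n) y)) \<partial>Pi\<^sub>M B (\<lambda>_. lborel))"
    unfolding plaque_integral_def
    by (intro nn_integral_mono plaque_density_liminf c \<psi>)
  also have "\<dots> \<le> liminf (\<lambda>n. plaque_integral c \<psi> (X n))"
    unfolding plaque_integral_def
    by (intro nn_integral_liminf measurable_compose[OF slice_point_measurable]
        plaque_density_measurable c \<psi>)
  finally show "plaque_integral c \<psi> z \<le> liminf (\<lambda>n. plaque_integral c \<psi> (X n))" .
qed

definition leaf_integral :: "('m \<Rightarrow> real) \<Rightarrow> 'm \<Rightarrow> ennreal" where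
  "leaf_integral \<psi> x = (\<integral>\<^sup>+ y. ennreal (\<psi> y) \<partial>\<nu> (leaf_of \<F> x))"

text \<open>Finitely many plaques of a leaf persist as distinct plaques of all nearby leaves.\<close>

lemma leaf_integral_lsc:
  assumes c: "c \<in> fol_charts" and \<psi>: "continuous_on UNIV \<psi>" "\<And>x. 0 \<le> \<psi> x"
    and supp: "\<And>x. x \<notin> chart_dom c \<Longrightarrow> \<psi> x = 0"
    and a: "a < leaf_integral \<psi> x0"
  shows "\<forall>\<^sub>F x in nhds x0. a < leaf_integral \<psi> x"
proof -
  note cA = fol_charts_subset[OF c] and cf = fol_chart_facts[OF c]
  have \<psi>b: "\<psi> \<in> borel_measurable borel" by (rule borel_measurable_continuous_onI[OF \<psi>(1)])
  obtain L0 where L0: "L0 \<in> \<F>" "x0 \<in> L0" by (rule leaf_at)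
  let ?\<P> = "plaque B c ` (chart_dom c \<inter> L0)"
  define J where "J P = (\<integral>\<^sup>+ x. ennreal (\<psi> x) * indicator P x \<partial>\<nu> L0)" for P
  have "leaf_integral \<psi> x0 = (\<integral>\<^sup>+ P. J P \<partial>count_space ?\<P>)"
    unfolding leaf_integral_def leaf_of_eq[OF L0] J_def
    by (rule nn_integral_leaf_plaques[OF c L0(1)])
       (simp_all add: supp measurable_compose[OF \<psi>b measurable_ennreal])
  with a obtain F where F: "finite F" "F \<subseteq> ?\<P>" "a < sum J F"
    using finite_part_of_countable_sum[OF countable_plaques[OF L0(1) c]] by metis
  obtain r where r: "\<And>P. P \<in> F \<Longrightarrow> r P \<in> chart_dom c \<and> r P \<in> L0 \<and> P = plaque B c (r P)"
  proof -
    have "\<forall>P\<in>F. \<exists>x. x \<in> chart_dom c \<and> x \<in> L0 \<and> P = plaque B c x" using F(2) by blast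
    then show ?thesis using that by metis
  qed
  define z where "z P = chart_map c (r P)" for P
  have J: "J P = plaque_integral c \<psi> (z P)" if "P \<in> F" for P
    using plaque_integral_eq[OF c L0(1) _ _ \<psi>b, of "r P"] r[OF that] by (simp add: J_def z_def)
  \<comment> \<open>The infimum over a ball is a lower bound valid for all plaques close to the
    given one; by semicontinuity these bounds increase to at least the plaque integral.\<close>
  define S where "S P m = (INF w\<in>ball (z P) (1 / real (Suc m)). plaque_integral c \<psi> w)" for P m
  have S_inc: "incseq (S P)" for P
    unfolding S_def
    by (intro incseq_SucI INF_superset_mono subset_ball frac_le) simp_all
  have "plaque_integral c \<psi> (z P) \<le> (SUP m. S P m)" for P
  proof (rule dense_le)
    fix b assume "b < plaque_integral c \<psi> (z P)"
    from plaque_integral_lsc[OF cA \<psi> this] obtain e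
      where e: "e > 0" "\<And>w. dist w (z P) < e \<Longrightarrow> b < plaque_integral c \<psi> w"
      by (auto simp: eventually_nhds_metric)
    obtain m where "1 / real (Suc m) < e" using e(1) nat_approx_posE by blast
    then have "b \<le> S P m"
      unfolding S_def by (intro INF_greatest) (auto simp: dist_commute intro!: less_imp_le e(2))
    then show "b \<le> (SUP m. S P m)" by (rule SUP_upper2[OF UNIV_I])
  qed
  then have "sum J F \<le> (\<Sum>P\<in>F. SUP m. S P m)" by (intro sum_mono) (simp add: J)
  also have "\<dots> = (SUP m. \<Sum>P\<in>F. S P m)" by (rule ennreal_SUP_sum[symmetric]) (rule S_inc)
  finally have less: "a < (SUP m. \<Sum>P\<in>F. S P m)" using F(3) by simp
  have "incseq (\<lambda>m. \<Sum>P\<in>F. S P m)"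
    using S_inc by (auto simp: incseq_def intro!: sum_mono)
  from order_tendstoD(1)[OF LIMSEQ_SUP[OF this] less]
  have ev1: "\<forall>\<^sub>F m in sequentially. a < (\<Sum>P\<in>F. S P m)" .
  \<comment> \<open>Different plaques have different transverse coordinates. Once balls around them
    are smaller than half the transverse distance, plaques through points of different balls are
    distinct.\<close>
  have ev2: "\<forall>\<^sub>F m in sequentially. \<forall>P\<in>F. \<forall>P'\<in>F. P \<noteq> P' \<longrightarrow>
      2 * (1 / real (Suc m)) < dist (transverse B (z P)) (transverse B (z P'))"
  proof (intro eventually_ball_finite F(1) ballI)
    fix P P' assume P: "P \<in> F" "P' \<in> F"
    show "\<forall>\<^sub>F m in sequentially. P \<noteq> P' \<longrightarrow>
      2 * (1 / real (Suc m)) < dist (transverse B (z P)) (transverse B (z P'))"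
    proof (cases "P = P'")
      case False
      have "transverse B (z P) \<noteq> transverse B (z P')"
      proof
        assume "transverse B (z P) = transverse B (z P')"
        then have "r P \<in> plaque B c (r P')" using r[OF P(1), THEN conjunct1]
          by (simp add: plaque_def transverse_eq_iff z_def)
        from plaque_eq[OF this] show False using r[OF P(1)] r[OF P(2)] False by simp
      qed
      then have "0 < dist (transverse B (z P)) (transverse B (z P'))" by simp
      moreover have "(\<lambda>m. 2 * (1 / real (Suc m))) \<longlonglongrightarrow> 2 * 0"
        by (intro tendsto_mult tendsto_const LIMSEQ_Suc[OF lim_1_over_n])
      ultimately have "\<forall>\<^sub>F m in sequentially. 2 * (1 / real (Suc m)) < dist (transverse B (z P)) (transverse B (z P'))"
        by (intro order_tendstoD(2)) auto
      then show ?thesis by eventually_elim simp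
    qed simp
  qed
  from eventually_happens'[OF sequentially_bot eventually_conj[OF ev1 ev2]] obtain m where
    m: "a < (\<Sum>P\<in>F. S P m)" "\<And>P P'. P \<in> F \<Longrightarrow> P' \<in> F \<Longrightarrow> P \<noteq> P' \<Longrightarrow>
      2 * (1 / real (Suc m)) < dist (transverse B (z P)) (transverse B (z P'))" by blast
  define N where "N P = {y \<in> chart_dom c. chart_map c y \<in> ball (z P) (1 / real (Suc m))}" for P
  \<comment> \<open>Leaves that pass close to each of the finitely many chosen plaques; open because
    saturations of open sets are.\<close>
  define O' where "O' = (\<Inter>P\<in>F. saturation (N P))"
  have "open O'" unfolding O'_def N_def
    by (intro open_INT F(1) ballI open_saturation open_chart_preimage cA open_ball)
  moreover have "x0 \<in> O'"
  proof -
    have "r P \<in> L0 \<inter> N P" if "P \<in> F" for P using r[OF that] by (simp add: N_def z_def)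
    then show ?thesis unfolding O'_def using saturation_iff[OF L0] by blast
  qed
  moreover have "a < leaf_integral \<psi> x" if x: "x \<in> O'" for x
  proof -
    obtain L where L: "L \<in> \<F>" "x \<in> L" by (rule leaf_at)
    have "\<forall>P\<in>F. \<exists>y. y \<in> L \<and> y \<in> N P"
      using x saturation_iff[OF L] unfolding O'_def by blast
    then obtain y where y: "\<And>P. P \<in> F \<Longrightarrow> y P \<in> L \<and> y P \<in> N P" by metis
    have yd: "y P \<in> chart_dom c" "y P \<in> L" "dist (chart_map c (y P)) (z P) < 1 / real (Suc m)" if "P \<in> F" for P
      using y[OF that] by (auto simp: N_def dist_commute)
    have disj: "plaque B c (y P) \<inter> plaque B c (y P') = {}" if P: "P \<in> F" "P' \<in> F" "P \<noteq> P'" for P P'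
    proof (rule ccontr)
      assume "plaque B c (y P) \<inter> plaque B c (y P') \<noteq> {}"
      then have "transverse B (chart_map c (y P)) = transverse B (chart_map c (y P'))"
        by (auto simp: plaque_def transverse_eq_iff)
      moreover have "dist (transverse B (z P)) (transverse B (z P')) \<le>
          dist (transverse B (z P)) (transverse B (chart_map c (y P))) +
          dist (transverse B (chart_map c (y P))) (transverse B (z P'))" by (rule dist_triangle)
      moreover have "dist (transverse B (z P)) (transverse B (chart_map c (y P))) < 1 / real (Suc m)"
        using dist_transverse_le[of B "z P" "chart_map c (y P)"] yd(3)[OF P(1)] by (simp add: dist_commute)
      moreover have "dist (transverse B (chart_map c (y P'))) (transverse B (z P')) < 1 / real (Suc m)"
        using dist_transverse_le[of B "chart_map c (y P')" "z P'"] yd(3)[OF P(2)] by simp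
      ultimately show False using m(2)[OF P] by simp
    qed
    have "(\<Sum>P\<in>F. S P m) \<le> (\<Sum>P\<in>F. plaque_integral c \<psi> (chart_map c (y P)))"
      unfolding S_def using yd(3) by (intro sum_mono INF_lower) (simp add: dist_commute)
    also have "\<dots> = (\<Sum>P\<in>F. \<integral>\<^sup>+ v. ennreal (\<psi> v) * indicator (plaque B c (y P)) v \<partial>\<nu> L)"
      using yd by (intro sum.cong refl plaque_integral_eq[OF c L(1) _ _ \<psi>b, symmetric]) auto
    also have "\<dots> = (\<integral>\<^sup>+ v. (\<Sum>P\<in>F. ennreal (\<psi> v) * indicator (plaque B c (y P)) v) \<partial>\<nu> L)"
    proof (rule nn_integral_sum[symmetric])
      fix P
      have "(\<lambda>v. ennreal (\<psi> v) * indicator (plaque B c (y P)) v) \<in> borel_measurable borel"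
        using \<psi>b plaque_sets[OF cA] by measurable
      then show "(\<lambda>v. ennreal (\<psi> v) * indicator (plaque B c (y P)) v) \<in> borel_measurable (\<nu> L)"
        using sets_nu[OF L(1)] by (simp cong: measurable_cong_sets)
    qed
    also have "\<dots> \<le> (\<integral>\<^sup>+ v. ennreal (\<psi> v) \<partial>\<nu> L)"
    proof (rule nn_integral_mono)
      fix v
      have "(\<Sum>P\<in>F. indicator (plaque B c (y P)) v) \<le> (1::ennreal)"
      proof (cases "\<exists>P\<in>F. v \<in> plaque B c (y P)")
        case True
        then obtain P where P: "P \<in> F" "v \<in> plaque B c (y P)" by blast
        have "(\<Sum>P'\<in>F. indicator (plaque B c (y P')) v) = (\<Sum>P'\<in>F. if P' = P then 1 else (0::ennreal))"
          using P disj[OF P(1)] by (intro sum.cong refl) (auto simp: indicator_def)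
        then show ?thesis using F(1) P(1) by simp
      next
        case False
        then have "(\<Sum>P\<in>F. indicator (plaque B c (y P)) v) = (0::ennreal)"
          by (intro sum.neutral) (auto simp: indicator_def)
        then show ?thesis by simp
      qed
      then have "ennreal (\<psi> v) * (\<Sum>P\<in>F. indicator (plaque B c (y P)) v) \<le> ennreal (\<psi> v) * 1"
        by (rule mult_left_mono) simp
      then show "(\<Sum>P\<in>F. ennreal (\<psi> v) * indicator (plaque B c (y P)) v) \<le> ennreal (\<psi> v)"
        by (simp add: sum_distrib_left)
    qed
    finally show ?thesis using m(1) by (simp add: leaf_integral_def leaf_of_eq[OF L])
  qed
  ultimately show ?thesis unfolding eventually_nhds by blast
qed

text \<open>A continuous function on the chart domain is extended by 0. Continuity is glued over the
  chart domain and the complement of a compact set, which is open as the manifold is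
  Hausdorff.\<close>

lemma bump_function:
  obtains c \<phi> N where "c \<in> fol_charts" "continuous_on UNIV \<phi>" "\<And>y. 0 \<le> \<phi> y" "\<And>y. \<phi> y \<le> (1::real)"
    "\<And>y. y \<notin> chart_dom c \<Longrightarrow> \<phi> y = 0" "open N" "x \<in> N" "\<And>y. y \<in> N \<Longrightarrow> \<phi> y = 1"
proof -
  obtain c where c: "c \<in> fol_charts" "x \<in> chart_dom c" by (rule fol_chart_at)
  note cA = fol_charts_subset[OF c(1)] and cf = fol_chart_facts[OF c(1)]
  let ?z = "chart_map c x"
  obtain r where r: "r > 0" "cball ?z r \<subseteq> chart_img c"
    using cf(2) cf(8)[OF c(2)] open_contains_cball by blast
  \<comment> \<open>Equal to 1 up to distance \<open>r / 2\<close> from the centre and to 0 from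
    distance \<open>r\<close> on.\<close>
  define h where "h y = max 0 (min 1 (2 - 2 * dist (chart_map c y) ?z / r))" for y
  define \<phi> where "\<phi> y = (if y \<in> chart_dom c then h y else 0)" for y
  let ?K = "chart_inv c ` cball ?z r"
  have "compact ?K"
    by (rule compact_continuous_image[OF continuous_on_subset[OF cf(4) r(2)] compact_cball])
  then have oK: "open (- ?K)" by (simp add: compact_imp_closed open_Compl)
  have KD: "- ?K \<union> chart_dom c = UNIV" using r(2) cf(7) by auto
  have "continuous_on (chart_dom c) h"
    unfolding h_def using r(1) by (intro continuous_intros cf(3)) auto
  then have 1: "continuous_on (chart_dom c) \<phi>"
    by (rule continuous_on_eq) (simp add: \<phi>_def)
  have "\<phi> y = 0" if "y \<in> - ?K" for y
  proof (cases "y \<in> chart_dom c")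
    case True
    have "chart_map c y \<notin> cball ?z r"
    proof
      assume "chart_map c y \<in> cball ?z r"
      then have "chart_inv c (chart_map c y) \<in> ?K" by (rule imageI)
      then show False using that cf(5)[OF True] by simp
    qed
    then have "dist (chart_map c y) ?z > r" by (simp add: dist_commute)
    then have "dist (chart_map c y) ?z / r > 1" using r(1) by simp
    then show ?thesis by (simp add: \<phi>_def h_def)
  qed (simp add: \<phi>_def)
  then have 2: "continuous_on (- ?K) \<phi>" by (intro continuous_on_eq[OF continuous_on_const[of _ 0]]) simp
  have cont: "continuous_on UNIV \<phi>"
    using continuous_on_open_Un[OF oK cf(1) 2 1] KD by simp
  let ?N = "{y \<in> chart_dom c. chart_map c y \<in> ball ?z (r / 2)}"
  have "\<phi> y = 1" if "y \<in> ?N" for y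
  proof -
    have "dist (chart_map c y) ?z \<le> r / 2" using that by (simp add: dist_commute)
    then have "2 * dist (chart_map c y) ?z / r \<le> 1" using r(1) by (simp add: field_simps)
    then show ?thesis using that by (simp add: \<phi>_def h_def)
  qed
  moreover have "open ?N" by (intro open_chart_preimage cA open_ball)
  moreover have "x \<in> ?N" using c(2) r(1) by simp
  moreover have "0 \<le> \<phi> y" "\<phi> y \<le> 1" for y by (auto simp: \<phi>_def h_def)
  moreover have "\<phi> y = 0" if "y \<notin> chart_dom c" for y using that by (simp add: \<phi>_def)
  ultimately show ?thesis using that[OF c(1) cont] by blast
qed

lemma countable_bump_functions:
  obtains \<phi> :: "nat \<Rightarrow> 'm \<Rightarrow> real" and c where "\<And>n. c n \<in> fol_charts" "\<And>n. continuous_on UNIV (\<phi> n)"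
    "\<And>n y. 0 \<le> \<phi> n y" "\<And>n y. \<phi> n y \<le> 1" "\<And>n y. y \<notin> chart_dom (c n) \<Longrightarrow> \<phi> n y = 0"
    "\<And>y. \<exists>n. \<phi> n y = 1"
proof -
  define Q where "Q N c \<phi> \<longleftrightarrow> c \<in> fol_charts \<and> continuous_on UNIV \<phi> \<and> (\<forall>y. 0 \<le> \<phi> y) \<and> (\<forall>y. \<phi> y \<le> (1::real)) \<and>
    (\<forall>y. y \<notin> chart_dom c \<longrightarrow> \<phi> y = 0) \<and> (\<forall>y\<in>N. \<phi> y = 1)" for N c \<phi>
  define \<N> where "\<N> = {N. open N \<and> (\<exists>c \<phi>. Q N c \<phi>)}"
  have "\<exists>N\<in>\<N>. x \<in> N" for x
  proof -
    obtain c \<phi> N where "Q N c \<phi>" "open N" "x \<in> N"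
      by (rule bump_function[of x]) (unfold Q_def, blast)
    then show ?thesis unfolding \<N>_def by blast
  qed
  then have cov: "\<Union>\<N> = UNIV" by blast
  obtain \<N>' where N': "\<N>' \<subseteq> \<N>" "countable \<N>'" "\<Union>\<N>' = UNIV"
    using Lindelof[of \<N>] cov by (auto simp: \<N>_def)
  then have ne: "\<N>' \<noteq> {}" by auto
  let ?N = "from_nat_into \<N>'"
  have "?N n \<in> \<N>" for n using from_nat_into[OF ne] N'(1) by blast
  then have "\<forall>n. \<exists>c \<phi>. Q (?N n) c \<phi>" unfolding \<N>_def by blast
  from choice[OF this] obtain c where "\<forall>n. \<exists>\<phi>. Q (?N n) (c n) \<phi>" by blast
  from choice[OF this] obtain \<phi> where "\<forall>n. Q (?N n) (c n) (\<phi> n)" by (elim exE)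
  then have Q: "Q (?N n) (c n) (\<phi> n)" for n by (rule spec)
  have "\<exists>n. \<phi> n y = 1" for y
  proof -
    have "y \<in> \<Union>\<N>'" using N'(3) by simp
    then obtain N where N: "N \<in> \<N>'" "y \<in> N" by (rule UnionE)
    from from_nat_into_surj[OF N'(2) N(1)] obtain n where "?N n = N" by (elim exE)
    then have "y \<in> ?N n" using N(2) by simp
    then have "\<phi> n y = 1" using Q[of n] unfolding Q_def by simp
    then show ?thesis by (rule exI)
  qed
  moreover have "c n \<in> fol_charts" "continuous_on UNIV (\<phi> n)" "0 \<le> \<phi> n y" "\<phi> n y \<le> 1"
    "y \<notin> chart_dom (c n) \<Longrightarrow> \<phi> n y = 0" for n y
    using Q[of n] unfolding Q_def by simp_all
  ultimately show ?thesis by (intro that[of c \<phi>])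
qed

text \<open>A countable partition of unity by functions supported in foliated charts writes the leaf
  volume as a sum of lower semicontinuous leaf integrals.\<close>

lemma hat_one_lsc:
  assumes a: "a < hat_one \<nu> \<F> x0"
  shows "\<forall>\<^sub>F x in nhds x0. a < hat_one \<nu> \<F> x"
proof -
  obtain \<phi> :: "nat \<Rightarrow> 'm \<Rightarrow> real" and c where \<phi>: "\<And>n. c n \<in> fol_charts" "\<And>n. continuous_on UNIV (\<phi> n)"
    "\<And>n y. 0 \<le> \<phi> n y" "\<And>n y. \<phi> n y \<le> 1" "\<And>n y. y \<notin> chart_dom (c n) \<Longrightarrow> \<phi> n y = 0"
    "\<And>y. \<exists>n. \<phi> n y = 1" by (rule countable_bump_functions) blast
  \<comment> \<open>Partial sums telescope to 1 minus a product, and the product vanishes as soon as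
    some bump function equals 1 at the point.\<close>
  define \<psi> where "\<psi> n y = \<phi> n y * (\<Prod>i<n. 1 - \<phi> i y)" for n y
  have cont: "continuous_on UNIV (\<psi> n)" for n
    unfolding \<psi>_def by (intro continuous_intros \<phi>(2))
  have nn: "0 \<le> \<psi> n y" for n y
    unfolding \<psi>_def using \<phi>(3,4) by (intro mult_nonneg_nonneg prod_nonneg) auto
  have part: "(\<Sum>i<n. \<psi> i y) = 1 - (\<Prod>i<n. 1 - \<phi> i y)" for n y
    by (induction n) (simp_all add: \<psi>_def algebra_simps)
  have one: "(\<Sum>n. ennreal (\<psi> n y)) = 1" for y
  proof -
    obtain k where k: "\<phi> k y = 1" using \<phi>(6) by blast
    have "(\<Sum>i<n. \<psi> i y) = 1" if "n \<ge> Suc k" for n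
    proof -
      have "(\<Prod>i<n. 1 - \<phi> i y) = 0" using k that by (intro prod_zero) (auto intro!: bexI[of _ k])
      then show ?thesis by (simp add: part)
    qed
    then have "\<forall>\<^sub>F n in sequentially. 1 = (\<Sum>i<n. \<psi> i y)"
      by (auto simp: eventually_sequentially)
    then have "(\<lambda>n. \<Sum>i<n. \<psi> i y) \<longlonglongrightarrow> 1" by (rule Lim_transform_eventually[OF tendsto_const])
    then have "(\<lambda>n. \<psi> n y) sums 1" by (simp add: sums_def)
    from suminf_ennreal_eq[OF nn this] show ?thesis by simp
  qed
  have tot: "hat_one \<nu> \<F> x = (\<integral>\<^sup>+ n. leaf_integral (\<psi> n) x \<partial>count_space UNIV)" for x
  proof -
    obtain L where L: "L \<in> \<F>" "x \<in> L" by (rule leaf_at)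
    have m: "(\<lambda>y. ennreal (\<psi> n y)) \<in> borel_measurable (\<nu> L)" for n
      using measurable_compose[OF borel_measurable_continuous_onI[OF cont] measurable_ennreal] sets_nu[OF L(1)]
      by (simp cong: measurable_cong_sets)
    have "hat_one \<nu> \<F> x = (\<integral>\<^sup>+ y. (\<Sum>n. ennreal (\<psi> n y)) \<partial>\<nu> L)"
      by (simp only: hat_one_def leaf_of_eq[OF L] one)
    also have "\<dots> = (\<Sum>n. \<integral>\<^sup>+ y. ennreal (\<psi> n y) \<partial>\<nu> L)" by (rule nn_integral_suminf[OF m])
    finally show ?thesis by (simp add: nn_integral_count_space_nat leaf_integral_def leaf_of_eq[OF L])
  qed
  show ?thesis using _ a
  proof (rule eventually_less_if_liminf)
    fix X :: "nat \<Rightarrow> 'm" assume X: "X \<longlonglongrightarrow> x0"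
    have "leaf_integral (\<psi> n) x0 \<le> liminf (\<lambda>k. leaf_integral (\<psi> n) (X k))" for n
      unfolding le_Liminf_iff
    proof (intro allI impI)
      fix b assume b: "b < leaf_integral (\<psi> n) x0"
      have "\<psi> n x = 0" if "x \<notin> chart_dom (c n)" for x using \<phi>(5)[OF that] by (simp add: \<psi>_def)
      from leaf_integral_lsc[OF \<phi>(1) cont nn this b]
      show "\<forall>\<^sub>F k in sequentially. b < leaf_integral (\<psi> n) (X k)"
        by (rule eventually_compose_filterlim[OF _ X])
    qed
    then have "hat_one \<nu> \<F> x0 \<le> (\<integral>\<^sup>+ n. liminf (\<lambda>k. leaf_integral (\<psi> n) (X k)) \<partial>count_space UNIV)"
      unfolding tot by (intro nn_integral_mono)
    \<comment> \<open>Fatou's lemma for counting measure: a countable sum of nonnegative lower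
      semicontinuous functions is lower semicontinuous.\<close>
    also have "\<dots> \<le> liminf (\<lambda>k. \<integral>\<^sup>+ n. leaf_integral (\<psi> n) (X k) \<partial>count_space UNIV)"
      by (rule nn_integral_liminf) simp
    finally show "hat_one \<nu> \<F> x0 \<le> liminf (\<lambda>k. hat_one \<nu> \<F> (X k))" unfolding tot .
  qed
qed

end

context extremal_foliation
begin

text \<open>Where the integral of \<open>f\<^sub>0\<close> over the leaves exceeds \<open>1\<close>, which by semicontinuity is an open
  saturated set, \<open>f\<^sub>0\<close> could be scaled down.\<close>

lemma leaf_mass_le_1:
  assumes const: "\<forall>L\<in>\<F>. f0 constant_on L"
  shows "ennreal (f0 x0) * hat_one \<nu> \<F> x0 \<le> 1"
proof (rule ccontr)
  assume "\<not> ?thesis"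
  then have gt: "1 < ennreal (f0 x0) * hat_one \<nu> \<F> x0" by simp
  have "ennreal (1 / f0 x0) < hat_one \<nu> \<F> x0"
  proof (rule ccontr)
    assume "\<not> ?thesis"
    then have "ennreal (f0 x0) * hat_one \<nu> \<F> x0 \<le> ennreal (f0 x0) * ennreal (1 / f0 x0)"
      by (intro mult_left_mono) auto
    also have "\<dots> = 1" using f0_pos[of x0] by (simp add: ennreal_mult[symmetric] less_imp_le)
    finally show False using gt by simp
  qed
  \<comment> \<open>An intermediate value is finite even if the leaf volume is not.\<close>
  from dense[OF this] obtain b' where b': "ennreal (1 / f0 x0) < b'" "b' < hat_one \<nu> \<F> x0" by blast
  then obtain b where b: "b' = ennreal b" "b \<ge> 0" by (cases b') (auto simp: top.not_eq_extremum)
  then have b1: "1 / f0 x0 < b" using b'(1) f0_pos[of x0] by (simp add: ennreal_less_iff less_imp_le)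
  then have "1 < f0 x0 * b" using f0_pos[of x0] by (simp add: field_simps)
  moreover have bpos: "b > 0" using b1 f0_pos[of x0] by (meson divide_pos_pos less_trans zero_less_one)
  ultimately have "1 / (f0 x0 * b) < 1" "0 < 1 / (f0 x0 * b)" using f0_pos[of x0] by auto
  then obtain \<theta> where \<theta>: "1 / (f0 x0 * b) < \<theta>" "\<theta> < 1" using dense by blast
  have "0 < \<theta>" using \<open>0 < 1 / (f0 x0 * b)\<close> \<theta>(1) by (rule less_trans)
  note \<theta> = \<theta> this
  \<comment> \<open>On a leaf in \<open>U\<close> the scaled function still has mass at least
    \<open>\<theta> * f0 x * b\<close>, which exceeds 1, so scaling by \<theta> preserves
    admissibility. Both conditions are open, and both are constant on leaves.\<close>
  define U where "U = {x. ennreal b < hat_one \<nu> \<F> x} \<inter> {x. 1 < \<theta> * f0 x * b}"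
  have "open {x. ennreal b < hat_one \<nu> \<F> x}"
  proof (subst open_subopen, rule ballI)
    fix x assume "x \<in> {x. ennreal b < hat_one \<nu> \<F> x}"
    then have "\<forall>\<^sub>F y in nhds x. ennreal b < hat_one \<nu> \<F> y" by (intro hat_one_lsc) simp
    then obtain S where S: "open S" "x \<in> S" "\<forall>y\<in>S. ennreal b < hat_one \<nu> \<F> y"
      unfolding eventually_nhds by (elim exE conjE)
    show "\<exists>T. open T \<and> x \<in> T \<and> T \<subseteq> {x. ennreal b < hat_one \<nu> \<F> x}"
      by (rule exI[of _ S]) (use S in simp, rule subsetI, simp)
  qed
  moreover have "open {x. 1 < \<theta> * f0 x * b}"
    by (intro open_Collect_less continuous_intros f0_continuous)
  ultimately have U: "open U" unfolding U_def by (rule open_Int)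
  have x0: "x0 \<in> U"
    using b' b \<theta> f0_pos[of x0] bpos by (simp add: U_def field_simps)
  have sat: "x \<in> U \<longleftrightarrow> y \<in> U" if "L \<in> \<F>" "x \<in> L" "y \<in> L" for L x y
  proof -
    have "f0 x = f0 y" using const that by (metis constant_on_def)
    moreover have "hat_one \<nu> \<F> x = hat_one \<nu> \<F> y"
      using that by (simp add: hat_one_def leaf_of_eq)
    ultimately show ?thesis by (simp add: U_def)
  qed
  define f where "f x = (if x \<in> U then \<theta> * f0 x else f0 x)" for x
  have fm: "f \<in> borel_measurable borel"
    unfolding f_def using U f0_borel by (intro measurable_If_set) (auto intro: borel_open)
  have fpos: "0 < f x" and fle: "f x \<le> f0 x" for x
    using \<theta> f0_pos[of x] by (auto simp: f_def mult_le_cancel_right1)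
  have fp: "f x powr p \<le> f0 x powr p" for x
    using fpos[of x] fle[of x] p by (intro powr_mono2) auto
  have fi: "integrable (completion \<mu>) (\<lambda>x. f x powr p)"
  proof (rule Bochner_Integration.integrable_bound[OF f0_powr_integrable])
    show "(\<lambda>x. f x powr p) \<in> borel_measurable (completion \<mu>)"
      using completion_borel[OF fm] by measurable
    show "AE x in completion \<mu>. norm (f x powr p) \<le> norm (f0 x powr p)" using fp by simp
  qed
  have leaf: "1 \<le> (\<integral>\<^sup>+ x. ennreal (f x) \<partial>\<nu> L)" if L: "L \<in> \<F>" and 1: "1 \<le> (\<integral>\<^sup>+ x. ennreal (f0 x) \<partial>\<nu> L)" for L
  proof -
    have "L \<noteq> {}" using L foliation unfolding foliation_def by metis
    then obtain x where x: "x \<in> L" by blast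
    show ?thesis
    proof (cases "x \<in> U")
      case True
      have "f y = \<theta> * f0 x" if "y \<in> L" for y
        using sat[OF L x that] True const L x that by (auto simp: f_def constant_on_def)
      then have I: "(\<integral>\<^sup>+ y. ennreal (f y) \<partial>\<nu> L) = (\<integral>\<^sup>+ y. ennreal (\<theta> * f0 x) \<partial>\<nu> L)"
        using AE_in_leaf[OF L] by (intro nn_integral_cong_AE) (auto elim: eventually_mono)
      have "1 \<le> ennreal (\<theta> * f0 x * b)" using True by (simp add: U_def)
      also have "\<dots> = ennreal (\<theta> * f0 x) * ennreal b"
        using \<theta> f0_pos[of x] bpos by (simp add: ennreal_mult)
      also have "\<dots> \<le> ennreal (\<theta> * f0 x) * hat_one \<nu> \<F> x"
        using True by (intro mult_left_mono) (auto simp: U_def)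
      also have "\<dots> = (\<integral>\<^sup>+ y. ennreal (f y) \<partial>\<nu> L)"
        unfolding I by (simp add: hat_one_def leaf_of_eq[OF L x])
      finally show ?thesis .
    next
      case False
      have "f y = f0 y" if "y \<in> L" for y
        using sat[OF L x that] False by (simp add: f_def)
      then have "(\<integral>\<^sup>+ y. ennreal (f y) \<partial>\<nu> L) = (\<integral>\<^sup>+ y. ennreal (f0 y) \<partial>\<nu> L)"
        using AE_in_leaf[OF L] by (intro nn_integral_cong_AE) (auto elim: eventually_mono)
      then show ?thesis using 1 by simp
    qed
  qed
  have "f \<in> adm \<mu> \<nu> \<F> p"
    unfolding adm_def in_Lp_def
  proof (intro CollectI conjI allI)
    show "f \<in> borel_measurable (completion \<mu>)" by (rule completion_borel[OF fm])
    show "integrable (completion \<mu>) (\<lambda>x. \<bar>f x\<bar> powr p)"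
      using fi fpos by (simp add: abs_of_pos)
    show "0 \<le> f x" for x using fpos[of x] by simp
    show "almost_every_leaf \<mu> \<F> (\<lambda>L. 1 \<le> (\<integral>\<^sup>+ x. ennreal (f x) \<partial>\<nu> L))"
      by (rule almost_every_leaf_mono[of \<mu> \<F> "\<lambda>L. 1 \<le> (\<integral>\<^sup>+ x. ennreal (f0 x) \<partial>\<nu> L)"])
         (use f0_adm leaf in \<open>auto simp: adm_def\<close>)
  qed
  then have "(\<integral>x. f0 x powr p \<partial>completion \<mu>) \<le> (\<integral>x. f x powr p \<partial>completion \<mu>)"
    by (rule extremal_integral_le)
  moreover have "(\<integral>x. f x powr p \<partial>completion \<mu>) \<le> (\<integral>x. f0 x powr p \<partial>completion \<mu>)"
    by (rule integral_mono[OF fi f0_powr_integrable fp])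
  ultimately have "(\<integral>x. f0 x powr p - f x powr p \<partial>completion \<mu>) = 0"
    using fi f0_powr_integrable by simp
  then have "AE x in completion \<mu>. f0 x powr p - f x powr p = 0"
    using fp by (subst (asm) integral_nonneg_eq_0_iff_AE)
      (auto intro: Bochner_Integration.integrable_diff fi f0_powr_integrable)
  then have "AE x in completion \<mu>. x \<notin> U"
  proof eventually_elim
    case (elim x)
    show ?case
    proof
      assume "x \<in> U"
      then have "f x < f0 x" using \<theta> f0_pos[of x] by (simp add: f_def)
      then have "f x powr p < f0 x powr p" using fpos[of x] p by (intro powr_less_mono2) auto
      then show False using elim by simp
    qed
  qed
  then have "AE x in \<mu>. x \<notin> U" by (simp add: AE_completion_iff)
  then have "U \<in> null_sets \<mu>" using U by (subst AE_iff_null_sets) (auto simp: sets_mu)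
  then have "emeasure \<mu> U = 0" by (rule null_setsD1)
  moreover have "U \<noteq> {}" using x0 by blast
  ultimately show False using emeasure_mu_open_pos[OF U] by simp
qed

text \<open>The integral of \<open>f0\<close> over a leaf is the constant value times the leaf
  volume. It is at least 1 on almost every leaf by admissibility and at most 1 on every leaf by
  \<open>leaf_mass_le_1\<close>.\<close>

lemma eq_inverse_hat_one:
  assumes const: "\<forall>L\<in>\<F>. f0 constant_on L"
  shows "almost_every_leaf \<mu> \<F> (\<lambda>L. \<forall>x\<in>L. ennreal (f0 x) = 1 / hat_one \<nu> \<F> x)"
proof (rule almost_every_leaf_mono[of \<mu> \<F> "\<lambda>L. 1 \<le> (\<integral>\<^sup>+ x. ennreal (f0 x) \<partial>\<nu> L)"])
  show "almost_every_leaf \<mu> \<F> (\<lambda>L. 1 \<le> (\<integral>\<^sup>+ x. ennreal (f0 x) \<partial>\<nu> L))"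
    using f0_adm by (simp add: adm_def)
  fix L assume L: "L \<in> \<F>" and 1: "1 \<le> (\<integral>\<^sup>+ x. ennreal (f0 x) \<partial>\<nu> L)"
  note ae = AE_in_leaf[OF L]
  show "\<forall>x\<in>L. ennreal (f0 x) = 1 / hat_one \<nu> \<F> x"
  proof
    fix x assume x: "x \<in> L"
    have "f0 y = f0 x" if "y \<in> L" for y using const L x that by (metis constant_on_def)
    then have "(\<integral>\<^sup>+ y. ennreal (f0 y) \<partial>\<nu> L) = (\<integral>\<^sup>+ y. ennreal (f0 x) \<partial>\<nu> L)"
      using ae by (intro nn_integral_cong_AE) (auto elim: eventually_mono)
    also have "\<dots> = ennreal (f0 x) * hat_one \<nu> \<F> x"
      by (simp add: hat_one_def leaf_of_eq[OF L x])
    finally have eq: "ennreal (f0 x) * hat_one \<nu> \<F> x = 1"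
      using 1 leaf_mass_le_1[OF const, of x] by simp
    then have "hat_one \<nu> \<F> x \<noteq> 0" "hat_one \<nu> \<F> x \<noteq> top"
      using f0_pos[of x] by (auto simp: ennreal_mult_top)
    then show "ennreal (f0 x) = 1 / hat_one \<nu> \<F> x"
      using eq by (metis ennreal_mult_divide_eq)
  qed
qed

end

theorem corollary4p4:
  fixes A :: "('m::{t2_space, second_countable_topology}, 'n::finite) chart set"
    and g :: "('m, 'n) metric"
    and B :: "'n set"
    and \<F> :: "'m set set"
    and \<mu> :: "'m measure"
    and \<nu> :: "'m set \<Rightarrow> 'm measure"
    and p :: real
    and f0 :: "'m \<Rightarrow> real"
  assumes "smooth_structure A"
    and "riemannian_metric A g"
    and "foliation A B \<F>"
    and "\<forall>L\<in>\<F>. closed L"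
    and "riemannian_volume A g \<mu>"
    and "\<forall>L\<in>\<F>. leaf_volume A g B \<F> L (\<nu> L)"
    and "p > 1"
    and "extremal \<mu> \<nu> \<F> p f0"
    and "Ck_fun A 2 f0"
    and "essinf \<mu> f0 > 0"
  shows "(\<forall>c\<in>foliated_charts A B \<F>. \<forall>z\<in>chart_img c.
            mean_curv_perp B g c z =
              (p - 1) *\<^sub>R tangential B g c z (gradient g c (\<lambda>x. ln (f0 x)) z)) \<and>
         ((\<forall>L\<in>\<F>. f0 constant_on L) \<longleftrightarrow> perp_minimal A g B \<F>) \<and>
         ((\<forall>L\<in>\<F>. f0 constant_on L) \<longrightarrow>
            almost_every_leaf \<mu> \<F> (\<lambda>L. \<forall>x\<in>L. ennreal (f0 x) = 1 / hat_one \<nu> \<F> x))"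
proof -
  interpret extremal_foliation A B \<F> g \<mu> \<nu> p f0
    using assms by unfold_locales
  show ?thesis
    using mean_curv_perp_formula constant_on_leaves_iff eq_inverse_hat_one by blast
qed

end
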